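(* Let $U,V,K,\Pi$ be vector bundles over $M$ and let $$(1)\quad 0\to U\otimes V\xrightarrow{i}\Pi\xrightarrow{j}K\to0$$ be a DVB$^*$ sequence. Let $$(2)\quad 0\to U\otimes K^*\xrightarrow{e}\Pi^*_U\xrightarrow{p}V^*\to0$$ be the $U$-dual of (1), let $$(3)\quad 0\to V\otimes K^*\xrightarrow{r}(\Pi^*_U)^*_{K^*}\xrightarrow{q}U^*\to0$$ be the $K^*$-dual of (2), and let $$(4)\quad 0\to V\otimes U\xrightarrow{i^t}\Pi\xrightarrow{j}K\to0,\qquad i^t(v\otimes u)=-i(u\otimes v),$$ be the transposition of (1). Then the DVB$^*$ sequences (3) and (4) are in $V$-duality. (In other words: (1) and (2) are in $U$-duality, (2) and (3) are in $K^*$-duality, (3) and (4) are in $V$-duality, and (4) is the transposition of (1).)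
   Context: All vector bundles are real, smooth, of finite rank over the base $M$. A DVB$^*$ sequence is a short exact sequence of vector bundles over $M$ of the form $0\to U\otimes V\to\Pi\to K\to0$; $U$ and $V$ are called the side bundles. For a tensor $\theta$ in a tensor product of two bundles, $\alpha\lrcorner\,\theta$ denotes contraction of $\theta$ with $\alpha$ in the factor dual to that containing $\alpha$ (e.g. $v^*\lrcorner\,\theta\in U$ for $v^*\in V^*$, $\theta\in U\otimes V$). In the notion of duality with respect to a side bundle, the order of the tensor factors is immaterial: $X\otimes Y$ and $Y\otimes X$ are identified by the flip $x\otimes y\leftrightarrow y\otimes x$ (without sign). $U$-duality: DVB$^*$ sequences $0\to U\otimes V\xrightarrow{i}\Pi\xrightarrow{j}K\to0$ and $0\to U\otimes K^*\xrightarrow{e}\Delta\xrightarrow{p}V^*\to0$ are in $U$-duality if there is a bilinear pairing $\{\cdot,\cdot\}_U:\Delta\times_M\Pi\to U$ with $$\{\epsilon,i(\theta)\}_U=p(\epsilon)\lrcorner\,\theta\quad(\epsilon\in\Delta,\ \theta\in U\otimes V),\qquad\{e(\kappa),\sigma\}_U=j(\sigma)\lrcorner\,\kappa\quad(\sigma\in\Pi,\ \kappa\in U\otimes K^* ).$$ The $U$-dual: given $0\to U\otimes V\xrightarrow{i}\Pi\xrightarrow{j}K\to0$, $\Pi^*_U$ is the pull-back of $V^*$ (embedded as $v^*\mapsto\mathrm{Id}_U\otimes v^*\in U\otimes U^*\otimes V^*$) along $\mathrm{Id}_U\otimes i^*:U\otimes\Pi^*\to U\otimes U^*\otimes V^*$;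 fibrewise it consists of those $\epsilon\in\mathrm{Hom}(\Pi_m,U_m)$, together with $v^*\in V^*_m$, such that $\epsilon(i(\theta))=v^*\lrcorner\,\theta$ for all $\theta\in U_m\otimes V_m$. The map $p$ sends $\epsilon$ to $v^*$, and $e=\mathrm{Id}_U\otimes j^*$, i.e. $e(\kappa)(\sigma)=j(\sigma)\lrcorner\,\kappa$ (with $v^*=0$). The $K^*$-dual of (2) is obtained by the same construction applied to (2) with the side bundle $K^*$ playing the role of $U$ (and $U$ the role of $V$, $V^*$ the role of $K$). *)

theory Defs
  imports "HOL-Analysis.Analysis" "HOL-Library.Function_Algebras"
begin

section \<open>Linear algebra on subspaces\<close>

instantiation "fun" :: (type, real_vector) real_vector
begin

definition scaleR_fun_def: "c *\<^sub>R f = (\<lambda>x. c *\<^sub>R f x)"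

instance
  by standard (simp_all add: scaleR_fun_def fun_eq_iff scaleR_add_right scaleR_add_left)

end

text \<open>Vector spaces (the fibres of bundles) are subspaces of ambient real vector spaces.
  Functions with a subspace as domain are set to zero outside of it, so that the elements of
  \<open>dual_space S\<close>, \<open>hom_space S T\<close> and \<open>tensor_space S T\<close> are determined by their restrictions.\<close>

definition linear_from_to ::
    "'a::real_vector set \<Rightarrow> 'b::real_vector set \<Rightarrow> ('a \<Rightarrow> 'b) \<Rightarrow> bool" where
  "linear_from_to S T f \<longleftrightarrow>
     (\<forall>x\<in>S. f x \<in> T) \<and> (\<forall>x\<in>S. \<forall>y\<in>S. f (x + y) = f x + f y) \<and> (\<forall>c. \<forall>x\<in>S. f (c *\<^sub>R x) = c *\<^sub>R f x)"

definition restrict0 :: "'a set \<Rightarrow> ('a \<Rightarrow> 'b::zero) \<Rightarrow> 'a \<Rightarrow> 'b" where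
  "restrict0 S f = (\<lambda>x. if x \<in> S then f x else 0)"

definition hom_space :: "'a::real_vector set \<Rightarrow> 'b::real_vector set \<Rightarrow> ('a \<Rightarrow> 'b) set" where
  "hom_space S T = {f. linear_from_to S T f \<and> (\<forall>x. x \<notin> S \<longrightarrow> f x = 0)}"

definition dual_space :: "'a::real_vector set \<Rightarrow> ('a \<Rightarrow> real) set" where
  "dual_space S = hom_space S UNIV"

text \<open>The canonical map from a vector space to its bidual.\<close>

definition bidual_embed :: "'a::real_vector set \<Rightarrow> 'a \<Rightarrow> (('a \<Rightarrow> real) \<Rightarrow> real)" where
  "bidual_embed S x = restrict0 (dual_space S) (\<lambda>\<alpha>. \<alpha> x)"

text \<open>The tensor product of two finite-dimensional vector spaces is modelled as the space of
  bilinear forms on the product of their duals.\<close>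

type_synonym ('a, 'b) tensor = "('a \<Rightarrow> real) \<Rightarrow> ('b \<Rightarrow> real) \<Rightarrow> real"

definition tensor_space ::
    "'a::real_vector set \<Rightarrow> 'b::real_vector set \<Rightarrow> ('a, 'b) tensor set" where
  "tensor_space S T = {\<theta>.
     (\<forall>\<beta>\<in>dual_space T. linear_from_to (dual_space S) UNIV (\<lambda>\<alpha>. \<theta> \<alpha> \<beta>)) \<and>
     (\<forall>\<alpha>\<in>dual_space S. linear_from_to (dual_space T) UNIV (\<theta> \<alpha>)) \<and>
     (\<forall>\<alpha> \<beta>. \<alpha> \<notin> dual_space S \<or> \<beta> \<notin> dual_space T \<longrightarrow> \<theta> \<alpha> \<beta> = 0)}"

definition tensor ::
    "'a::real_vector set \<Rightarrow> 'b::real_vector set \<Rightarrow> 'a \<Rightarrow> 'b \<Rightarrow> ('a, 'b) tensor" where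
  "tensor S T x y =
     (\<lambda>\<alpha> \<beta>. if \<alpha> \<in> dual_space S \<and> \<beta> \<in> dual_space T then \<alpha> x * \<beta> y else 0)"

definition flip :: "('a, 'b) tensor \<Rightarrow> ('b, 'a) tensor" where
  "flip \<theta> = (\<lambda>\<beta> \<alpha>. \<theta> \<alpha> \<beta>)"

text \<open>Contraction of \<open>\<theta>\<close> in \<open>S \<otimes> T\<close> with \<open>\<beta>\<close> in the dual of \<open>T\<close>: the element of \<open>S\<close> that
  corresponds to \<open>\<lambda>\<alpha>. \<theta> \<alpha> \<beta>\<close> in the bidual of \<open>S\<close>. If \<open>T\<close> is itself the dual of \<open>R\<close>,
  the contraction with \<open>x\<close> in \<open>R\<close> is the contraction with \<open>bidual_embed R x\<close>.\<close>

definition contract :: "'a::real_vector set \<Rightarrow> ('b \<Rightarrow> real) \<Rightarrow> ('a, 'b) tensor \<Rightarrow> 'a" where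
  "contract S \<beta> \<theta> = (THE x. x \<in> S \<and> (\<forall>\<alpha>\<in>dual_space S. \<alpha> x = \<theta> \<alpha> \<beta>))"

lemma flip_tensor: "flip (tensor S T x y) = tensor T S y x"
  by (auto simp: flip_def tensor_def fun_eq_iff)

lemma dual_space_separates:
  assumes "subspace S" "x \<in> S" "\<And>\<alpha>. \<alpha> \<in> dual_space S \<Longrightarrow> \<alpha> x = 0"
  shows "x = 0"
proof (rule ccontr)
  assume "x \<noteq> 0"
  then have "independent {x}" by (simp add: dependent_single)
  then obtain g :: "'a \<Rightarrow> real" where g: "linear g" "g x = 1"
    using linear_independent_extend[of "{x}" "\<lambda>_. 1 :: real"] by auto
  have "restrict0 S g \<in> dual_space S"
    using assms(1) g(1)
    by (auto simp: dual_space_def hom_space_def restrict0_def linear_from_to_def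
        subspace_add subspace_scale linear_add linear_scale)
  from assms(3)[OF this] assms(2) g(2) show False by (simp add: restrict0_def)
qed

lemma contract_tensor:
  assumes "subspace S" "x \<in> S" "\<beta> \<in> dual_space T"
  shows "contract S \<beta> (tensor S T x y) = \<beta> y *\<^sub>R x"
  unfolding contract_def
proof (rule the_equality)
  have scale: "\<alpha> (c *\<^sub>R x) = c * \<alpha> x" if "\<alpha> \<in> dual_space S" for \<alpha> c
    using that assms(2) by (simp add: dual_space_def hom_space_def linear_from_to_def)
  show 1: "\<beta> y *\<^sub>R x \<in> S \<and> (\<forall>\<alpha>\<in>dual_space S. \<alpha> (\<beta> y *\<^sub>R x) = tensor S T x y \<alpha> \<beta>)"
    using assms by (simp add: tensor_def scale subspace_scale)
  fix z assume z: "z \<in> S \<and> (\<forall>\<alpha>\<in>dual_space S. \<alpha> z = tensor S T x y \<alpha> \<beta>)"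
  have "z - \<beta> y *\<^sub>R x = 0"
  proof (rule dual_space_separates[OF assms(1)])
    show "z - \<beta> y *\<^sub>R x \<in> S" using 1 z assms(1) by (simp add: subspace_diff)
    fix \<alpha> assume a: "\<alpha> \<in> dual_space S"
    then have "\<alpha> (z - \<beta> y *\<^sub>R x + \<beta> y *\<^sub>R x) = \<alpha> (z - \<beta> y *\<^sub>R x) + \<alpha> (\<beta> y *\<^sub>R x)"
      using 1 \<open>z - \<beta> y *\<^sub>R x \<in> S\<close>
      unfolding dual_space_def hom_space_def linear_from_to_def by blast
    moreover have "\<alpha> z = \<alpha> (\<beta> y *\<^sub>R x)" using 1 z a by metis
    ultimately show "\<alpha> (z - \<beta> y *\<^sub>R x) = 0" by simp
  qed
  then show "z = \<beta> y *\<^sub>R x" by simp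
qed

section \<open>Smooth manifolds\<close>

primrec C_k_on ::
    "nat \<Rightarrow> 'a::real_normed_vector set \<Rightarrow> ('a \<Rightarrow> 'b::real_normed_vector) \<Rightarrow> bool" where
  "C_k_on 0 S f \<longleftrightarrow> continuous_on S f"
| "C_k_on (Suc k) S f \<longleftrightarrow>
     (\<forall>x\<in>S. f differentiable (at x)) \<and> (\<forall>v. C_k_on k S (\<lambda>x. frechet_derivative f (at x) v))"

text \<open>Only used for open subsets \<open>S\<close> of finite-dimensional spaces.\<close>

definition smooth_on :: "'a::real_normed_vector set \<Rightarrow> ('a \<Rightarrow> 'b::real_normed_vector) \<Rightarrow> bool" where
  "smooth_on S f \<longleftrightarrow> (\<forall>k. C_k_on k S f)"

text \<open>An atlas is a set of charts, each given by its domain and the coordinate map. The manifold is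
  the whole type \<open>'m\<close>. The model space \<open>'b\<close> is not required to be in \<open>euclidean_space\<close>
  because that class excludes dimension 0.\<close>

type_synonym ('m, 'b) atlas = "('m set \<times> ('m \<Rightarrow> 'b)) set"

definition smooth_manifold ::
    "('m::{t2_space,second_countable_topology}, 'b::real_normed_vector) atlas \<Rightarrow> bool" where
  "smooth_manifold A \<longleftrightarrow>
     (\<exists>B :: 'b set. finite B \<and> span B = UNIV) \<and>
     (\<Union>(D, \<phi>)\<in>A. D) = UNIV \<and>
     (\<forall>(D, \<phi>)\<in>A. open D \<and> open (\<phi> ` D) \<and> homeomorphism D (\<phi> ` D) \<phi> (inv_into D \<phi>)) \<and>
     (\<forall>(D, \<phi>)\<in>A. \<forall>(D', \<phi>')\<in>A. smooth_on (\<phi> ` (D \<inter> D')) (\<phi>' \<circ> inv_into D \<phi>))"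

definition smooth_fun ::
    "('m, 'b::real_normed_vector) atlas \<Rightarrow> 'm set \<Rightarrow> ('m \<Rightarrow> real) \<Rightarrow> bool" where
  "smooth_fun A W f \<longleftrightarrow> (\<forall>(D, \<phi>)\<in>A. smooth_on (\<phi> ` (W \<inter> D)) (f \<circ> inv_into D \<phi>))"

section \<open>Smooth vector bundles\<close>

text \<open>A vector bundle is given by its fibres and a vector bundle atlas. A local trivialisation over
  \<open>W\<close> of rank \<open>r\<close> is encoded as the corresponding local frame \<open>(W, r, s)\<close>, where \<open>s 0, \<dots>, s (r - 1)\<close>
  are the sections over \<open>W\<close> that form the image of the standard basis of \<open>\<real>\<^sup>r\<close> in each fibre. The
  rank may vary between components of the base.\<close>

record ('m, 'e) vbundle =
  fibre :: "'m \<Rightarrow> 'e set"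
  frames :: "('m set \<times> nat \<times> (nat \<Rightarrow> 'm \<Rightarrow> 'e)) set"

definition is_frame ::
    "('m \<Rightarrow> 'e::real_vector set) \<Rightarrow> 'm set \<Rightarrow> nat \<Rightarrow> (nat \<Rightarrow> 'm \<Rightarrow> 'e) \<Rightarrow> bool" where
  "is_frame F W r s \<longleftrightarrow> (\<forall>m\<in>W. inj_on (\<lambda>i. s i m) {..<r} \<and>
     independent ((\<lambda>i. s i m) ` {..<r}) \<and> span ((\<lambda>i. s i m) ` {..<r}) = F m)"

definition smooth_section :: "('m, 'b::real_normed_vector) atlas \<Rightarrow> ('m, 'e::real_vector) vbundle
    \<Rightarrow> 'm set \<Rightarrow> ('m \<Rightarrow> 'e) \<Rightarrow> bool" where
  "smooth_section A E W \<sigma> \<longleftrightarrow> (\<forall>m\<in>W. \<sigma> m \<in> fibre E m) \<and>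
     (\<forall>(W', r, s)\<in>frames E. \<exists>c. (\<forall>i<r. smooth_fun A (W \<inter> W') (c i)) \<and>
        (\<forall>m\<in>W \<inter> W'. \<sigma> m = (\<Sum>i<r. c i m *\<^sub>R s i m)))"

text \<open>The last condition on a single frame says that the transition matrices between any two
  frames are smooth.\<close>

definition vector_bundle :: "('m::topological_space, 'b::real_normed_vector) atlas
    \<Rightarrow> ('m, 'e::real_vector) vbundle \<Rightarrow> bool" where
  "vector_bundle A E \<longleftrightarrow>
     (\<forall>(W, r, s)\<in>frames E. open W \<and> is_frame (fibre E) W r s \<and>
        (\<forall>i<r. smooth_section A E W (s i))) \<and>
     (\<Union>(W, r, s)\<in>frames E. W) = UNIV"

definition bundle_map :: "('m::topological_space, 'b::real_normed_vector) atlas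
    \<Rightarrow> ('m, 'e::real_vector) vbundle \<Rightarrow> ('m, 'f::real_vector) vbundle \<Rightarrow> ('m \<Rightarrow> 'e \<Rightarrow> 'f) \<Rightarrow> bool" where
  "bundle_map A E F h \<longleftrightarrow>
     (\<forall>m. linear_from_to (fibre E m) (fibre F m) (h m)) \<and>
     (\<forall>W \<sigma>. open W \<and> smooth_section A E W \<sigma> \<longrightarrow> smooth_section A F W (\<lambda>m. h m (\<sigma> m)))"

text \<open>The vector bundle with given fibres whose smooth frames are all the local frames consisting of
  sections that satisfy \<open>P\<close>. The smooth structure of each derived bundle below is specified in this
  way by saying which local sections are smooth; that there are enough frames is not built in, but
  part of the claim that the result is a \<open>vector_bundle\<close>.\<close>

definition bundle_of_sections :: "('m \<Rightarrow> 'e::real_vector set) \<Rightarrow> ('m set \<Rightarrow> ('m \<Rightarrow> 'e) \<Rightarrow> bool)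
    \<Rightarrow> ('m::topological_space, 'e) vbundle" where
  "bundle_of_sections F P =
     \<lparr>fibre = F, frames = {(W, r, s). open W \<and> is_frame F W r s \<and> (\<forall>i<r. P W (s i))}\<rparr>"

definition dual_bundle :: "('m::topological_space, 'b::real_normed_vector) atlas
    \<Rightarrow> ('m, 'e::real_vector) vbundle \<Rightarrow> ('m, 'e \<Rightarrow> real) vbundle" where
  "dual_bundle A E = bundle_of_sections (\<lambda>m. dual_space (fibre E m))
     (\<lambda>W \<alpha>. \<forall>W' \<sigma>. open W' \<and> W' \<subseteq> W \<and> smooth_section A E W' \<sigma> \<longrightarrow>
        smooth_fun A W' (\<lambda>m. \<alpha> m (\<sigma> m)))"

definition hom_bundle :: "('m::topological_space, 'b::real_normed_vector) atlas
    \<Rightarrow> ('m, 'e::real_vector) vbundle \<Rightarrow> ('m, 'f::real_vector) vbundle \<Rightarrow> ('m, 'e \<Rightarrow> 'f) vbundle" where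
  "hom_bundle A E F = bundle_of_sections (\<lambda>m. hom_space (fibre E m) (fibre F m))
     (\<lambda>W h. \<forall>W' \<sigma>. open W' \<and> W' \<subseteq> W \<and> smooth_section A E W' \<sigma> \<longrightarrow>
        smooth_section A F W' (\<lambda>m. h m (\<sigma> m)))"

definition tensor_bundle :: "('m::topological_space, 'b::real_normed_vector) atlas
    \<Rightarrow> ('m, 'e::real_vector) vbundle \<Rightarrow> ('m, 'f::real_vector) vbundle
    \<Rightarrow> ('m, ('e, 'f) tensor) vbundle" where
  "tensor_bundle A E F = bundle_of_sections (\<lambda>m. tensor_space (fibre E m) (fibre F m))
     (\<lambda>W \<theta>. \<forall>W' \<alpha> \<beta>. open W' \<and> W' \<subseteq> W \<and>
        smooth_section A (dual_bundle A E) W' \<alpha> \<and> smooth_section A (dual_bundle A F) W' \<beta> \<longrightarrow>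
        smooth_fun A W' (\<lambda>m. \<theta> m (\<alpha> m) (\<beta> m)))"

section \<open>DVB* sequences and duality\<close>

text \<open>The record describes a sequence
  \<open>0 \<rightarrow> side1 \<otimes> side2 \<rightarrow> total \<rightarrow> core \<rightarrow> 0\<close> with maps \<open>incl\<close> and \<open>proj\<close>.\<close>

record ('m, 'u, 'v, 'p, 'k) dvb_data =
  side1 :: "('m, 'u) vbundle"
  side2 :: "('m, 'v) vbundle"
  total :: "('m, 'p) vbundle"
  core :: "('m, 'k) vbundle"
  incl :: "'m \<Rightarrow> ('u, 'v) tensor \<Rightarrow> 'p"
  proj :: "'m \<Rightarrow> 'p \<Rightarrow> 'k"

definition DVB_sequence :: "('m::topological_space, 'b::real_normed_vector) atlas
    \<Rightarrow> ('m, 'u::real_vector, 'v::real_vector, 'p::real_vector, 'k::real_vector) dvb_data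
    \<Rightarrow> bool" where
  "DVB_sequence A S \<longleftrightarrow>
     vector_bundle A (side1 S) \<and> vector_bundle A (side2 S) \<and>
     vector_bundle A (total S) \<and> vector_bundle A (core S) \<and>
     bundle_map A (tensor_bundle A (side1 S) (side2 S)) (total S) (incl S) \<and>
     bundle_map A (total S) (core S) (proj S) \<and>
     (\<forall>m. inj_on (incl S m) (tensor_space (fibre (side1 S) m) (fibre (side2 S) m)) \<and>
        incl S m ` tensor_space (fibre (side1 S) m) (fibre (side2 S) m) =
          {\<sigma> \<in> fibre (total S) m. proj S m \<sigma> = 0} \<and>
        proj S m ` fibre (total S) m = fibre (core S) m)"

definition bilinear_pairing :: "('m::topological_space, 'b::real_normed_vector) atlas
    \<Rightarrow> ('m, 'd::real_vector) vbundle \<Rightarrow> ('m, 'p::real_vector) vbundle \<Rightarrow> ('m, 'u::real_vector) vbundle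
    \<Rightarrow> ('m \<Rightarrow> 'd \<Rightarrow> 'p \<Rightarrow> 'u) \<Rightarrow> bool" where
  "bilinear_pairing A D P U b \<longleftrightarrow>
     (\<forall>m. (\<forall>\<epsilon>\<in>fibre D m. linear_from_to (fibre P m) (fibre U m) (b m \<epsilon>)) \<and>
        (\<forall>\<sigma>\<in>fibre P m. linear_from_to (fibre D m) (fibre U m) (\<lambda>\<epsilon>. b m \<epsilon> \<sigma>))) \<and>
     (\<forall>W \<epsilon> \<sigma>. open W \<and> smooth_section A D W \<epsilon> \<and> smooth_section A P W \<sigma> \<longrightarrow>
        smooth_section A U W (\<lambda>m. b m (\<epsilon> m) (\<sigma> m)))"

text \<open>\<open>S\<close> and \<open>T\<close> are in duality with respect to the first side bundle \<open>U\<close> of \<open>S\<close>: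
  for \<open>S\<close> of the form \<open>0 \<rightarrow> U \<otimes> V \<rightarrow> \<Pi> \<rightarrow> K \<rightarrow> 0\<close>, \<open>T\<close> is of the form
  \<open>0 \<rightarrow> U \<otimes> K* \<rightarrow> \<Delta> \<rightarrow> V* \<rightarrow> 0\<close>.\<close>

definition in_duality :: "('m::topological_space, 'b::real_normed_vector) atlas
    \<Rightarrow> ('m, 'u::real_vector, 'v::real_vector, 'p::real_vector, 'k::real_vector) dvb_data
    \<Rightarrow> ('m, 'u, 'k \<Rightarrow> real, 'd::real_vector, 'v \<Rightarrow> real) dvb_data \<Rightarrow> bool" where
  "in_duality A S T \<longleftrightarrow>
     DVB_sequence A S \<and> DVB_sequence A T \<and>
     side1 T = side1 S \<and> side2 T = dual_bundle A (core S) \<and> core T = dual_bundle A (side2 S) \<and>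
     (\<exists>b. bilinear_pairing A (total T) (total S) (side1 S) b \<and>
        (\<forall>m. \<forall>\<epsilon>\<in>fibre (total T) m.
           \<forall>\<theta>\<in>tensor_space (fibre (side1 S) m) (fibre (side2 S) m).
             b m \<epsilon> (incl S m \<theta>) = contract (fibre (side1 S) m) (proj T m \<epsilon>) \<theta>) \<and>
        (\<forall>m. \<forall>\<sigma>\<in>fibre (total S) m.
           \<forall>\<kappa>\<in>tensor_space (fibre (side1 S) m) (fibre (side2 T) m).
             b m (incl T m \<kappa>) \<sigma> =
               contract (fibre (side1 S) m) (bidual_embed (fibre (core S) m) (proj S m \<sigma>)) \<kappa>))"

text \<open>The dual with respect to the first side bundle. The total space is the pull-back, which is a
  subbundle of the sum of \<open>U \<otimes> \<Pi>* = Hom(\<Pi>, U)\<close> and \<open>V*\<close>. The component in \<open>V*\<close> is determined by the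
  other one except where \<open>U\<close> has rank 0.\<close>

definition dual_total :: "('m::topological_space, 'b::real_normed_vector) atlas
    \<Rightarrow> ('m, 'u::real_vector, 'v::real_vector, 'p::real_vector, 'k::real_vector) dvb_data
    \<Rightarrow> ('m, ('p \<Rightarrow> 'u) \<times> ('v \<Rightarrow> real)) vbundle" where
  "dual_total A S = bundle_of_sections
     (\<lambda>m. {(\<epsilon>, \<beta>). \<epsilon> \<in> hom_space (fibre (total S) m) (fibre (side1 S) m) \<and>
        \<beta> \<in> dual_space (fibre (side2 S) m) \<and>
        (\<forall>\<theta>\<in>tensor_space (fibre (side1 S) m) (fibre (side2 S) m).
           \<epsilon> (incl S m \<theta>) = contract (fibre (side1 S) m) \<beta> \<theta>)})
     (\<lambda>W s. smooth_section A (hom_bundle A (total S) (side1 S)) W (\<lambda>m. fst (s m)) \<and>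
        smooth_section A (dual_bundle A (side2 S)) W (\<lambda>m. snd (s m)))"

definition side_dual :: "('m::topological_space, 'b::real_normed_vector) atlas
    \<Rightarrow> ('m, 'u::real_vector, 'v::real_vector, 'p::real_vector, 'k::real_vector) dvb_data
    \<Rightarrow> ('m, 'u, 'k \<Rightarrow> real, ('p \<Rightarrow> 'u) \<times> ('v \<Rightarrow> real), 'v \<Rightarrow> real) dvb_data" where
  "side_dual A S =
     \<lparr>side1 = side1 S, side2 = dual_bundle A (core S),
      total = dual_total A S, core = dual_bundle A (side2 S),
      incl = (\<lambda>m \<kappa>. (restrict0 (fibre (total S) m)
        (\<lambda>\<sigma>. contract (fibre (side1 S) m)
           (bidual_embed (fibre (core S) m) (proj S m \<sigma>)) \<kappa>), 0)),
      proj = (\<lambda>m (\<epsilon>, \<beta>). \<beta>)\<rparr>"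

text \<open>Identification of \<open>X \<otimes> Y\<close> with \<open>Y \<otimes> X\<close>, used to regard the second side bundle as the first.\<close>

definition flip_sides ::
    "('m, 'u, 'v, 'p, 'k) dvb_data \<Rightarrow> ('m, 'v, 'u, 'p, 'k) dvb_data" where
  "flip_sides S =
     \<lparr>side1 = side2 S, side2 = side1 S, total = total S, core = core S,
      incl = (\<lambda>m \<theta>. incl S m (flip \<theta>)), proj = proj S\<rparr>"

definition transposition ::
    "('m, 'u, 'v, 'p::real_vector, 'k) dvb_data \<Rightarrow> ('m, 'v, 'u, 'p, 'k) dvb_data" where
  "transposition S =
     \<lparr>side1 = side2 S, side2 = side1 S, total = total S, core = core S,
      incl = (\<lambda>m \<theta>. - incl S m (flip \<theta>)), proj = proj S\<rparr>"

lemma incl_transposition: "incl (transposition S) m (tensor Y X y x) = - incl S m (tensor X Y x y)"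
  by (simp add: transposition_def flip_tensor)

text \<open>If the first side bundle is the bidual of \<open>V\<close>, replace it by \<open>V\<close>: the map \<open>incl\<close> is composed
  with the tensor product of \<open>V \<rightarrow> V**\<close> and the identity. In the formula, an element \<open>\<alpha>\<close> of the
  dual of \<open>V**\<close> is pulled back along \<open>V \<rightarrow> V**\<close>.\<close>

definition identify_bidual :: "('m, 'v::real_vector) vbundle
    \<Rightarrow> ('m, ('v \<Rightarrow> real) \<Rightarrow> real, 'w, 'p, 'k) dvb_data \<Rightarrow> ('m, 'v, 'w, 'p, 'k) dvb_data" where
  "identify_bidual V S =
     \<lparr>side1 = V, side2 = side2 S, total = total S, core = core S,
      incl = (\<lambda>m \<theta>. incl S m (restrict0 (dual_space (dual_space (dual_space (fibre V m))))
        (\<lambda>\<alpha>. \<theta> (restrict0 (fibre V m) (\<lambda>x. \<alpha> (bidual_embed (fibre V m) x)))))),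
      proj = proj S\<rparr>"

end

theory Submission
  imports Defs
begin

text \<open>
  \<^bold>\<open>Fibrewise idea.\<close> An element of the \<open>U\<close>-dual of \<open>0 \<rightarrow> U \<otimes> V \<rightarrow> \<Pi> \<rightarrow> K \<rightarrow> 0\<close> is a pair \<open>e = (\<epsilon>, \<beta>)\<close> with
  \<open>\<epsilon> : \<Pi> \<rightarrow> U\<close>, \<open>\<beta> \<in> V\<^sup>*\<close> and \<open>\<epsilon>(i(\<theta>)) = \<beta> \<lrcorner> \<theta>\<close>. A linear section \<open>s\<close> of \<open>j\<close> identifies such pairs with
  arbitrary pairs \<open>(\<epsilon> \<circ> s, \<beta>)\<close> in \<open>Hom(K, U) \<oplus> V\<^sup>*\<close>, so the \<open>U\<close>-dual is again an exact sequence, and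
  evaluation \<open>(\<epsilon>, \<sigma>) \<mapsto> \<epsilon>(\<sigma>)\<close> is a \<open>U\<close>-pairing (\<open>in_duality_side_dual\<close>). This applies to the given
  sequence and, after exchange of the side bundles, to its \<open>U\<close>-dual.

  An element of the second dual is a pair \<open>(\<psi>, \<mu>)\<close> of \<open>\<psi> : \<Pi>\<^sup>*\<^sub>U \<rightarrow> K\<^sup>*\<close> and \<open>\<mu> \<in> U\<^sup>*\<close>. Its pairing with
  \<open>\<sigma> \<in> \<Pi>\<close> is the element \<open>v\<close> of \<open>V = V\<^sup>*\<^sup>*\<close> defined by
  \<open>\<beta>(v) = \<psi>(e)(j(\<sigma>)) - \<mu>(\<epsilon>(\<sigma>))\<close> for any \<open>e = (\<epsilon>, \<beta>)\<close> over \<open>\<beta>\<close>.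
  The right-hand side does not depend on \<open>e\<close>: for \<open>e\<close> in the kernel \<open>U \<otimes> K\<^sup>*\<close> of
  \<open>e \<mapsto> \<beta>\<close> both terms are the contraction of \<open>e\<close> with \<open>\<mu>\<close> and \<open>j(\<sigma>)\<close>, and they cancel (\<open>transposed_functional_kernel\<close>). For
  \<open>\<sigma> = i\<^sup>t(v \<otimes> u) = - i(u \<otimes> v)\<close> the first term vanishes and the second is \<open>+ \<mu>(u) \<beta>(v)\<close>: this is
  why the transposition carries a sign (\<open>in_duality_transposition\<close>).

  \<^bold>\<open>Smoothness.\<close> All derived bundles are described by their smooth sections, and it has to be shown
  that they have enough smooth frames. Everything rests on coframes, that is, local frames with
  their coordinate functionals, and on the Steinitz exchange of one member of a coframe
  (\<open>coframe_exchange\<close>), which needs only that the inverse of a function without zeros is smooth. By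
  repeated exchange, smooth sections that are independent at a point are part of a coframe nearby
  (\<open>coframe_extend\<close>). Consequently injective bundle maps reflect smoothness of sections, and surjective
  bundle maps have smooth local sections; the latter yield the coframes of the \<open>U\<close>-dual.
\<close>

section \<open>Smooth functions\<close>

lemma C_k_on_subset: "C_k_on k S f \<Longrightarrow> T \<subseteq> S \<Longrightarrow> C_k_on k T f"
  by (induction k arbitrary: f) (auto intro: continuous_on_subset)

lemma C_k_on_cong:
  assumes "open S" "\<And>x. x \<in> S \<Longrightarrow> f x = g x" "C_k_on k S f"
  shows "C_k_on k S g"
  using assms(2,3)
proof (induction k arbitrary: f g)
  case 0
  then show ?case using continuous_on_cong[of S S f g] by simp
next
  case (Suc k)
  have der: "(g has_derivative frechet_derivative f (at x)) (at x)" if "x \<in> S" for x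
  proof (rule has_derivative_transform_within_open[OF _ \<open>open S\<close> that])
    show "(f has_derivative frechet_derivative f (at x)) (at x)"
      using Suc.prems(2) that by (simp add: frechet_derivative_works)
  qed (use Suc.prems(1) in auto)
  show ?case
    unfolding C_k_on.simps
  proof (intro conjI ballI allI)
    fix x assume "x \<in> S"
    then show "g differentiable at x" using der differentiable_def by blast
  next
    fix v
    have "frechet_derivative f (at x) v = frechet_derivative g (at x) v" if "x \<in> S" for x
      using frechet_derivative_at[OF der[OF that]] by simp
    then show "C_k_on k S (\<lambda>x. frechet_derivative g (at x) v)"
      using Suc.IH[of "\<lambda>x. frechet_derivative f (at x) v" "\<lambda>x. frechet_derivative g (at x) v"]
        Suc.prems(2) by auto
  qed
qed

lemma C_k_on_local:
  assumes "\<And>x. x \<in> S \<Longrightarrow> \<exists>T. open T \<and> x \<in> T \<and> C_k_on k T f"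
  shows "C_k_on k S f"
  using assms
proof (induction k arbitrary: f)
  case 0
  have "isCont f x" if "x \<in> S" for x
    using 0[OF that] by (auto simp: continuous_on_eq_continuous_at)
  then show ?case by (simp add: continuous_at_imp_continuous_on)
next
  case (Suc k)
  show ?case
    unfolding C_k_on.simps
  proof (intro conjI ballI allI)
    fix x assume "x \<in> S"
    then show "f differentiable at x" using Suc.prems[of x] by auto
  next
    fix v
    show "C_k_on k S (\<lambda>x. frechet_derivative f (at x) v)"
      by (rule Suc.IH) (use Suc.prems in fastforce)
  qed
qed

lemma C_k_on_SucD: "C_k_on (Suc k) S f \<Longrightarrow> C_k_on k S f"
proof (induction k arbitrary: f)
  case 0
  then show ?case
    by (auto intro!: continuous_at_imp_continuous_on differentiable_imp_continuous_within)
next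
  case (Suc k)
  have "f differentiable at x" if "x \<in> S" for x
    using Suc.prems that by simp
  moreover have "C_k_on k S (\<lambda>x. frechet_derivative f (at x) v)" for v
    by (rule Suc.IH) (use Suc.prems in simp)
  ultimately show ?case by simp
qed

lemma C_k_on_const: "C_k_on k S (\<lambda>_. c)"
proof (induction k arbitrary: c)
  case (Suc k)
  have "frechet_derivative (\<lambda>_::'a. c) (at x) = (\<lambda>_. 0)" for x
    using frechet_derivative_const by blast
  then show ?case using Suc by simp
qed simp

lemma C_k_on_add:
  assumes "open S" "C_k_on k S f" "C_k_on k S g"
  shows "C_k_on k S (\<lambda>x. f x + g x)"
  using assms(2,3)
proof (induction k arbitrary: f g)
  case 0
  then show ?case by (simp add: continuous_on_add)
next
  case (Suc k)
  have der: "((\<lambda>x. f x + g x) has_derivative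
      (\<lambda>v. frechet_derivative f (at x) v + frechet_derivative g (at x) v)) (at x)"
    if "x \<in> S" for x
    using Suc.prems that by (intro has_derivative_add) (auto simp: frechet_derivative_works[symmetric])
  have "C_k_on k S (\<lambda>x. frechet_derivative (\<lambda>x. f x + g x) (at x) v)" for v
  proof (rule C_k_on_cong[OF \<open>open S\<close>])
    show "C_k_on k S (\<lambda>x. frechet_derivative f (at x) v + frechet_derivative g (at x) v)"
      by (rule Suc.IH) (use Suc.prems in auto)
  qed (simp add: fun_cong[OF frechet_derivative_at[OF der]])
  then show ?case using der differentiable_def by fastforce
qed

lemma C_k_on_mult:
  fixes f g :: "'a::real_normed_vector \<Rightarrow> real"
  assumes "open S" "C_k_on k S f" "C_k_on k S g"
  shows "C_k_on k S (\<lambda>x. f x * g x)"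
  using assms(2,3)
proof (induction k arbitrary: f g)
  case 0
  then show ?case by (simp add: continuous_on_mult)
next
  case (Suc k)
  have der: "((\<lambda>x. f x * g x) has_derivative
      (\<lambda>v. f x * frechet_derivative g (at x) v + frechet_derivative f (at x) v * g x)) (at x)"
    if "x \<in> S" for x
    using Suc.prems that by (intro has_derivative_mult) (auto simp: frechet_derivative_works[symmetric])
  have "C_k_on k S (\<lambda>x. frechet_derivative (\<lambda>x. f x * g x) (at x) v)" for v
  proof (rule C_k_on_cong[OF \<open>open S\<close>])
    show "C_k_on k S (\<lambda>x. f x * frechet_derivative g (at x) v + frechet_derivative f (at x) v * g x)"
      by (intro C_k_on_add[OF \<open>open S\<close>] Suc.IH)
        (use Suc.prems C_k_on_SucD[OF Suc.prems(1)] C_k_on_SucD[OF Suc.prems(2)] in auto)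
  qed (simp add: fun_cong[OF frechet_derivative_at[OF der]])
  then show ?case using der differentiable_def by fastforce
qed

lemma C_k_on_inverse:
  fixes f :: "'a::real_normed_vector \<Rightarrow> real"
  assumes "open S" "\<And>x. x \<in> S \<Longrightarrow> f x \<noteq> 0" "C_k_on k S f"
  shows "C_k_on k S (\<lambda>x. inverse (f x))"
  using assms(3)
proof (induction k)
  case 0
  then show ?case using assms(2) by (simp add: continuous_on_inverse)
next
  case (Suc k)
  have der: "((\<lambda>x. inverse (f x)) has_derivative
      (\<lambda>v. - (inverse (f x) * frechet_derivative f (at x) v * inverse (f x)))) (at x)"
    if "x \<in> S" for x
    using Suc.prems that assms(2) by (intro Deriv.has_derivative_inverse) (auto simp: frechet_derivative_works[symmetric])
  have inv: "C_k_on k S (\<lambda>x. inverse (f x))"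
    using Suc C_k_on_SucD by blast
  have "C_k_on k S (\<lambda>x. frechet_derivative (\<lambda>x. inverse (f x)) (at x) v)" for v
  proof (rule C_k_on_cong[OF \<open>open S\<close>])
    show "C_k_on k S (\<lambda>x. (-1) * (inverse (f x) * frechet_derivative f (at x) v * inverse (f x)))"
      using Suc.prems inv by (intro C_k_on_mult[OF \<open>open S\<close>] C_k_on_const) auto
    fix x assume "x \<in> S"
    then show "(-1) * (inverse (f x) * frechet_derivative f (at x) v * inverse (f x)) =
        frechet_derivative (\<lambda>x. inverse (f x)) (at x) v"
      using fun_cong[OF frechet_derivative_at[OF der], of x v] by simp
  qed
  then show ?case using der differentiable_def by fastforce
qed

text \<open>On functions on \<open>M\<close>, only the following facts about smoothness are used: smooth functions form
  a sheaf of rings of continuous functions in which functions without zeros are invertible.\<close>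

lemma smooth_fun_subset: "smooth_fun A W f \<Longrightarrow> W' \<subseteq> W \<Longrightarrow> smooth_fun A W' f"
  unfolding smooth_fun_def smooth_on_def by (fastforce intro: C_k_on_subset)

lemma smooth_fun_const: "smooth_fun A W (\<lambda>_. c)"
  by (auto simp: smooth_fun_def smooth_on_def comp_def C_k_on_const)

text \<open>The base manifold of all bundles.\<close>

locale smooth_base =
  fixes A :: "('m::{t2_space,second_countable_topology}, 'b::real_normed_vector) atlas"
  assumes A: "smooth_manifold A"
begin

lemma chart:
  assumes "(D, \<phi>) \<in> A"
  shows "open D" "open (\<phi> ` D)" "homeomorphism D (\<phi> ` D) \<phi> (inv_into D \<phi>)"
  using A assms unfolding smooth_manifold_def by auto

lemma chart_inverse: "(D, \<phi>) \<in> A \<Longrightarrow> x \<in> D \<Longrightarrow> inv_into D \<phi> (\<phi> x) = x"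
  using chart(3) unfolding homeomorphism_def by blast

lemma chart_open:
  assumes "(D, \<phi>) \<in> A" "open W"
  shows "open (\<phi> ` (W \<inter> D))"
proof -
  have "openin (top_of_set (\<phi> ` D)) (\<phi> ` (W \<inter> D))"
    using homeomorphism_imp_open_map[OF chart(3)[OF assms(1)], of "W \<inter> D"] assms(2)
    by (metis Int_commute openin_open)
  then show ?thesis using chart(2)[OF assms(1)] openin_open_trans by blast
qed

lemma smooth_fun_cong:
  assumes "open W" "\<And>m. m \<in> W \<Longrightarrow> f m = g m" "smooth_fun A W f"
  shows "smooth_fun A W g"
  unfolding smooth_fun_def smooth_on_def
proof (intro ballI allI, clarify)
  fix D \<phi> k assume D: "(D, \<phi>) \<in> A"
  show "C_k_on k (\<phi> ` (W \<inter> D)) (g \<circ> inv_into D \<phi>)"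
  proof (rule C_k_on_cong[OF chart_open[OF D assms(1)]])
    show "C_k_on k (\<phi> ` (W \<inter> D)) (f \<circ> inv_into D \<phi>)"
      using assms(3) D unfolding smooth_fun_def smooth_on_def by blast
  qed (use assms(2) chart_inverse[OF D] in auto)
qed

lemma smooth_fun_add:
  assumes "open W" "smooth_fun A W f" "smooth_fun A W g"
  shows "smooth_fun A W (\<lambda>m. f m + g m)"
  using assms C_k_on_add[OF chart_open] unfolding smooth_fun_def smooth_on_def comp_def by blast

lemma smooth_fun_mult:
  assumes "open W" "smooth_fun A W f" "smooth_fun A W g"
  shows "smooth_fun A W (\<lambda>m. f m * g m)"
  using assms C_k_on_mult[OF chart_open] unfolding smooth_fun_def smooth_on_def comp_def by blast

lemma smooth_fun_diff:
  assumes "open W" "smooth_fun A W f" "smooth_fun A W g"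
  shows "smooth_fun A W (\<lambda>m. f m - g m)"
  using smooth_fun_add[OF assms(1,2) smooth_fun_mult[OF assms(1) smooth_fun_const[of A W "-1"] assms(3)]]
  by simp

lemma smooth_fun_sum:
  assumes "open W" "\<And>i. i \<in> I \<Longrightarrow> smooth_fun A W (f i)"
  shows "smooth_fun A W (\<lambda>m. \<Sum>i\<in>I. f i m)"
proof (cases "finite I")
  case True
  then show ?thesis using assms(2)
    by (induction I) (auto intro: smooth_fun_const smooth_fun_add[OF assms(1)])
qed (simp add: smooth_fun_const)

lemma smooth_fun_inverse:
  assumes "open W" "\<And>m. m \<in> W \<Longrightarrow> f m \<noteq> 0" "smooth_fun A W f"
  shows "smooth_fun A W (\<lambda>m. inverse (f m))"
  unfolding smooth_fun_def smooth_on_def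
proof (intro ballI allI, clarify)
  fix D \<phi> k assume D: "(D, \<phi>) \<in> A"
  have "C_k_on k (\<phi> ` (W \<inter> D)) (\<lambda>x. inverse ((f \<circ> inv_into D \<phi>) x))"
    using assms(2,3) D chart_inverse[OF D]
    by (intro C_k_on_inverse[OF chart_open[OF D assms(1)]])
      (auto simp: smooth_fun_def smooth_on_def comp_def)
  then show "C_k_on k (\<phi> ` (W \<inter> D)) ((\<lambda>m. inverse (f m)) \<circ> inv_into D \<phi>)"
    by (simp add: comp_def)
qed

lemma smooth_fun_local:
  assumes "\<And>m. m \<in> W \<Longrightarrow> \<exists>W'. open W' \<and> m \<in> W' \<and> smooth_fun A W' f"
  shows "smooth_fun A W f"
  unfolding smooth_fun_def smooth_on_def
proof (intro ballI allI, clarify)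
  fix D \<phi> k assume D: "(D, \<phi>) \<in> A"
  show "C_k_on k (\<phi> ` (W \<inter> D)) (f \<circ> inv_into D \<phi>)"
  proof (rule C_k_on_local)
    fix x assume "x \<in> \<phi> ` (W \<inter> D)"
    then obtain m where m: "m \<in> W" "m \<in> D" "x = \<phi> m" by auto
    then obtain W' where W': "open W'" "m \<in> W'" "smooth_fun A W' f" using assms by blast
    show "\<exists>T. open T \<and> x \<in> T \<and> C_k_on k T (f \<circ> inv_into D \<phi>)"
      using W' m D chart_open[OF D W'(1)]
      by (intro exI[of _ "\<phi> ` (W' \<inter> D)"]) (auto simp: smooth_fun_def smooth_on_def)
  qed
qed

lemma smooth_fun_continuous:
  assumes "open W" "smooth_fun A W f"
  shows "continuous_on W f"
proof -
  have "isCont f m" if "m \<in> W" for m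
  proof -
    have "m \<in> (\<Union>(D, \<phi>)\<in>A. D)" using A unfolding smooth_manifold_def by simp
    then obtain D \<phi> where D: "(D, \<phi>) \<in> A" "m \<in> D" by auto
    have "C_k_on 0 (\<phi> ` (W \<inter> D)) (f \<circ> inv_into D \<phi>)"
      using assms(2) D(1) unfolding smooth_fun_def smooth_on_def by blast
    moreover have "continuous_on (W \<inter> D) \<phi>"
      using chart(3)[OF D(1)] unfolding homeomorphism_def
      by (meson continuous_on_subset inf_le2)
    ultimately have "continuous_on (W \<inter> D) ((f \<circ> inv_into D \<phi>) \<circ> \<phi>)"
      using continuous_on_compose[of "W \<inter> D" \<phi> "f \<circ> inv_into D \<phi>"] by simp
    then have "continuous_on (W \<inter> D) f"
      by (rule continuous_on_eq) (simp add: chart_inverse[OF D(1)])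
    then show ?thesis
      using D chart(1)[OF D(1)] assms(1) that by (simp add: continuous_on_eq_continuous_at open_Int)
  qed
  then show ?thesis by (simp add: continuous_at_imp_continuous_on)
qed

lemma smooth_fun_nonzero_nhd:
  assumes "open W" "smooth_fun A W f" "m \<in> W" "f m \<noteq> 0"
  obtains W' where "open W'" "m \<in> W'" "W' \<subseteq> W" "\<And>x. x \<in> W' \<Longrightarrow> f x \<noteq> 0"
proof
  show "open (W \<inter> f -` (- {0}))"
    using continuous_on_open_vimage[OF assms(1)] smooth_fun_continuous[OF assms(1,2)]
    by (metis Int_commute open_Compl closed_singleton)
qed (use assms in auto)

end

section \<open>Finite-dimensional fibres\<close>

lemma linear_from_toD:
  assumes "linear_from_to S T f"
  shows "x \<in> S \<Longrightarrow> f x \<in> T" "x \<in> S \<Longrightarrow> y \<in> S \<Longrightarrow> f (x + y) = f x + f y"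
    "x \<in> S \<Longrightarrow> f (c *\<^sub>R x) = c *\<^sub>R f x"
  using assms by (auto simp: linear_from_to_def)

lemma linear_from_to_0: "linear_from_to S T f \<Longrightarrow> subspace S \<Longrightarrow> f 0 = 0"
  using linear_from_toD(3)[of S T f 0 0] by (simp add: subspace_0)

lemma linear_from_to_diff:
  assumes "linear_from_to S T f" "subspace S" "x \<in> S" "y \<in> S"
  shows "f (x - y) = f x - f y"
  using linear_from_toD(2)[OF assms(1), of "x - y" y] assms by (simp add: subspace_diff)

lemma linear_from_to_sum:
  assumes "linear_from_to S T f" "subspace S" "\<And>i. i \<in> I \<Longrightarrow> x i \<in> S"
  shows "f (\<Sum>i\<in>I. c i *\<^sub>R x i) = (\<Sum>i\<in>I. c i *\<^sub>R f (x i))"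
proof (cases "finite I")
  case True
  then show ?thesis using assms(3)
  proof (induction I)
    case empty
    then show ?case using linear_from_to_0[OF assms(1,2)] by simp
  next
    case (insert a I)
    have "(\<Sum>i\<in>I. c i *\<^sub>R x i) \<in> S"
      using insert assms(2) by (intro subspace_sum) (auto intro: subspace_scale)
    moreover have "c a *\<^sub>R x a \<in> S" using insert assms(2) by (auto intro: subspace_scale)
    ultimately show ?case
      using insert linear_from_toD(2)[OF assms(1)] linear_from_toD(3)[OF assms(1)] by simp
  qed
qed (simp add: linear_from_to_0[OF assms(1,2)])

lemma linear_from_to_comp:
  "linear_from_to S T f \<Longrightarrow> linear_from_to T R g \<Longrightarrow> linear_from_to S R (\<lambda>x. g (f x))"
  by (simp add: linear_from_to_def)

lemma linear_from_to_cong: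
  assumes "linear_from_to S T f" "subspace S" "\<And>x. x \<in> S \<Longrightarrow> f x = g x"
  shows "linear_from_to S T g"
  using assms by (auto simp: linear_from_to_def subspace_add subspace_scale)

lemma restrict0_in: "x \<in> S \<Longrightarrow> restrict0 S f x = f x"
  by (simp add: restrict0_def)

lemma restrict0_hom_space:
  "linear_from_to S T f \<Longrightarrow> subspace S \<Longrightarrow> restrict0 S f \<in> hom_space S T"
  unfolding hom_space_def
  using linear_from_to_cong[of S T f "restrict0 S f"] by (simp add: restrict0_def)

lemma restrict0_dual_space:
  "linear_from_to S UNIV f \<Longrightarrow> subspace S \<Longrightarrow> restrict0 S f \<in> dual_space S"
  unfolding dual_space_def by (rule restrict0_hom_space)

lemma hom_spaceD: "f \<in> hom_space S T \<Longrightarrow> linear_from_to S T f"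
  by (simp add: hom_space_def)

lemma dual_spaceD: "f \<in> dual_space S \<Longrightarrow> linear_from_to S UNIV f"
  by (simp add: dual_space_def hom_space_def)

lemma hom_space_eqI:
  assumes "f \<in> hom_space S T" "g \<in> hom_space S T" "\<And>x. x \<in> S \<Longrightarrow> f x = g x"
  shows "f = g"
  using assms by (auto simp: hom_space_def fun_eq_iff) metis

lemma dual_space_eqI:
  assumes "f \<in> dual_space S" "g \<in> dual_space S" "\<And>x. x \<in> S \<Longrightarrow> f x = g x"
  shows "f = g"
  using assms unfolding dual_space_def by (rule hom_space_eqI)

lemma subspace_hom_space:
  assumes "subspace T" shows "subspace (hom_space S T)"
  unfolding subspace_def
proof (intro conjI ballI allI)
  show "0 \<in> hom_space S T"
    using assms by (simp add: hom_space_def linear_from_to_def subspace_0)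
next
  fix f g assume "f \<in> hom_space S T" "g \<in> hom_space S T"
  then show "f + g \<in> hom_space S T"
    using assms by (simp add: hom_space_def linear_from_to_def subspace_add algebra_simps)
next
  fix c f assume "f \<in> hom_space S T"
  then show "c *\<^sub>R f \<in> hom_space S T"
    using assms
    by (simp add: hom_space_def linear_from_to_def subspace_scale scaleR_fun_def algebra_simps)
qed

lemma subspace_dual_space: "subspace (dual_space S)"
  unfolding dual_space_def by (rule subspace_hom_space) simp

lemma linear_eval: "linear_from_to (dual_space S) UNIV (\<lambda>\<alpha>. \<alpha> x)"
  by (simp add: linear_from_to_def scaleR_fun_def)

text \<open>The tensor product is, with no identification needed, the space of linear maps from the dual
  of the first factor to the bidual of the second.\<close>

lemma tensor_space_hom: "tensor_space S T = hom_space (dual_space S) (dual_space (dual_space T))"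
proof (intro set_eqI iffI)
  fix \<theta> assume \<theta>: "\<theta> \<in> tensor_space S T"
  have "\<theta> \<alpha> \<in> dual_space (dual_space T)" if "\<alpha> \<in> dual_space S" for \<alpha>
    using \<theta> that by (simp add: tensor_space_def dual_space_def[of "dual_space T"] hom_space_def)
  moreover have "\<theta> (\<alpha> + \<alpha>') = \<theta> \<alpha> + \<theta> \<alpha>'"
    if "\<alpha> \<in> dual_space S" "\<alpha>' \<in> dual_space S" for \<alpha> \<alpha>'
  proof
    fix \<beta>
    show "\<theta> (\<alpha> + \<alpha>') \<beta> = (\<theta> \<alpha> + \<theta> \<alpha>') \<beta>"
      using \<theta> that by (cases "\<beta> \<in> dual_space T") (auto simp: tensor_space_def linear_from_to_def)
  qed
  moreover have "\<theta> (c *\<^sub>R \<alpha>) = c *\<^sub>R \<theta> \<alpha>" if "\<alpha> \<in> dual_space S" for \<alpha> c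
  proof
    fix \<beta>
    show "\<theta> (c *\<^sub>R \<alpha>) \<beta> = (c *\<^sub>R \<theta> \<alpha>) \<beta>"
      using \<theta> that
      by (cases "\<beta> \<in> dual_space T") (auto simp: tensor_space_def linear_from_to_def scaleR_fun_def)
  qed
  moreover have "\<theta> \<alpha> = 0" if "\<alpha> \<notin> dual_space S" for \<alpha>
    using \<theta> that by (auto simp: tensor_space_def fun_eq_iff)
  ultimately show "\<theta> \<in> hom_space (dual_space S) (dual_space (dual_space T))"
    by (simp add: hom_space_def linear_from_to_def)
next
  fix \<theta> assume \<theta>: "\<theta> \<in> hom_space (dual_space S) (dual_space (dual_space T))"
  then have *: "\<theta> \<alpha> \<in> dual_space (dual_space T)" if "\<alpha> \<in> dual_space S" for \<alpha>
    using that by (simp add: hom_space_def linear_from_to_def)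
  have "\<theta> \<alpha> \<beta> = 0" if "\<alpha> \<notin> dual_space S \<or> \<beta> \<notin> dual_space T" for \<alpha> \<beta>
    using \<theta> * that
    by (cases "\<alpha> \<in> dual_space S")
      (auto simp: dual_space_def[of "dual_space T"] hom_space_def)
  then show "\<theta> \<in> tensor_space S T"
    using \<theta> dual_spaceD[OF *]
    by (simp add: tensor_space_def hom_space_def linear_from_to_def scaleR_fun_def)
qed

lemma subspace_tensor_space: "subspace (tensor_space S T)"
  unfolding tensor_space_hom by (intro subspace_hom_space subspace_dual_space)

lemma tensor_spaceD:
  assumes "\<theta> \<in> tensor_space S T"
  shows "\<beta> \<in> dual_space T \<Longrightarrow> linear_from_to (dual_space S) UNIV (\<lambda>\<alpha>. \<theta> \<alpha> \<beta>)"
    "\<alpha> \<in> dual_space S \<Longrightarrow> linear_from_to (dual_space T) UNIV (\<theta> \<alpha>)"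
    "\<alpha> \<notin> dual_space S \<Longrightarrow> \<theta> \<alpha> \<beta> = 0" "\<beta> \<notin> dual_space T \<Longrightarrow> \<theta> \<alpha> \<beta> = 0"
  using assms by (auto simp: tensor_space_def)

lemma tensor_space_eqI:
  assumes "\<theta> \<in> tensor_space S T" "\<theta>' \<in> tensor_space S T"
    and "\<And>\<alpha> \<beta>. \<alpha> \<in> dual_space S \<Longrightarrow> \<beta> \<in> dual_space T \<Longrightarrow> \<theta> \<alpha> \<beta> = \<theta>' \<alpha> \<beta>"
  shows "\<theta> = \<theta>'"
proof (intro ext)
  fix \<alpha> \<beta> show "\<theta> \<alpha> \<beta> = \<theta>' \<alpha> \<beta>"
    using assms tensor_spaceD(3,4)[OF assms(1)] tensor_spaceD(3,4)[OF assms(2)]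
    by (cases "\<alpha> \<in> dual_space S \<and> \<beta> \<in> dual_space T") auto
qed

lemma flip_flip: "flip (flip \<theta>) = \<theta>"
  by (simp add: flip_def)

lemma flip_tensor_space: "\<theta> \<in> tensor_space S T \<Longrightarrow> flip \<theta> \<in> tensor_space T S"
  by (auto simp: tensor_space_def flip_def)

text \<open>A finite basis \<open>b\<close> of the subspace \<open>S\<close>, indexed by \<open>I\<close>, together with its dual basis \<open>\<phi>\<close> of
  coordinate functionals.\<close>

definition dual_bases ::
    "'a::real_vector set \<Rightarrow> 'i set \<Rightarrow> ('i \<Rightarrow> 'a) \<Rightarrow> ('i \<Rightarrow> 'a \<Rightarrow> real) \<Rightarrow> bool" where
  "dual_bases S I b \<phi> \<longleftrightarrow> finite I \<and> subspace S \<and> (\<forall>i\<in>I. b i \<in> S) \<and> (\<forall>i\<in>I. \<phi> i \<in> dual_space S) \<and>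
     (\<forall>i\<in>I. \<forall>k\<in>I. \<phi> i (b k) = (if i = k then 1 else 0)) \<and>
     (\<forall>x\<in>S. x = (\<Sum>i\<in>I. \<phi> i x *\<^sub>R b i))"

text \<open>Finite dimension, as existence of a basis with its coordinate functionals.\<close>

definition finite_dim :: "'a::real_vector set \<Rightarrow> bool" where
  "finite_dim S \<longleftrightarrow> (\<exists>(I::nat set) b \<phi>. dual_bases S I b \<phi>)"

lemma dual_basesD:
  assumes "dual_bases S I b \<phi>"
  shows "finite I" "subspace S" "i \<in> I \<Longrightarrow> b i \<in> S" "i \<in> I \<Longrightarrow> \<phi> i \<in> dual_space S"
    "i \<in> I \<Longrightarrow> k \<in> I \<Longrightarrow> \<phi> i (b k) = (if i = k then 1 else 0)"
    "x \<in> S \<Longrightarrow> (\<Sum>i\<in>I. \<phi> i x *\<^sub>R b i) = x"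
    "i \<in> I \<Longrightarrow> linear_from_to S UNIV (\<phi> i)"
  using assms dual_spaceD by (auto simp: dual_bases_def)

lemma dual_bases_coord_sum:
  assumes "dual_bases S I b \<phi>" "i \<in> I"
  shows "\<phi> i (\<Sum>k\<in>I. c k *\<^sub>R b k) = c i"
proof -
  have "\<phi> i (\<Sum>k\<in>I. c k *\<^sub>R b k) = (\<Sum>k\<in>I. c k *\<^sub>R \<phi> i (b k))"
    using dual_basesD[OF assms(1)] assms(2) by (intro linear_from_to_sum[of S UNIV]) auto
  also have "\<dots> = (\<Sum>k\<in>I. if k = i then c k else 0)"
    using dual_basesD(5)[OF assms] by (intro sum.cong) auto
  also have "\<dots> = c i" using dual_basesD(1)[OF assms(1)] assms(2) by simp
  finally show ?thesis .
qed

lemma dual_bases_linear_expand: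
  assumes "dual_bases S I b \<phi>" "linear_from_to S T f" "x \<in> S"
  shows "f x = (\<Sum>i\<in>I. \<phi> i x *\<^sub>R f (b i))"
  using linear_from_to_sum[OF assms(2) dual_basesD(2)[OF assms(1)], of I b "\<lambda>i. \<phi> i x"]
    dual_basesD(3,6)[OF assms(1)] assms(3) by simp

lemma dual_bases_reindex:
  assumes "dual_bases S I b \<phi>" "bij_betw h J I"
  shows "dual_bases S J (\<lambda>j. b (h j)) (\<lambda>j. \<phi> (h j))"
proof -
  have h: "h j \<in> I" if "j \<in> J" for j using assms(2) that by (auto simp: bij_betw_def)
  have eq: "h j = h k \<longleftrightarrow> j = k" if "j \<in> J" "k \<in> J" for j k
    using assms(2) that by (auto simp: bij_betw_def inj_on_def)
  have "(\<Sum>j\<in>J. \<phi> (h j) x *\<^sub>R b (h j)) = x" if "x \<in> S" for x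
    using sum.reindex_bij_betw[OF assms(2), of "\<lambda>i. \<phi> i x *\<^sub>R b i"] dual_basesD(6)[OF assms(1) that]
    by simp
  then show ?thesis
    using dual_basesD[OF assms(1)] h eq bij_betw_finite[OF assms(2)]
    by (simp add: dual_bases_def)
qed

lemma dual_bases_finite_dim: "dual_bases S I b \<phi> \<Longrightarrow> finite_dim S"
proof -
  assume d: "dual_bases S I b \<phi>"
  obtain h where "bij_betw h {0..<card I} I"
    using ex_bij_betw_nat_finite[OF dual_basesD(1)[OF d]] by blast
  from dual_bases_reindex[OF d this] show ?thesis unfolding finite_dim_def by blast
qed

lemma finite_dim_subspace: "finite_dim S \<Longrightarrow> subspace S"
  by (auto simp: finite_dim_def dest: dual_basesD(2))

lemma bidual_embed_eval: "\<alpha> \<in> dual_space S \<Longrightarrow> bidual_embed S x \<alpha> = \<alpha> x"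
  by (simp add: bidual_embed_def restrict0_in)

lemma bidual_embed_in: "bidual_embed S x \<in> dual_space (dual_space S)"
  unfolding bidual_embed_def by (intro restrict0_dual_space linear_eval subspace_dual_space)

lemma bidual_embed_linear: "linear_from_to S (dual_space (dual_space S)) (bidual_embed S)"
  unfolding linear_from_to_def
  by (auto simp: bidual_embed_in)
    (auto simp: bidual_embed_def restrict0_def fun_eq_iff scaleR_fun_def
      linear_from_toD(2,3)[OF dual_spaceD[of _ S]])

lemma dual_bases_dual:
  assumes "dual_bases S I b \<phi>"
  shows "dual_bases (dual_space S) I \<phi> (\<lambda>i. bidual_embed S (b i))"
proof -
  note d = dual_basesD[OF assms]
  have "\<alpha> = (\<Sum>i\<in>I. \<alpha> (b i) *\<^sub>R \<phi> i)" if \<alpha>: "\<alpha> \<in> dual_space S" for \<alpha>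
  proof (rule dual_space_eqI[OF \<alpha>])
    show "(\<Sum>i\<in>I. \<alpha> (b i) *\<^sub>R \<phi> i) \<in> dual_space S"
      using d by (intro subspace_sum subspace_scale subspace_dual_space) auto
    fix x assume "x \<in> S"
    have "(\<Sum>i\<in>I. \<alpha> (b i) *\<^sub>R \<phi> i) x = (\<Sum>i\<in>I. \<phi> i x *\<^sub>R \<alpha> (b i))"
      using d(1) by (induction I) (auto simp: scaleR_fun_def)
    then show "\<alpha> x = (\<Sum>i\<in>I. \<alpha> (b i) *\<^sub>R \<phi> i) x"
      using dual_bases_linear_expand[OF assms dual_spaceD[OF \<alpha>] \<open>x \<in> S\<close>] by simp
  qed
  then show ?thesis
    using d by (auto simp: dual_bases_def subspace_dual_space bidual_embed_in bidual_embed_eval)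
qed

lemma finite_dim_dual: "finite_dim S \<Longrightarrow> finite_dim (dual_space S)"
  unfolding finite_dim_def using dual_bases_dual by blast

lemma finite_dim_bidual:
  assumes "finite_dim S" "\<gamma> \<in> dual_space (dual_space S)"
  obtains x where "x \<in> S" "\<gamma> = bidual_embed S x"
proof -
  obtain I :: "nat set" and b \<phi> where d: "dual_bases S I b \<phi>"
    using assms(1) by (auto simp: finite_dim_def)
  define x where "x = (\<Sum>i\<in>I. \<gamma> (\<phi> i) *\<^sub>R b i)"
  have "x \<in> S"
    unfolding x_def using dual_basesD[OF d] by (intro subspace_sum subspace_scale) auto
  moreover have "\<gamma> = bidual_embed S x"
  proof (rule dual_space_eqI[OF assms(2) bidual_embed_in])
    fix \<alpha> assume \<alpha>: "\<alpha> \<in> dual_space S"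
    have "\<gamma> \<alpha> = (\<Sum>i\<in>I. bidual_embed S (b i) \<alpha> *\<^sub>R \<gamma> (\<phi> i))"
      by (rule dual_bases_linear_expand[OF dual_bases_dual[OF d] dual_spaceD[OF assms(2)] \<alpha>])
    also have "\<dots> = \<alpha> x"
      unfolding x_def using dual_basesD[OF d] \<alpha>
      by (subst linear_from_to_sum[OF dual_spaceD[OF \<alpha>]]) (auto simp: bidual_embed_eval mult.commute)
    finally show "\<gamma> \<alpha> = bidual_embed S x \<alpha>" by (simp add: bidual_embed_eval \<alpha>)
  qed
  ultimately show ?thesis using that by blast
qed

lemma dual_separates:
  assumes "subspace S" "x \<in> S" "y \<in> S" "\<And>\<alpha>. \<alpha> \<in> dual_space S \<Longrightarrow> \<alpha> x = \<alpha> y"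
  shows "x = y"
proof -
  have "x - y = 0"
  proof (rule dual_space_separates[OF assms(1)])
    fix \<alpha> assume \<alpha>: "\<alpha> \<in> dual_space S"
    show "\<alpha> (x - y) = 0"
      using linear_from_to_diff[OF dual_spaceD[OF \<alpha>] assms(1-3)] assms(4)[OF \<alpha>] by simp
  qed (simp add: assms subspace_diff)
  then show ?thesis by simp
qed

lemma contract:
  assumes "finite_dim S" "\<theta> \<in> tensor_space S T" "\<beta> \<in> dual_space T"
  shows contract_in: "contract S \<beta> \<theta> \<in> S"
    and contract_eval: "\<alpha> \<in> dual_space S \<Longrightarrow> \<alpha> (contract S \<beta> \<theta>) = \<theta> \<alpha> \<beta>"
proof -
  have "restrict0 (dual_space S) (\<lambda>\<alpha>. \<theta> \<alpha> \<beta>) \<in> dual_space (dual_space S)"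
    using tensor_spaceD(1)[OF assms(2,3)] by (intro restrict0_dual_space subspace_dual_space)
  then obtain x where x: "x \<in> S" "restrict0 (dual_space S) (\<lambda>\<alpha>. \<theta> \<alpha> \<beta>) = bidual_embed S x"
    using finite_dim_bidual[OF assms(1)] by blast
  have *: "\<alpha> x = \<theta> \<alpha> \<beta>" if "\<alpha> \<in> dual_space S" for \<alpha>
    using fun_cong[OF x(2), of \<alpha>] that by (simp add: restrict0_in bidual_embed_eval)
  have "contract S \<beta> \<theta> = x"
    unfolding contract_def
  proof (rule the_equality)
    fix y assume "y \<in> S \<and> (\<forall>\<alpha>\<in>dual_space S. \<alpha> y = \<theta> \<alpha> \<beta>)"
    then show "y = x"
      using x(1) * by (intro dual_separates[OF finite_dim_subspace[OF assms(1)]]) auto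
  qed (use x(1) * in auto)
  then show "contract S \<beta> \<theta> \<in> S" "\<alpha> \<in> dual_space S \<Longrightarrow> \<alpha> (contract S \<beta> \<theta>) = \<theta> \<alpha> \<beta>"
    using x * by auto
qed

lemma contract_eqI:
  assumes "finite_dim S" "\<theta> \<in> tensor_space S T" "\<beta> \<in> dual_space T" "x \<in> S"
    and "\<And>\<alpha>. \<alpha> \<in> dual_space S \<Longrightarrow> \<alpha> x = \<theta> \<alpha> \<beta>"
  shows "contract S \<beta> \<theta> = x"
proof (rule dual_separates[OF finite_dim_subspace[OF assms(1)] contract_in[OF assms(1-3)] assms(4)])
  show "\<alpha> (contract S \<beta> \<theta>) = \<alpha> x" if "\<alpha> \<in> dual_space S" for \<alpha>
    using assms(5)[OF that] contract_eval[OF assms(1-3) that] by metis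
qed

lemma contract_linear_left:
  assumes "finite_dim S" "\<theta> \<in> tensor_space S T"
  shows "linear_from_to (dual_space T) S (\<lambda>\<beta>. contract S \<beta> \<theta>)"
  unfolding linear_from_to_def
proof (intro conjI ballI allI)
  note sub = finite_dim_subspace[OF assms(1)]
  fix \<beta> assume \<beta>: "\<beta> \<in> dual_space T"
  show "contract S \<beta> \<theta> \<in> S" using contract[OF assms] \<beta> by simp
  show "contract S (c *\<^sub>R \<beta>) \<theta> = c *\<^sub>R contract S \<beta> \<theta>" for c
    using \<beta> contract[OF assms \<beta>] sub linear_from_toD(3)[OF dual_spaceD[of _ S]]
      linear_from_toD(3)[OF tensor_spaceD(2)[OF assms(2)] \<beta>]
    by (intro contract_eqI[OF assms]) (auto simp: subspace_scale subspace_dual_space)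
  fix \<beta>' assume \<beta>': "\<beta>' \<in> dual_space T"
  show "contract S (\<beta> + \<beta>') \<theta> = contract S \<beta> \<theta> + contract S \<beta>' \<theta>"
    using \<beta> \<beta>' contract[OF assms \<beta>] contract[OF assms \<beta>'] sub
      linear_from_toD(2)[OF dual_spaceD[of _ S]]
      linear_from_toD(2)[OF tensor_spaceD(2)[OF assms(2)] \<beta> \<beta>']
    by (intro contract_eqI[OF assms]) (auto simp: subspace_add subspace_dual_space)
qed

lemma contract_linear_right:
  assumes "finite_dim S" "\<beta> \<in> dual_space T"
  shows "linear_from_to (tensor_space S T) S (contract S \<beta>)"
  unfolding linear_from_to_def
proof (intro conjI ballI allI)
  note sub = finite_dim_subspace[OF assms(1)]
  fix \<theta> assume \<theta>: "\<theta> \<in> tensor_space S T"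
  show "contract S \<beta> \<theta> \<in> S" using contract[OF assms(1) \<theta> assms(2)] by simp
  show "contract S \<beta> (c *\<^sub>R \<theta>) = c *\<^sub>R contract S \<beta> \<theta>" for c
    using contract[OF assms(1) \<theta> assms(2)] sub assms linear_from_toD(3)[OF dual_spaceD[of _ S]]
      subspace_scale[OF subspace_tensor_space \<theta>, of c]
    by (intro contract_eqI[of S _ T]) (auto simp: subspace_scale scaleR_fun_def)
  fix \<theta>' assume \<theta>': "\<theta>' \<in> tensor_space S T"
  show "contract S \<beta> (\<theta> + \<theta>') = contract S \<beta> \<theta> + contract S \<beta> \<theta>'"
    using \<theta> \<theta>' contract[OF assms(1) \<theta> assms(2)] contract[OF assms(1) \<theta>' assms(2)] sub assms
      linear_from_toD(2)[OF dual_spaceD[of _ S]]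
    by (intro contract_eqI[of S _ T]) (auto simp: subspace_add subspace_tensor_space)
qed

lemma dual_bases_hom:
  assumes S: "dual_bases S I b \<phi>" and T: "dual_bases T J c \<psi>"
  shows "dual_bases (hom_space S T) (I \<times> J) (\<lambda>(i, j). restrict0 S (\<lambda>x. \<phi> i x *\<^sub>R c j))
    (\<lambda>(i, j). restrict0 (hom_space S T) (\<lambda>h. \<psi> j (h (b i))))"
proof -
  note s = dual_basesD[OF S] note t = dual_basesD[OF T]
  let ?H = "hom_space S T"
  have subH: "subspace ?H" by (rule subspace_hom_space[OF t(2)])
  have e: "restrict0 S (\<lambda>x. \<phi> i x *\<^sub>R c j) \<in> ?H" if "i \<in> I" "j \<in> J" for i j
    using that s t linear_from_toD[OF s(7)[OF that(1)]]
    by (intro restrict0_hom_space) (auto simp: linear_from_to_def subspace_scale algebra_simps)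
  have "linear_from_to ?H UNIV (\<lambda>h. \<psi> j (h (b i)))" if "i \<in> I" "j \<in> J" for i j
    using that s(3) linear_from_toD[OF t(7)[OF that(2)]] hom_spaceD[THEN linear_from_toD(1)]
    by (fastforce simp: linear_from_to_def scaleR_fun_def)
  then have f: "restrict0 ?H (\<lambda>h. \<psi> j (h (b i))) \<in> dual_space ?H" if "i \<in> I" "j \<in> J" for i j
    using that subH by (intro restrict0_dual_space) auto
  have "h = (\<Sum>(i, j)\<in>I \<times> J. \<psi> j (h (b i)) *\<^sub>R restrict0 S (\<lambda>x. \<phi> i x *\<^sub>R c j))"
    if h: "h \<in> ?H" for h
  proof (rule hom_space_eqI[OF h])
    show "(\<Sum>(i, j)\<in>I \<times> J. \<psi> j (h (b i)) *\<^sub>R restrict0 S (\<lambda>x. \<phi> i x *\<^sub>R c j)) \<in> ?H"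
      using e by (intro subspace_sum[OF subH]) (auto intro: subspace_scale[OF subH])
    fix x assume x: "x \<in> S"
    have hb: "h (b i) \<in> T" if "i \<in> I" for i
      using linear_from_toD(1)[OF hom_spaceD[OF h]] s(3)[OF that] by simp
    have ev: "(\<Sum>p\<in>Q. g p) x = (\<Sum>p\<in>Q. g p x)" if "finite Q" for Q and g :: "'b \<times> 'd \<Rightarrow> 'a \<Rightarrow> 'c"
      using that by induction auto
    have "h x = (\<Sum>i\<in>I. \<phi> i x *\<^sub>R h (b i))"
      by (rule dual_bases_linear_expand[OF S hom_spaceD[OF h] x])
    also have "\<dots> = (\<Sum>i\<in>I. \<phi> i x *\<^sub>R (\<Sum>j\<in>J. \<psi> j (h (b i)) *\<^sub>R c j))"
      using t(6)[OF hb] by simp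
    also have "\<dots> = (\<Sum>(i, j)\<in>I \<times> J. (\<psi> j (h (b i)) *\<^sub>R restrict0 S (\<lambda>x. \<phi> i x *\<^sub>R c j)) x)"
      by (simp add: sum.cartesian_product[symmetric] scaleR_sum_right scaleR_fun_def restrict0_in x
          mult.commute)
    also have "\<dots> = (\<Sum>(i, j)\<in>I \<times> J. \<psi> j (h (b i)) *\<^sub>R restrict0 S (\<lambda>x. \<phi> i x *\<^sub>R c j)) x"
      using s(1) t(1) by (subst ev) (auto simp: case_prod_beta)
    finally show "h x = (\<Sum>(i, j)\<in>I \<times> J. \<psi> j (h (b i)) *\<^sub>R restrict0 S (\<lambda>x. \<phi> i x *\<^sub>R c j)) x" .
  qed
  then have "h = (\<Sum>p\<in>I \<times> J. (\<lambda>(i, j). restrict0 ?H (\<lambda>h. \<psi> j (h (b i)))) p h *\<^sub>R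
      (\<lambda>(i, j). restrict0 S (\<lambda>x. \<phi> i x *\<^sub>R c j)) p)" if "h \<in> ?H" for h
    using that by (simp add: case_prod_beta restrict0_in)
  moreover have "restrict0 ?H (\<lambda>h. \<psi> j (h (b i))) (restrict0 S (\<lambda>x. \<phi> i' x *\<^sub>R c j')) =
      (if (i, j) = (i', j') then 1 else 0)" if "i \<in> I" "j \<in> J" "i' \<in> I" "j' \<in> J" for i j i' j'
    using that e s t linear_from_to_0[OF t(7) t(2)] by (auto simp: restrict0_in)
  ultimately show ?thesis
    using subH s(1) t(1) e f unfolding dual_bases_def by fastforce
qed

lemma dual_bases_prod:
  assumes S: "dual_bases S I b \<phi>" and T: "dual_bases T J c \<psi>"
  shows "dual_bases (S \<times> T) (Inl ` I \<union> Inr ` J)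
    (case_sum (\<lambda>i. (b i, 0)) (\<lambda>j. (0, c j)))
    (case_sum (\<lambda>i. restrict0 (S \<times> T) (\<lambda>(x, y). \<phi> i x)) (\<lambda>j. restrict0 (S \<times> T) (\<lambda>(x, y). \<psi> j y)))"
    (is "dual_bases _ ?I ?b ?f")
proof -
  note s = dual_basesD[OF S] note t = dual_basesD[OF T]
  have sub: "subspace (S \<times> T)" using s(2) t(2) by (rule subspace_Times)
  have zero: "i \<in> I \<Longrightarrow> \<phi> i 0 = 0" "j \<in> J \<Longrightarrow> \<psi> j 0 = 0" for i j
    using linear_from_to_0[OF s(7) s(2)] linear_from_to_0[OF t(7) t(2)] by auto
  have "restrict0 (S \<times> T) (\<lambda>(x, y). \<phi> i x) \<in> dual_space (S \<times> T)" if "i \<in> I" for i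
    using linear_from_toD[OF s(7)[OF that]] sub
    by (intro restrict0_dual_space) (auto simp: linear_from_to_def)
  moreover have "restrict0 (S \<times> T) (\<lambda>(x, y). \<psi> j y) \<in> dual_space (S \<times> T)" if "j \<in> J" for j
    using linear_from_toD[OF t(7)[OF that]] sub
    by (intro restrict0_dual_space) (auto simp: linear_from_to_def)
  ultimately have f: "\<forall>k\<in>?I. ?f k \<in> dual_space (S \<times> T)" by auto
  have b: "\<forall>k\<in>?I. ?b k \<in> S \<times> T"
    using s(3) t(3) subspace_0[OF s(2)] subspace_0[OF t(2)] by auto
  have "?f k (?b l) = (if k = l then 1 else 0)" if "k \<in> ?I" "l \<in> ?I" for k l
  proof -
    have "?b l \<in> S \<times> T" using b that(2) by blast
    then show ?thesis
      using that s(5) t(5) zero by (elim UnE imageE) (simp_all add: restrict0_in)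
  qed
  then have "\<forall>k\<in>?I. \<forall>l\<in>?I. ?f k (?b l) = (if k = l then 1 else 0)" by blast
  moreover have "(x, y) = (\<Sum>k\<in>?I. ?f k (x, y) *\<^sub>R ?b k)" if "x \<in> S" "y \<in> T" for x y
  proof -
    have 1: "(\<Sum>i\<in>I. (\<phi> i x *\<^sub>R b i, 0 :: 'c)) = (x, 0)"
      using s(6)[OF that(1)] sum_prod[of "\<lambda>i. \<phi> i x *\<^sub>R b i" "\<lambda>_. 0 :: 'c" I] by simp
    have 2: "(\<Sum>j\<in>J. (0 :: 'a, \<psi> j y *\<^sub>R c j)) = (0, y)"
      using t(6)[OF that(2)] sum_prod[of "\<lambda>_. 0 :: 'a" "\<lambda>j. \<psi> j y *\<^sub>R c j" J] by simp
    show ?thesis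
      using s(1) t(1) that 1 2
      by (subst sum.union_disjoint) (auto simp: sum.reindex restrict0_in)
  qed
  then have "\<forall>z\<in>S \<times> T. z = (\<Sum>k\<in>?I. ?f k z *\<^sub>R ?b k)" by blast
  moreover have "finite ?I" using s(1) t(1) by simp
  ultimately show ?thesis
    using sub f b unfolding dual_bases_def by (intro conjI)
qed

text \<open>Steinitz exchange: the basis vector with index \<open>a\<close> is replaced by \<open>y\<close>, which gets the index
  \<open>k\<close>.\<close>

lemma dual_bases_exchange:
  assumes S: "dual_bases S I b \<phi>" and a: "a \<in> I" "k \<notin> I" and y: "y \<in> S" "\<phi> a y \<noteq> 0"
  shows "dual_bases S (insert k (I - {a})) (b(k := y))
    (\<lambda>i. if i = k then (\<lambda>x. \<phi> a x / \<phi> a y) else (\<lambda>x. \<phi> i x - \<phi> i y * (\<phi> a x / \<phi> a y)))"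
    (is "dual_bases S ?I ?b ?\<phi>")
proof -
  note s = dual_basesD[OF S]
  have "x = (\<Sum>i\<in>?I. ?\<phi> i x *\<^sub>R ?b i)" if x: "x \<in> S" for x
  proof -
    define r where "r = \<phi> a x / \<phi> a y"
    have "(\<Sum>i\<in>?I. ?\<phi> i x *\<^sub>R ?b i) = r *\<^sub>R y + (\<Sum>i\<in>I - {a}. (\<phi> i x - \<phi> i y * r) *\<^sub>R b i)"
      using s(1) a by (simp add: r_def) (intro sum.cong, auto)
    also have "(\<Sum>i\<in>I - {a}. (\<phi> i x - \<phi> i y * r) *\<^sub>R b i) = (\<Sum>i\<in>I. (\<phi> i x - \<phi> i y * r) *\<^sub>R b i)"
      using s(1) a(1) y(2) by (subst sum.remove[of I a]) (auto simp: r_def)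
    also have "\<dots> = (\<Sum>i\<in>I. \<phi> i x *\<^sub>R b i) - r *\<^sub>R (\<Sum>i\<in>I. \<phi> i y *\<^sub>R b i)"
      by (simp add: scaleR_diff_left sum_subtractf scaleR_sum_right mult.commute)
    finally show ?thesis using s(6)[OF x] s(6)[OF y(1)] by (simp add: r_def)
  qed
  then have "\<forall>x\<in>S. x = (\<Sum>i\<in>?I. ?\<phi> i x *\<^sub>R ?b i)" by blast
  moreover have "\<forall>i\<in>?I. \<forall>l\<in>?I. ?\<phi> i (?b l) = (if i = l then 1 else 0)"
  proof (intro ballI)
    fix i l assume "i \<in> ?I" "l \<in> ?I"
    then show "?\<phi> i (?b l) = (if i = l then 1 else 0)"
      using s(5)[of i l] s(5)[of a l] a y(2) by auto
  qed
  moreover have "\<forall>i\<in>?I. ?b i \<in> S"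
    using s(3) y(1) by auto
  moreover have "\<forall>i\<in>?I. ?\<phi> i \<in> dual_space S"
  proof
    fix i assume i: "i \<in> ?I"
    have "(\<lambda>x. \<phi> a x / \<phi> a y) \<in> dual_space S"
      using s(4)[OF a(1)]
      by (simp add: dual_space_def hom_space_def linear_from_to_def add_divide_distrib)
    moreover have "(\<lambda>x. \<phi> i x - \<phi> i y * (\<phi> a x / \<phi> a y)) \<in> dual_space S" if "i \<in> I"
      using s(4)[OF a(1)] s(4)[OF that]
      by (simp add: dual_space_def hom_space_def linear_from_to_def add_divide_distrib algebra_simps)
    ultimately show "?\<phi> i \<in> dual_space S" using i a(2) by (cases "i = k") auto
  qed
  moreover have "finite ?I" using s(1) by simp
  ultimately show ?thesis
    using s(2) unfolding dual_bases_def by (intro conjI)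
qed

lemma dual_bases_representation:
  assumes "finite I" "inj_on b I" "independent (b ` I)" "span (b ` I) = S"
  shows "dual_bases S I b (\<lambda>i. restrict0 S (\<lambda>x. representation (b ` I) x (b i)))"
proof -
  have sub: "subspace S" using assms(4) subspace_span by blast
  have "linear_from_to S UNIV (\<lambda>x. representation (b ` I) x (b i))" for i
    unfolding assms(4)[symmetric] linear_from_to_def
    using representation_add[OF assms(3)] representation_scale[OF assms(3)] by simp
  moreover have "b i \<in> S" if "i \<in> I" for i
    using span_base[of "b i" "b ` I"] that by (simp add: assms(4))
  moreover have "x = (\<Sum>i\<in>I. restrict0 S (\<lambda>x. representation (b ` I) x (b i)) x *\<^sub>R b i)"
    if "x \<in> S" for x
    using sum_representation_eq[of "b ` I" x "b ` I"] assms that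
    by (simp add: sum.reindex restrict0_in)
  ultimately show ?thesis
    using assms sub restrict0_dual_space[OF _ sub]
    by (auto simp: dual_bases_def restrict0_in representation_basis inj_on_def)
qed

lemma dual_bases_basis:
  assumes "dual_bases S I b \<phi>"
  shows "inj_on b I" "independent (b ` I)" "span (b ` I) = S"
proof -
  note s = dual_basesD[OF assms]
  show inj: "inj_on b I"
  proof
    fix i k assume "i \<in> I" "k \<in> I" "b i = b k"
    then show "i = k" using s(5)[of i i] s(5)[of i k] by (auto split: if_splits)
  qed
  have "c (b i) = 0" if "(\<Sum>v\<in>b ` I. c v *\<^sub>R v) = 0" "i \<in> I" for c i
    using dual_bases_coord_sum[OF assms that(2), of "\<lambda>i. c (b i)"] that
      linear_from_to_0[OF s(7) s(2)] inj by (simp add: sum.reindex)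
  then show "independent (b ` I)"
    using s(1) by (auto simp: dependent_finite)
  show "span (b ` I) = S"
  proof
    show "span (b ` I) \<subseteq> S" using s by (intro span_minimal) auto
    show "S \<subseteq> span (b ` I)"
    proof
      fix x assume "x \<in> S"
      have "(\<Sum>i\<in>I. \<phi> i x *\<^sub>R b i) \<in> span (b ` I)"
        by (intro span_sum span_scale span_base) auto
      then show "x \<in> span (b ` I)" using s(6)[OF \<open>x \<in> S\<close>] by simp
    qed
  qed
qed

section \<open>Local frames\<close>

text \<open>Let \<open>F\<close> be a family of vector spaces and \<open>P W \<sigma>\<close> a notion of smoothness for sections \<open>\<sigma>\<close> of
  \<open>F\<close> over \<open>W\<close>. A coframe over the open set \<open>W\<close> is a family \<open>t\<close> of sections that form a basis of
  each fibre, with dual bases \<open>\<phi>\<close>, such that the smooth sections over open subsets of \<open>W\<close> are the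
  sections with smooth coordinates. The index set is arbitrary, so that frames of bundles of
  homomorphisms or of sums need not be renumbered.\<close>

definition coframe :: "('m::topological_space, 'b::real_normed_vector) atlas \<Rightarrow>
    ('m \<Rightarrow> 'e::real_vector set) \<Rightarrow> ('m set \<Rightarrow> ('m \<Rightarrow> 'e) \<Rightarrow> bool) \<Rightarrow> 'm set \<Rightarrow> 'i set \<Rightarrow>
    ('i \<Rightarrow> 'm \<Rightarrow> 'e) \<Rightarrow> ('i \<Rightarrow> 'm \<Rightarrow> 'e \<Rightarrow> real) \<Rightarrow> bool" where
  "coframe A F P W I t \<phi> \<longleftrightarrow> open W \<and> finite I \<and>
     (\<forall>m\<in>W. dual_bases (F m) I (\<lambda>i. t i m) (\<lambda>i. \<phi> i m)) \<and>
     (\<forall>W' \<sigma>. open W' \<and> W' \<subseteq> W \<and> (\<forall>m\<in>W'. \<sigma> m \<in> F m) \<longrightarrow>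
        (P W' \<sigma> \<longleftrightarrow> (\<forall>i\<in>I. smooth_fun A W' (\<lambda>m. \<phi> i m (\<sigma> m)))))"

text \<open>The smooth sections form a sheaf, and there are coframes near every point.\<close>

definition locally_trivial :: "('m::topological_space, 'b::real_normed_vector) atlas \<Rightarrow>
    ('m \<Rightarrow> 'e::real_vector set) \<Rightarrow> ('m set \<Rightarrow> ('m \<Rightarrow> 'e) \<Rightarrow> bool) \<Rightarrow> bool" where
  "locally_trivial A F P \<longleftrightarrow>
     (\<forall>W W' \<sigma>. open W \<and> open W' \<and> W' \<subseteq> W \<and> P W \<sigma> \<longrightarrow> P W' \<sigma>) \<and>
     (\<forall>W \<sigma>. open W \<and> (\<forall>m\<in>W. \<sigma> m \<in> F m) \<and> (\<forall>m\<in>W. \<exists>W'. open W' \<and> m \<in> W' \<and> W' \<subseteq> W \<and> P W' \<sigma>)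
        \<longrightarrow> P W \<sigma>) \<and>
     (\<forall>m. \<exists>W (I::nat set) t \<phi>. m \<in> W \<and> coframe A F P W I t \<phi>)"

lemma coframeD:
  assumes "coframe A F P W I t \<phi>"
  shows "open W" "finite I" "m \<in> W \<Longrightarrow> dual_bases (F m) I (\<lambda>i. t i m) (\<lambda>i. \<phi> i m)"
    "open W' \<Longrightarrow> W' \<subseteq> W \<Longrightarrow> (\<And>m. m \<in> W' \<Longrightarrow> \<sigma> m \<in> F m) \<Longrightarrow>
       P W' \<sigma> \<longleftrightarrow> (\<forall>i\<in>I. smooth_fun A W' (\<lambda>m. \<phi> i m (\<sigma> m)))"
  using assms unfolding coframe_def by auto

lemma locally_trivialD:
  assumes "locally_trivial A F P"
  shows "open W \<Longrightarrow> open W' \<Longrightarrow> W' \<subseteq> W \<Longrightarrow> P W \<sigma> \<Longrightarrow> P W' \<sigma>"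
    "open W \<Longrightarrow> (\<And>m. m \<in> W \<Longrightarrow> \<sigma> m \<in> F m) \<Longrightarrow>
       (\<And>m. m \<in> W \<Longrightarrow> \<exists>W'. open W' \<and> m \<in> W' \<and> W' \<subseteq> W \<and> P W' \<sigma>) \<Longrightarrow> P W \<sigma>"
proof -
  show "open W \<Longrightarrow> open W' \<Longrightarrow> W' \<subseteq> W \<Longrightarrow> P W \<sigma> \<Longrightarrow> P W' \<sigma>"
    using assms unfolding locally_trivial_def by blast
  have glue: "\<forall>W \<sigma>. open W \<and> (\<forall>m\<in>W. \<sigma> m \<in> F m) \<and>
      (\<forall>m\<in>W. \<exists>W'. open W' \<and> m \<in> W' \<and> W' \<subseteq> W \<and> P W' \<sigma>) \<longrightarrow> P W \<sigma>"
    using assms unfolding locally_trivial_def by (elim conjE)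
  show "P W \<sigma>" if "open W" "\<And>m. m \<in> W \<Longrightarrow> \<sigma> m \<in> F m"
    "\<And>m. m \<in> W \<Longrightarrow> \<exists>W'. open W' \<and> m \<in> W' \<and> W' \<subseteq> W \<and> P W' \<sigma>"
    using that by (intro mp[OF spec[OF spec[OF glue]]] conjI ballI)
qed

lemma locally_trivial_coframe:
  assumes "locally_trivial A F P"
  obtains W and I :: "nat set" and t \<phi> where "m \<in> W" "coframe A F P W I t \<phi>"
  using assms unfolding locally_trivial_def by metis

lemma coframe_subset:
  assumes "coframe A F P W I t \<phi>" "open W'" "W' \<subseteq> W"
  shows "coframe A F P W' I t \<phi>"
  unfolding coframe_def
proof (intro conjI ballI allI impI; (elim conjE)?)
  fix V \<sigma> assume "open V" "V \<subseteq> W'" "\<forall>m\<in>V. \<sigma> m \<in> F m"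
  then show "P V \<sigma> \<longleftrightarrow> (\<forall>i\<in>I. smooth_fun A V (\<lambda>m. \<phi> i m (\<sigma> m)))"
    using assms(3) by (intro coframeD(4)[OF assms(1)]) auto
qed (use coframeD(2,3)[OF assms(1)] assms(2,3) in auto)

lemma coframe_reindex:
  assumes "coframe A F P W I t \<phi>" "bij_betw h J I"
  shows "coframe A F P W J (\<lambda>j. t (h j)) (\<lambda>j. \<phi> (h j))"
proof -
  note c = coframeD[OF assms(1)]
  have "h ` J = I" using assms(2) by (simp add: bij_betw_def)
  then have "(\<forall>i\<in>I. Q i) \<longleftrightarrow> (\<forall>j\<in>J. Q (h j))" for Q by auto
  moreover have "dual_bases (F m) J (\<lambda>i. t (h i) m) (\<lambda>i. \<phi> (h i) m)" if "m \<in> W" for m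
    by (rule dual_bases_reindex[OF c(3)[OF that] assms(2)])
  ultimately show ?thesis
    using c(1,4) bij_betw_finite[OF assms(2)] c(2) unfolding coframe_def by simp
qed

lemma coframe_exists_nat:
  assumes "coframe A F P W I t \<phi>"
  obtains r :: nat and t' \<phi>' where "coframe A F P W {..<r} t' \<phi>'"
proof -
  obtain h where "bij_betw h {0..<card I} I"
    using ex_bij_betw_nat_finite[OF coframeD(2)[OF assms]] by blast
  from coframe_reindex[OF assms this] have "coframe A F P W {..<card I} (\<lambda>j. t (h j)) (\<lambda>j. \<phi> (h j))"
    by (simp only: atLeast0LessThan)
  then show ?thesis by (rule that)
qed

lemma coframe_is_frame: "coframe A F P W {..<r} t \<phi> \<Longrightarrow> is_frame F W r t"
  unfolding is_frame_def by (intro ballI conjI dual_bases_basis[OF coframeD(3)])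

lemma coframe_frame_section:
  assumes "coframe A F P W I t \<phi>" "i \<in> I"
  shows "m \<in> W \<Longrightarrow> t i m \<in> F m"
  using dual_basesD(3)[OF coframeD(3)[OF assms(1)] assms(2)] .

text \<open>The coordinates with respect to a frame in the sense of \<^const>\<open>is_frame\<close>.\<close>

definition frame_coord :: "nat \<Rightarrow> (nat \<Rightarrow> 'm \<Rightarrow> 'e::real_vector) \<Rightarrow> nat \<Rightarrow> 'm \<Rightarrow> 'e \<Rightarrow> real" where
  "frame_coord r s i m = restrict0 (span ((\<lambda>i. s i m) ` {..<r}))
     (\<lambda>x. representation ((\<lambda>i. s i m) ` {..<r}) x (s i m))"

lemma frame_coord:
  assumes "is_frame F W r s" "m \<in> W"
  shows "dual_bases (F m) {..<r} (\<lambda>i. s i m) (\<lambda>i. frame_coord r s i m)"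
proof -
  have "inj_on (\<lambda>i. s i m) {..<r}" "independent ((\<lambda>i. s i m) ` {..<r})"
    "span ((\<lambda>i. s i m) ` {..<r}) = F m"
    using assms by (auto simp: is_frame_def)
  from dual_bases_representation[OF _ this] this(3) show ?thesis
    by (simp add: frame_coord_def)
qed

lemma dual_bases_unique:
  assumes "dual_bases S I b \<phi>" "dual_bases S I b \<psi>" "i \<in> I"
  shows "\<phi> i = \<psi> i"
proof (rule dual_space_eqI[OF dual_basesD(4)[OF assms(1,3)] dual_basesD(4)[OF assms(2,3)]])
  fix x assume "x \<in> S"
  have "\<psi> i x = \<psi> i (\<Sum>k\<in>I. \<phi> k x *\<^sub>R b k)"
    using dual_basesD(6)[OF assms(1) \<open>x \<in> S\<close>] by simp
  also have "\<dots> = \<phi> i x" by (rule dual_bases_coord_sum[OF assms(2,3)])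
  finally show "\<phi> i x = \<psi> i x" by simp
qed

lemma smooth_section_fibre: "smooth_section A E W \<sigma> \<Longrightarrow> m \<in> W \<Longrightarrow> \<sigma> m \<in> fibre E m"
  by (simp add: smooth_section_def)

lemma smooth_section_cong:
  assumes \<sigma>: "smooth_section A E W \<sigma>" and eq: "\<And>m. m \<in> W \<Longrightarrow> \<sigma> m = \<sigma>' m"
  shows "smooth_section A E W \<sigma>'"
  unfolding smooth_section_def
proof (intro conjI ballI)
  show "\<sigma>' m \<in> fibre E m" if "m \<in> W" for m
    using smooth_section_fibre[OF \<sigma> that] eq[OF that] by simp
  fix f assume f: "f \<in> frames E"
  obtain W' r s where f_eq: "f = (W', r, s)" by (cases f)
  obtain c where c: "\<forall>i<r. smooth_fun A (W \<inter> W') (c i)" "\<forall>m\<in>W \<inter> W'. \<sigma> m = (\<Sum>i<r. c i m *\<^sub>R s i m)"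
    using \<sigma> f unfolding smooth_section_def f_eq by blast
  have "\<sigma>' m = (\<Sum>i<r. c i m *\<^sub>R s i m)" if "m \<in> W \<inter> W'" for m
    using c(2) eq[of m] that by (metis IntE)
  then show "case f of (W', r, s) \<Rightarrow> \<exists>c. (\<forall>i<r. smooth_fun A (W \<inter> W') (c i)) \<and>
      (\<forall>m\<in>W \<inter> W'. \<sigma>' m = (\<Sum>i<r. c i m *\<^sub>R s i m))"
    using c(1) unfolding f_eq by blast
qed

lemma coframe_coord_smooth:
  assumes c: "coframe A (fibre E) (smooth_section A E) W I t \<phi>"
    and W': "open W'" "W' \<subseteq> W" and \<sigma>: "smooth_section A E W' \<sigma>" and i: "i \<in> I"
  shows "smooth_fun A W' (\<lambda>m. \<phi> i m (\<sigma> m))"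
proof -
  have "\<forall>i\<in>I. smooth_fun A W' (\<lambda>m. \<phi> i m (\<sigma> m))"
    by (rule iffD1[OF coframeD(4)[OF c W' smooth_section_fibre[OF \<sigma>]] \<sigma>])
  then show ?thesis using i by (rule bspec)
qed

context smooth_base
begin

text \<open>The smooth version of \<open>dual_bases_exchange\<close>.\<close>

lemma coframe_exchange:
  assumes c: "coframe A F P W I t \<phi>" and a: "a \<in> I" "k \<notin> I" and W': "open W'" "W' \<subseteq> W"
    and \<tau>: "P W' \<tau>" "\<And>m. m \<in> W' \<Longrightarrow> \<tau> m \<in> F m" "\<And>m. m \<in> W' \<Longrightarrow> \<phi> a m (\<tau> m) \<noteq> 0"
  shows "coframe A F P W' (insert k (I - {a})) (t(k := \<tau>))
    (\<lambda>i m. if i = k then (\<lambda>x. \<phi> a m x / \<phi> a m (\<tau> m))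
       else (\<lambda>x. \<phi> i m x - \<phi> i m (\<tau> m) * (\<phi> a m x / \<phi> a m (\<tau> m))))"
    (is "coframe A F P W' ?I ?t ?f")
proof -
  note d = coframeD[OF c]
  have db: "dual_bases (F m) ?I (\<lambda>i. ?t i m) (\<lambda>i. ?f i m)" if "m \<in> W'" for m
  proof -
    have "(\<lambda>i. t i m)(k := \<tau> m) = (\<lambda>i. (t(k := \<tau>)) i m)" by auto
    then show ?thesis
      using dual_bases_exchange[OF d(3) a \<tau>(2,3)[OF that]] W'(2) that by auto
  qed
  have coord_\<tau>: "smooth_fun A W' (\<lambda>m. \<phi> i m (\<tau> m))" if "i \<in> I" for i
    using d(4)[OF W' \<tau>(2)] \<tau>(1) that by blast
  have sm: "P W'' \<sigma> \<longleftrightarrow> (\<forall>i\<in>?I. smooth_fun A W'' (\<lambda>m. ?f i m (\<sigma> m)))"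
    if W'': "open W''" "W'' \<subseteq> W'" "\<And>m. m \<in> W'' \<Longrightarrow> \<sigma> m \<in> F m" for W'' \<sigma>
  proof -
    have c\<tau>: "smooth_fun A W'' (\<lambda>m. \<phi> i m (\<tau> m))" if "i \<in> I" for i
      using coord_\<tau>[OF that] smooth_fun_subset W''(2) by blast
    have inv: "smooth_fun A W'' (\<lambda>m. inverse (\<phi> a m (\<tau> m)))"
      using \<tau>(3) W'' by (intro smooth_fun_inverse c\<tau> a) auto
    have iff: "P W'' \<sigma> \<longleftrightarrow> (\<forall>i\<in>I. smooth_fun A W'' (\<lambda>m. \<phi> i m (\<sigma> m)))"
      using W'' W'(2) by (intro d(4)) auto
    show ?thesis
    proof
      assume "P W'' \<sigma>"
      then have \<sigma>: "smooth_fun A W'' (\<lambda>m. \<phi> i m (\<sigma> m))" if "i \<in> I" for i using iff that by blast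
      have quot: "smooth_fun A W'' (\<lambda>m. \<phi> a m (\<sigma> m) / \<phi> a m (\<tau> m))"
        using smooth_fun_mult[OF W''(1) \<sigma>[OF a(1)] inv] by (simp add: divide_inverse)
      show "\<forall>i\<in>?I. smooth_fun A W'' (\<lambda>m. ?f i m (\<sigma> m))"
      proof
        fix i assume i: "i \<in> ?I"
        show "smooth_fun A W'' (\<lambda>m. ?f i m (\<sigma> m))"
        proof (cases "i = k")
          case False
          then have "i \<in> I" using i by simp
          then show ?thesis
            using False smooth_fun_diff[OF W''(1) \<sigma> smooth_fun_mult[OF W''(1) c\<tau> quot]] by simp
        qed (use quot in simp)
      qed
    next
      assume \<sigma>: "\<forall>i\<in>?I. smooth_fun A W'' (\<lambda>m. ?f i m (\<sigma> m))"
      have quot: "smooth_fun A W'' (\<lambda>m. \<phi> a m (\<sigma> m) / \<phi> a m (\<tau> m))"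
        using bspec[OF \<sigma>, of k] by simp
      have "smooth_fun A W'' (\<lambda>m. \<phi> i m (\<sigma> m))" if i: "i \<in> I" for i
      proof (cases "i = a")
        case True
        show ?thesis
          by (rule smooth_fun_cong[OF W''(1) _ smooth_fun_mult[OF W''(1) quot c\<tau>[OF a(1)]]])
            (use True \<tau>(3) W''(2) in auto)
      next
        case False
        then have "smooth_fun A W'' (\<lambda>m. \<phi> i m (\<sigma> m) - \<phi> i m (\<tau> m) * (\<phi> a m (\<sigma> m) / \<phi> a m (\<tau> m)))"
          using bspec[OF \<sigma>, of i] i a(2) by (cases "i = k") auto
        from smooth_fun_add[OF W''(1) this smooth_fun_mult[OF W''(1) c\<tau>[OF i] quot]]
        show ?thesis by simp
      qed
      then show "P W'' \<sigma>" using iff by blast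
    qed
  qed
  show ?thesis
    unfolding coframe_def
  proof (intro conjI ballI allI impI)
    show "finite ?I" using d(2) by simp
  qed (use W'(1) in assumption, use db in blast, elim conjE, rule sm, auto)
qed

text \<open>Smooth sections that are linearly independent at a point \<open>m\<close> can be completed to a coframe
  near \<open>m\<close> with members of any given coframe. This replaces the smoothness of the inverse of a smooth
  matrix in all that follows.\<close>

lemma coframe_extend:
  fixes J :: "'j set" and I :: "'i set"
  assumes c: "coframe A F P W I t \<phi>" and m: "m \<in> W" and J: "finite J"
    and \<tau>: "\<And>j. j \<in> J \<Longrightarrow> P W (\<tau> j)" "\<And>j x. j \<in> J \<Longrightarrow> x \<in> W \<Longrightarrow> \<tau> j x \<in> F x"
    and indep: "\<And>d j. (\<Sum>j\<in>J. d j *\<^sub>R \<tau> j m) = 0 \<Longrightarrow> j \<in> J \<Longrightarrow> d j = 0"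
  shows "\<exists>W' I' t' \<phi>'. m \<in> W' \<and> W' \<subseteq> W \<and> coframe A F P W' (Inl ` J \<union> Inr ` I' :: ('j + 'i) set) t' \<phi>' \<and>
    (\<forall>j\<in>J. t' (Inl j) = \<tau> j)"
  using J \<tau> indep
proof (induction J)
  case empty
  have "bij_betw projr (Inr ` I :: ('j + 'i) set) I"
    by (intro bij_betw_imageI inj_onI) (auto simp: image_image)
  from coframe_reindex[OF c this] show ?case using m by (intro exI[of _ W] exI[of _ I]) auto
next
  case (insert k J)
  have "\<exists>W' I' t' \<phi>'. m \<in> W' \<and> W' \<subseteq> W \<and> coframe A F P W' (Inl ` J \<union> Inr ` I' :: ('j + 'i) set) t' \<phi>' \<and>
      (\<forall>j\<in>J. t' (Inl j) = \<tau> j)"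
  proof (rule insert.IH)
    fix d j assume d: "(\<Sum>j\<in>J. d j *\<^sub>R \<tau> j m) = 0" "j \<in> J"
    have "(\<Sum>j\<in>J. (d(k := 0)) j *\<^sub>R \<tau> j m) = (\<Sum>j\<in>J. d j *\<^sub>R \<tau> j m)"
      using insert.hyps by (intro sum.cong) auto
    then have "(\<Sum>j\<in>insert k J. (d(k := 0)) j *\<^sub>R \<tau> j m) = 0"
      using insert.hyps d(1) by simp
    from insert.prems(3)[OF this, of j] show "d j = 0" using d(2) insert.hyps by (auto split: if_splits)
  qed (use insert.prems in auto)
  then obtain W' I' t' \<phi>' where W': "m \<in> W'" "W' \<subseteq> W"
    and c': "coframe A F P W' (Inl ` J \<union> Inr ` I' :: ('j + 'i) set) t' \<phi>'"
    and t': "\<forall>j\<in>J. t' (Inl j) = \<tau> j" by blast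
  note d = coframeD[OF c'] and b = coframeD(3)[OF c' W'(1)]
  have fin: "finite I'" using d(2) by (auto dest: finite_imageD)
  have \<tau>k: "P W' (\<tau> k)" "\<And>x. x \<in> W' \<Longrightarrow> \<tau> k x \<in> F x"
  proof -
    show mem: "\<And>x. x \<in> W' \<Longrightarrow> \<tau> k x \<in> F x" using insert.prems(2) W'(2) by auto
    have "\<forall>i\<in>I. smooth_fun A W (\<lambda>x. \<phi> i x (\<tau> k x))"
      using coframeD(4)[OF c coframeD(1)[OF c] order_refl, of "\<tau> k"] insert.prems(1,2) by auto
    then show "P W' (\<tau> k)"
      using coframeD(4)[OF c d(1) W'(2) mem] smooth_fun_subset[OF _ W'(2)] by blast
  qed
  \<comment> \<open>Since \<open>\<tau> k\<close> is not in the span of the other \<open>\<tau> j\<close> at \<open>m\<close>, it has a nonzero coordinate in one of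
    the remaining directions; it takes the place of that basis vector.\<close>
  have "\<exists>a\<in>I'. \<phi>' (Inr a) m (\<tau> k m) \<noteq> 0"
  proof (rule ccontr)
    assume "\<not> ?thesis"
    then have z: "\<phi>' (Inr a) m (\<tau> k m) = 0" if "a \<in> I'" for a using that by blast
    have "\<tau> k m = (\<Sum>i\<in>Inl ` J \<union> Inr ` I'. \<phi>' i m (\<tau> k m) *\<^sub>R t' i m)"
      using dual_basesD(6)[OF b \<tau>k(2)[OF W'(1)]] by simp
    also have "\<dots> = (\<Sum>j\<in>J. \<phi>' (Inl j) m (\<tau> k m) *\<^sub>R \<tau> j m)"
      using insert.hyps(1) fin z t' by (subst sum.union_disjoint) (auto simp: sum.reindex)
    finally have *: "\<tau> k m = (\<Sum>j\<in>J. \<phi>' (Inl j) m (\<tau> k m) *\<^sub>R \<tau> j m)" .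
    define e where "e = (\<lambda>j. if j = k then -1 else \<phi>' (Inl j) m (\<tau> k m))"
    have "(\<Sum>j\<in>J. e j *\<^sub>R \<tau> j m) = (\<Sum>j\<in>J. \<phi>' (Inl j) m (\<tau> k m) *\<^sub>R \<tau> j m)"
      using insert.hyps by (intro sum.cong) (auto simp: e_def)
    then have "(\<Sum>j\<in>insert k J. e j *\<^sub>R \<tau> j m) = 0"
      using insert.hyps * by (simp add: e_def)
    from insert.prems(3)[OF this, of k] show False by (simp add: e_def)
  qed
  then obtain a where a: "a \<in> I'" "\<phi>' (Inr a) m (\<tau> k m) \<noteq> 0" by blast
  have "smooth_fun A W' (\<lambda>x. \<phi>' (Inr a) x (\<tau> k x))"
    using d(4)[OF d(1) order_refl \<tau>k(2)] \<tau>k(1) a(1) by blast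
  from smooth_fun_nonzero_nhd[OF d(1) this W'(1) a(2)] obtain W'' where
    W'': "open W''" "m \<in> W''" "W'' \<subseteq> W'" "\<And>x. x \<in> W'' \<Longrightarrow> \<phi>' (Inr a) x (\<tau> k x) \<noteq> 0" by blast
  have "P W'' (\<tau> k)"
    using d(4)[OF d(1) order_refl, of "\<tau> k"] d(4)[OF W''(1,3), of "\<tau> k"] \<tau>k W''(3)
      smooth_fun_subset[OF _ W''(3)] by blast
  then have c'': "coframe A F P W'' (insert (Inl k) (Inl ` J \<union> Inr ` I' - {Inr a})) (t'(Inl k := \<tau> k))
    (\<lambda>i m. if i = Inl k then (\<lambda>x. \<phi>' (Inr a) m x / \<phi>' (Inr a) m (\<tau> k m))
       else (\<lambda>x. \<phi>' i m x - \<phi>' i m (\<tau> k m) * (\<phi>' (Inr a) m x / \<phi>' (Inr a) m (\<tau> k m))))"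
    using \<tau>k(2) W'' a(1) insert.hyps by (intro coframe_exchange[OF c']) auto
  have "insert (Inl k) (Inl ` J \<union> Inr ` I' - {Inr a}) = Inl ` insert k J \<union> Inr ` (I' - {a})"
    using a(1) by auto
  note c'' = c''[unfolded this]
  have t'': "\<forall>j\<in>insert k J. (t'(Inl k := \<tau> k)) (Inl j) = \<tau> j"
    using t' by simp
  have "W'' \<subseteq> W" using W''(3) W'(2) by blast
  then show ?case by (intro exI conjI) (rule W''(2), assumption, rule c'', rule t'')
qed

text \<open>If the sections form a basis at \<open>m\<close>, then no member of the old coframe is left.\<close>

lemma coframe_of_basis:
  fixes J :: "'j set" and I :: "'i set"
  assumes c: "coframe A F P W I t \<phi>" and m: "m \<in> W"
    and \<tau>: "\<And>j. j \<in> J \<Longrightarrow> P W (\<tau> j)" "\<And>j x. j \<in> J \<Longrightarrow> x \<in> W \<Longrightarrow> \<tau> j x \<in> F x"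
    and b: "dual_bases (F m) J (\<lambda>j. \<tau> j m) \<psi>"
  obtains W' \<phi>' where "m \<in> W'" "W' \<subseteq> W" "coframe A F P W' J \<tau> \<phi>'"
proof -
  have "d j = 0" if "(\<Sum>j\<in>J. d j *\<^sub>R \<tau> j m) = 0" "j \<in> J" for d j
    using dual_bases_coord_sum[OF b that(2), of d] that
      linear_from_to_0[OF dual_basesD(7)[OF b that(2)] dual_basesD(2)[OF b]] by simp
  then have "\<exists>W' I' t' \<phi>'. m \<in> W' \<and> W' \<subseteq> W \<and> coframe A F P W' (Inl ` J \<union> Inr ` I' :: ('j + 'i) set) t' \<phi>' \<and>
    (\<forall>j\<in>J. t' (Inl j) = \<tau> j)"
    using \<tau> by (intro coframe_extend[where J = J and \<tau> = \<tau>, OF c m dual_basesD(1)[OF b]]) auto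
  then obtain W' I' t' \<phi>'
    where W': "m \<in> W'" "W' \<subseteq> W" and c': "coframe A F P W' (Inl ` J \<union> Inr ` I' :: ('j + 'i) set) t' \<phi>'"
      and t': "\<forall>j\<in>J. t' (Inl j) = \<tau> j" by blast
  note b' = coframeD(3)[OF c' W'(1)]
  have "I' = {}"
  proof (rule ccontr)
    assume "I' \<noteq> {}"
    then obtain a where a: "a \<in> I'" by blast
    have "t' (Inr a) m \<in> F m" using dual_basesD(3)[OF b', of "Inr a"] a by simp
    from dual_bases_linear_expand[OF b dual_basesD(7)[OF b', of "Inr a"] this]
    have "\<phi>' (Inr a) m (t' (Inr a) m) = (\<Sum>j\<in>J. \<psi> j (t' (Inr a) m) *\<^sub>R \<phi>' (Inr a) m (t' (Inl j) m))"
      using a t' by simp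
    also have "\<dots> = 0"
      using a dual_basesD(5)[OF b', of "Inr a" "Inl _"] by (intro sum.neutral) auto
    finally show False using dual_basesD(5)[OF b', of "Inr a" "Inr a"] a by simp
  qed
  then have "bij_betw Inl J (Inl ` J \<union> Inr ` I' :: ('j + 'i) set)"
    by (auto simp: bij_betw_def)
  from coframe_reindex[OF c' this] have "coframe A F P W' J (\<lambda>j. t' (Inl j)) (\<lambda>j. \<phi>' (Inl j))" .
  then have "coframe A F P W' J \<tau> (\<lambda>j. \<phi>' (Inl j))"
    using t' unfolding coframe_def dual_bases_def by simp
  then show ?thesis using W' that by blast
qed

lemma smooth_section_iff:
  assumes fr: "\<And>W' r s. (W', r, s) \<in> frames E \<Longrightarrow> open W' \<and> is_frame (fibre E) W' r s" and W: "open W"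
  shows "smooth_section A E W \<sigma> \<longleftrightarrow> (\<forall>m\<in>W. \<sigma> m \<in> fibre E m) \<and>
    (\<forall>(W', r, s)\<in>frames E. \<forall>i<r. smooth_fun A (W \<inter> W') (\<lambda>m. frame_coord r s i m (\<sigma> m)))"
proof -
  have "(\<exists>c. (\<forall>i<r. smooth_fun A (W \<inter> W') (c i)) \<and>
        (\<forall>m\<in>W \<inter> W'. \<sigma> m = (\<Sum>i<r. c i m *\<^sub>R s i m))) \<longleftrightarrow>
      (\<forall>i<r. smooth_fun A (W \<inter> W') (\<lambda>m. frame_coord r s i m (\<sigma> m)))"
    if f: "(W', r, s) \<in> frames E" and \<sigma>: "\<forall>m\<in>W. \<sigma> m \<in> fibre E m" for W' r s
  proof
    have W': "open (W \<inter> W')" using fr[OF f] W by blast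
    have b: "dual_bases (fibre E m) {..<r} (\<lambda>i. s i m) (\<lambda>i. frame_coord r s i m)" if "m \<in> W'" for m
      by (rule frame_coord[OF conjunct2[OF fr[OF f]] that])
    {
      assume "\<exists>c. (\<forall>i<r. smooth_fun A (W \<inter> W') (c i)) \<and>
        (\<forall>m\<in>W \<inter> W'. \<sigma> m = (\<Sum>i<r. c i m *\<^sub>R s i m))"
      then obtain c where c: "\<forall>i<r. smooth_fun A (W \<inter> W') (c i)"
        "\<forall>m\<in>W \<inter> W'. \<sigma> m = (\<Sum>i<r. c i m *\<^sub>R s i m)" by blast
      show "\<forall>i<r. smooth_fun A (W \<inter> W') (\<lambda>m. frame_coord r s i m (\<sigma> m))"
      proof (intro allI impI)
        fix i assume i: "i < r"
        have "c i m = frame_coord r s i m (\<sigma> m)" if "m \<in> W \<inter> W'" for m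
          using dual_bases_coord_sum[OF b, of m i "\<lambda>i. c i m"] that c(2) i by simp
        then show "smooth_fun A (W \<inter> W') (\<lambda>m. frame_coord r s i m (\<sigma> m))"
          by (rule smooth_fun_cong[OF W' _ c(1)[rule_format, OF i]])
      qed
    }
    {
      assume "\<forall>i<r. smooth_fun A (W \<inter> W') (\<lambda>m. frame_coord r s i m (\<sigma> m))"
      moreover have "\<forall>m\<in>W \<inter> W'. \<sigma> m = (\<Sum>i<r. frame_coord r s i m (\<sigma> m) *\<^sub>R s i m)"
        using dual_basesD(6)[OF b] \<sigma> by simp
      ultimately show "\<exists>c. (\<forall>i<r. smooth_fun A (W \<inter> W') (c i)) \<and>
        (\<forall>m\<in>W \<inter> W'. \<sigma> m = (\<Sum>i<r. c i m *\<^sub>R s i m))"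
        by (intro exI[of _ "\<lambda>i m. frame_coord r s i m (\<sigma> m)"]) simp
    }
  qed
  note coords = this
  show ?thesis
    unfolding smooth_section_def
  proof (intro conj_cong refl ball_cong)
    fix f assume \<sigma>: "\<forall>m\<in>W. \<sigma> m \<in> fibre E m" and f: "f \<in> frames E"
    obtain W' r s where f_eq: "f = (W', r, s)" by (cases f)
    show "(case f of (W', r, s) \<Rightarrow> \<exists>c. (\<forall>i<r. smooth_fun A (W \<inter> W') (c i)) \<and>
        (\<forall>m\<in>W \<inter> W'. \<sigma> m = (\<Sum>i<r. c i m *\<^sub>R s i m))) \<longleftrightarrow>
      (case f of (W', r, s) \<Rightarrow> \<forall>i<r. smooth_fun A (W \<inter> W') (\<lambda>m. frame_coord r s i m (\<sigma> m)))"
      unfolding f_eq prod.case by (rule coords[OF f[unfolded f_eq] \<sigma>])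
  qed
qed

lemma vector_bundle_locally_trivial:
  assumes E: "vector_bundle A E"
  shows "locally_trivial A (fibre E) (smooth_section A E)"
proof -
  have fr: "open W" "is_frame (fibre E) W r s" "\<And>i. i < r \<Longrightarrow> smooth_section A E W (s i)"
    if "(W, r, s) \<in> frames E" for W r s
    using E that unfolding vector_bundle_def by auto
  have iff: "smooth_section A E W \<sigma> \<longleftrightarrow> (\<forall>m\<in>W. \<sigma> m \<in> fibre E m) \<and>
      (\<forall>(W', r, s)\<in>frames E. \<forall>i<r. smooth_fun A (W \<inter> W') (\<lambda>m. frame_coord r s i m (\<sigma> m)))"
    if "open W" for W \<sigma>
    by (rule smooth_section_iff[OF conjI[OF fr(1,2)] that])
  have restr: "smooth_section A E W' \<sigma>" if "open W" "open W'" "W' \<subseteq> W" "smooth_section A E W \<sigma>"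
    for W W' \<sigma>
  proof -
    have "smooth_fun A (W' \<inter> V) (\<lambda>m. frame_coord r s i m (\<sigma> m))"
      if f: "(V, r, s) \<in> frames E" "i < r" for V r s i
    proof (rule smooth_fun_subset)
      show "smooth_fun A (W \<inter> V) (\<lambda>m. frame_coord r s i m (\<sigma> m))"
        using iff[OF \<open>open W\<close>, of \<sigma>] \<open>smooth_section A E W \<sigma>\<close> f by fastforce
    qed (use \<open>W' \<subseteq> W\<close> in blast)
    moreover have "\<forall>m\<in>W'. \<sigma> m \<in> fibre E m"
      using \<open>W' \<subseteq> W\<close> smooth_section_fibre[OF that(4)] by blast
    ultimately show ?thesis using iff[OF \<open>open W'\<close>, of \<sigma>] by auto
  qed
  have glue: "smooth_section A E W \<sigma>"
    if W: "open W" and \<sigma>: "\<forall>m\<in>W. \<sigma> m \<in> fibre E m"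
      and loc: "\<forall>m\<in>W. \<exists>W'. open W' \<and> m \<in> W' \<and> W' \<subseteq> W \<and> smooth_section A E W' \<sigma>" for W \<sigma>
  proof -
    have "smooth_fun A (W \<inter> W') (\<lambda>m. frame_coord r s i m (\<sigma> m))"
      if f: "(W', r, s) \<in> frames E" "i < r" for W' r s i
    proof (rule smooth_fun_local)
      fix m assume m: "m \<in> W \<inter> W'"
      then obtain V where V: "open V" "m \<in> V" "smooth_section A E V \<sigma>" using loc by blast
      then have "smooth_fun A (V \<inter> W') (\<lambda>m. frame_coord r s i m (\<sigma> m))"
        using iff[OF V(1)] f by fastforce
      then show "\<exists>V. open V \<and> m \<in> V \<and> smooth_fun A V (\<lambda>m. frame_coord r s i m (\<sigma> m))"
        using V m fr(1)[OF f(1)] by (intro exI[of _ "V \<inter> W'"]) auto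
    qed
    then show ?thesis using iff[OF W] \<sigma> by auto
  qed
  have cof: "coframe A (fibre E) (smooth_section A E) W {..<r} s (frame_coord r s)"
    if f: "(W, r, s) \<in> frames E" for W r s
    unfolding coframe_def
  proof (intro conjI ballI allI impI; (elim conjE)?)
    show "open W" by (rule fr(1)[OF f])
    show "dual_bases (fibre E m) {..<r} (\<lambda>i. s i m) (\<lambda>i. frame_coord r s i m)" if "m \<in> W" for m
      by (rule frame_coord[OF fr(2)[OF f] that])
    fix W' \<sigma> assume W': "open W'" "W' \<subseteq> W" "\<forall>m\<in>W'. \<sigma> m \<in> fibre E m"
    have "W' \<inter> W = W'" using W'(2) by blast
    show "smooth_section A E W' \<sigma> \<longleftrightarrow> (\<forall>i\<in>{..<r}. smooth_fun A W' (\<lambda>m. frame_coord r s i m (\<sigma> m)))"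
    proof
      assume "smooth_section A E W' \<sigma>"
      then show "\<forall>i\<in>{..<r}. smooth_fun A W' (\<lambda>m. frame_coord r s i m (\<sigma> m))"
        using iff[OF W'(1)] f \<open>W' \<inter> W = W'\<close> by fastforce
    next
      assume \<sigma>: "\<forall>i\<in>{..<r}. smooth_fun A W' (\<lambda>m. frame_coord r s i m (\<sigma> m))"
      have "smooth_fun A (W' \<inter> V) (\<lambda>m. frame_coord q u k m (\<sigma> m))"
        if g: "(V, q, u) \<in> frames E" "k < q" for V q u k
      proof -
        have o: "open (W' \<inter> V)" using W'(1) fr(1)[OF g(1)] by blast
        have "smooth_fun A (W' \<inter> V) (\<lambda>m. \<Sum>i<r. frame_coord r s i m (\<sigma> m) * frame_coord q u k m (s i m))"
        proof (intro smooth_fun_sum[OF o] smooth_fun_mult[OF o])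
          fix i assume i: "i \<in> {..<r}"
          show "smooth_fun A (W' \<inter> V) (\<lambda>m. frame_coord r s i m (\<sigma> m))"
            using \<sigma> i smooth_fun_subset[of A W' _ "W' \<inter> V"] by blast
          have "smooth_fun A (W \<inter> V) (\<lambda>m. frame_coord q u k m (s i m))"
            using iff[OF fr(1)[OF f]] fr(3)[OF f] i g by fastforce
          then show "smooth_fun A (W' \<inter> V) (\<lambda>m. frame_coord q u k m (s i m))"
            using smooth_fun_subset[of A "W \<inter> V" _ "W' \<inter> V"] W'(2) by blast
        qed
        then show ?thesis
        proof (rule smooth_fun_cong[OF o, rotated])
          fix m assume m: "m \<in> W' \<inter> V"
          then have "m \<in> W" using W'(2) by blast
          have k: "k \<in> {..<q}" and mV: "m \<in> V" using g(2) m by auto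
          from dual_bases_linear_expand[OF frame_coord[OF fr(2)[OF f] \<open>m \<in> W\<close>]
              dual_basesD(7)[OF frame_coord[OF fr(2)[OF g(1)] mV] k], of "\<sigma> m"]
          show "(\<Sum>i<r. frame_coord r s i m (\<sigma> m) * frame_coord q u k m (s i m)) =
              frame_coord q u k m (\<sigma> m)"
            using m W'(3) by simp
        qed
      qed
      then show "smooth_section A E W' \<sigma>" using iff[OF W'(1)] W'(3) by auto
    qed
  qed simp
  show ?thesis
    unfolding locally_trivial_def
  proof (intro conjI allI impI)
    fix m
    have "m \<in> (\<Union>(W, r, s)\<in>frames E. W)" using E unfolding vector_bundle_def by simp
    then obtain W r s where "(W, r, s) \<in> frames E" "m \<in> W" by auto
    then show "\<exists>W (I::nat set) t \<phi>. m \<in> W \<and> coframe A (fibre E) (smooth_section A E) W I t \<phi>"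
      using cof by blast
  qed (use restr glue in blast)+
qed

text \<open>Conversely, local triviality is what makes \<^const>\<open>bundle_of_sections\<close> a vector bundle, and the
  smooth sections of that bundle are then the prescribed ones.\<close>

lemma bundle_of_sections:
  assumes lt: "locally_trivial A F P"
  shows vector_bundle_of_sections: "vector_bundle A (bundle_of_sections F P)"
    and smooth_section_of_sections: "open W \<Longrightarrow>
      smooth_section A (bundle_of_sections F P) W \<sigma> \<longleftrightarrow> (\<forall>m\<in>W. \<sigma> m \<in> F m) \<and> P W \<sigma>"
proof -
  let ?E = "bundle_of_sections F P"
  note res = locally_trivialD(1)[OF lt] and glue = locally_trivialD(2)[OF lt]
  have fr: "open W" "is_frame F W r s" "\<And>i. i < r \<Longrightarrow> P W (s i)"
    if "(W, r, s) \<in> frames ?E" for W r s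
    using that by (auto simp: bundle_of_sections_def)
  have fibre: "fibre ?E = F" by (simp add: bundle_of_sections_def)
  \<comment> \<open>Every frame made of smooth sections is a coframe: near each point it can be exchanged for a given
    coframe.\<close>
  have cof: "P W' \<sigma> \<longleftrightarrow> (\<forall>i<r. smooth_fun A W' (\<lambda>m. frame_coord r s i m (\<sigma> m)))"
    if f: "(W, r, s) \<in> frames ?E" and W': "open W'" "W' \<subseteq> W" and \<sigma>: "\<And>m. m \<in> W' \<Longrightarrow> \<sigma> m \<in> F m"
    for W r s W' \<sigma>
  proof -
    note b = frame_coord[OF fr(2)[OF f]]
    have loc: "\<exists>N. open N \<and> m \<in> N \<and> N \<subseteq> W' \<and>
        (P N \<sigma> \<longleftrightarrow> (\<forall>i<r. smooth_fun A N (\<lambda>m. frame_coord r s i m (\<sigma> m))))" if m: "m \<in> W'" for m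
    proof -
      obtain N and I :: "nat set" and t \<phi> where N: "m \<in> N" "coframe A F P N I t \<phi>"
        using locally_trivial_coframe[OF lt] by blast
      have o: "open (N \<inter> W')" using coframeD(1)[OF N(2)] W'(1) by blast
      have "m \<in> W" using m W'(2) by blast
      have sF: "s i x \<in> F x" if "i \<in> {..<r}" "x \<in> N \<inter> W'" for i x
        using dual_basesD(3)[OF b that(1)] that(2) W'(2) by blast
      have sP: "P (N \<inter> W') (s i)" if "i \<in> {..<r}" for i
        using res[OF fr(1)[OF f] o] fr(3)[OF f] that W'(2) by blast
      obtain N' \<phi>' where N': "m \<in> N'" "N' \<subseteq> N \<inter> W'" "coframe A F P N' {..<r} s \<phi>'"
      proof (rule coframe_of_basis[OF coframe_subset[OF N(2) o] _ sP sF b[OF \<open>m \<in> W\<close>]])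
      qed (use N(1) m in auto)
      have "smooth_fun A N' (\<lambda>m. frame_coord r s i m (\<sigma> m)) \<longleftrightarrow> smooth_fun A N' (\<lambda>m. \<phi>' i m (\<sigma> m))"
        if "i < r" for i
      proof -
        have "frame_coord r s i x = \<phi>' i x" if "x \<in> N'" for x
          using dual_bases_unique[OF b coframeD(3)[OF N'(3) that], of i] N'(2) W'(2) that \<open>i < r\<close>
          by blast
        then show ?thesis
          using smooth_fun_cong[OF coframeD(1)[OF N'(3)]] by (metis (mono_tags, lifting))
      qed
      moreover have "P N' \<sigma> \<longleftrightarrow> (\<forall>i\<in>{..<r}. smooth_fun A N' (\<lambda>m. \<phi>' i m (\<sigma> m)))"
        using coframeD(4)[OF N'(3) coframeD(1)[OF N'(3)] order_refl] \<sigma> N'(2) by blast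
      ultimately show ?thesis
        using N' coframeD(1)[OF N'(3)] by (intro exI[of _ N']) auto
    qed
    show ?thesis
    proof
      assume P: "P W' \<sigma>"
      show "\<forall>i<r. smooth_fun A W' (\<lambda>m. frame_coord r s i m (\<sigma> m))"
      proof (intro allI impI smooth_fun_local)
        fix i m assume "i < r" "m \<in> W'"
        then show "\<exists>V. open V \<and> m \<in> V \<and> smooth_fun A V (\<lambda>m. frame_coord r s i m (\<sigma> m))"
          using loc[of m] res[OF W'(1) _ _ P] by blast
      qed
    next
      assume s: "\<forall>i<r. smooth_fun A W' (\<lambda>m. frame_coord r s i m (\<sigma> m))"
      show "P W' \<sigma>"
      proof (rule glue[OF W'(1) \<sigma>])
        fix m assume "m \<in> W'"
        then show "\<exists>V. open V \<and> m \<in> V \<and> V \<subseteq> W' \<and> P V \<sigma>"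
          using loc[of m] s smooth_fun_subset by metis
      qed
    qed
  qed
  have iff: "smooth_section A ?E W \<sigma> \<longleftrightarrow> (\<forall>m\<in>W. \<sigma> m \<in> F m) \<and>
      (\<forall>(W', r, s)\<in>frames ?E. \<forall>i<r. smooth_fun A (W \<inter> W') (\<lambda>m. frame_coord r s i m (\<sigma> m)))"
    if "open W" for W \<sigma>
  proof -
    have "open W' \<and> is_frame (fibre ?E) W' r s" if "(W', r, s) \<in> frames ?E" for W' r s
      using fr(1,2)[OF that] by (simp add: fibre)
    from smooth_section_iff[OF this \<open>open W\<close>] show ?thesis by (simp add: fibre)
  qed
  have cover: "\<exists>W r s. (W, r, s) \<in> frames ?E \<and> m \<in> W" for m
  proof -
    obtain W and I :: "nat set" and t \<phi> where W: "m \<in> W" "coframe A F P W I t \<phi>"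
      using locally_trivial_coframe[OF lt] by blast
    obtain r :: nat and t' \<phi>' where c: "coframe A F P W {..<r} t' \<phi>'" using coframe_exists_nat[OF W(2)] .
    have "P W (t' i)" if i: "i < r" for i
    proof -
      have "smooth_fun A W (\<lambda>m. \<phi>' k m (t' i m))" if "k \<in> {..<r}" for k
        using dual_basesD(5)[OF coframeD(3)[OF c] that, of _ i] i
        by (intro smooth_fun_cong[OF coframeD(1)[OF c] _ smooth_fun_const[of A W "if k = i then 1 else 0"]])
          simp
      moreover have "t' i x \<in> F x" if "x \<in> W" for x
        using coframe_frame_section[OF c _ that] i by simp
      ultimately show ?thesis
        using coframeD(4)[OF c coframeD(1)[OF c] order_refl] by blast
    qed
    then have "(W, r, t') \<in> frames ?E"
      using coframeD(1)[OF c] coframe_is_frame[OF c] by (simp add: bundle_of_sections_def)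
    then show ?thesis using W(1) by blast
  qed
  have main: "smooth_section A ?E W \<sigma> \<longleftrightarrow> (\<forall>m\<in>W. \<sigma> m \<in> F m) \<and> P W \<sigma>" if W: "open W" for W \<sigma>
  proof
    assume l: "smooth_section A ?E W \<sigma>"
    then have \<sigma>: "\<forall>m\<in>W. \<sigma> m \<in> F m" by (simp add: smooth_section_def fibre)
    have "P W \<sigma>"
    proof (rule glue[OF W])
      fix m assume m: "m \<in> W"
      obtain W' r s where f: "(W', r, s) \<in> frames ?E" "m \<in> W'" using cover by blast
      have "\<forall>i<r. smooth_fun A (W \<inter> W') (\<lambda>m. frame_coord r s i m (\<sigma> m))"
        using l iff[OF W] f(1) by fastforce
      then have "P (W \<inter> W') \<sigma>"
        using cof[OF f(1), of "W \<inter> W'" \<sigma>] W fr(1)[OF f(1)] \<sigma> by auto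
      then show "\<exists>V. open V \<and> m \<in> V \<and> V \<subseteq> W \<and> P V \<sigma>"
        using m f(2) W fr(1)[OF f(1)] by (intro exI[of _ "W \<inter> W'"]) auto
    qed (use \<sigma> in blast)
    then show "(\<forall>m\<in>W. \<sigma> m \<in> F m) \<and> P W \<sigma>" using \<sigma> by blast
  next
    assume r: "(\<forall>m\<in>W. \<sigma> m \<in> F m) \<and> P W \<sigma>"
    have "smooth_fun A (W \<inter> W') (\<lambda>m. frame_coord r s i m (\<sigma> m))"
      if f: "(W', r, s) \<in> frames ?E" "i < r" for W' r s i
    proof -
      have o: "open (W \<inter> W')" using W fr(1)[OF f(1)] by blast
      then have "P (W \<inter> W') \<sigma>" using res[OF W o] r by blast
      then show ?thesis using cof[OF f(1) o, of \<sigma>] r f(2) by auto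
    qed
    then show "smooth_section A ?E W \<sigma>" using iff[OF W] r by auto
  qed
  then show "open W \<Longrightarrow> smooth_section A ?E W \<sigma> \<longleftrightarrow> (\<forall>m\<in>W. \<sigma> m \<in> F m) \<and> P W \<sigma>" by blast
  show "vector_bundle A ?E"
    unfolding vector_bundle_def
  proof (intro conjI ballI, clarify)
    fix W r s assume f: "(W, r, s) \<in> frames ?E"
    have "s i m \<in> F m" if "m \<in> W" "i < r" for i m
      using dual_basesD(3)[OF frame_coord[OF fr(2)[OF f] that(1)]] that(2) by simp
    then show "open W \<and> is_frame (fibre ?E) W r s \<and> (\<forall>i<r. smooth_section A ?E W (s i))"
      using fr[OF f] main[OF fr(1)[OF f]] unfolding fibre by blast
  qed (use cover in fastforce)
qed

end

section \<open>Derived bundles\<close>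

lemma fibre_bundles [simp]:
  "fibre (hom_bundle A E F) = (\<lambda>m. hom_space (fibre E m) (fibre F m))"
  "fibre (dual_bundle A E) = (\<lambda>m. dual_space (fibre E m))"
  "fibre (tensor_bundle A E F') = (\<lambda>m. tensor_space (fibre E m) (fibre F' m))"
  by (simp_all add: hom_bundle_def dual_bundle_def tensor_bundle_def bundle_of_sections_def)

lemma fibre_dual_total:
  "fibre (dual_total A S) = (\<lambda>m. {(\<epsilon>, \<beta>). \<epsilon> \<in> hom_space (fibre (total S) m) (fibre (side1 S) m) \<and>
        \<beta> \<in> dual_space (fibre (side2 S) m) \<and>
        (\<forall>\<theta>\<in>tensor_space (fibre (side1 S) m) (fibre (side2 S) m).
           \<epsilon> (incl S m \<theta>) = contract (fibre (side1 S) m) \<beta> \<theta>)})"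
  by (simp add: dual_total_def bundle_of_sections_def)

lemma bundle_mapD:
  assumes "bundle_map A E F h"
  shows "linear_from_to (fibre E m) (fibre F m) (h m)"
    "open W \<Longrightarrow> smooth_section A E W \<sigma> \<Longrightarrow> smooth_section A F W (\<lambda>m. h m (\<sigma> m))"
  using assms by (auto simp: bundle_map_def)

text \<open>The trivial line bundle: the dual of \<open>E\<close> is the bundle of homomorphisms from \<open>E\<close> to it.\<close>

definition line_bundle :: "('m, real) vbundle" where
  "line_bundle = \<lparr>fibre = (\<lambda>_. UNIV), frames = {(UNIV, 1, \<lambda>_ _. 1)}\<rparr>"

context smooth_base
begin

lemma coframe_section:
  assumes c: "coframe A F P W I t \<phi>" and i: "i \<in> I"
  shows "P W (t i)"
proof -
  have "smooth_fun A W (\<lambda>m. \<phi> k m (t i m))" if k: "k \<in> I" for k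
  proof (rule smooth_fun_cong[OF coframeD(1)[OF c] _ smooth_fun_const])
    show "(if k = i then 1 else 0) = \<phi> k m (t i m)" if "m \<in> W" for m
      using dual_basesD(5)[OF coframeD(3)[OF c that] k i] by simp
  qed
  then show ?thesis
    using coframeD(4)[OF c coframeD(1)[OF c] order_refl, of "t i"] coframe_frame_section[OF c i] by blast
qed

lemma smooth_section_subset:
  assumes "vector_bundle A E" "open W" "open W'" "W' \<subseteq> W" "smooth_section A E W \<sigma>"
  shows "smooth_section A E W' \<sigma>"
  by (rule locally_trivialD(1)[OF vector_bundle_locally_trivial[OF assms(1)] assms(2-5)])

lemma smooth_section_local:
  assumes "vector_bundle A E" "open W" "\<And>m. m \<in> W \<Longrightarrow> \<sigma> m \<in> fibre E m"
    and "\<And>m. m \<in> W \<Longrightarrow> \<exists>W'. open W' \<and> m \<in> W' \<and> W' \<subseteq> W \<and> smooth_section A E W' \<sigma>"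
  shows "smooth_section A E W \<sigma>"
  by (rule locally_trivialD(2)[OF vector_bundle_locally_trivial[OF assms(1)] assms(2-4)])

lemma vector_bundle_coframe:
  assumes "vector_bundle A E"
  obtains W and I :: "nat set" and t \<phi> where "m \<in> W" "coframe A (fibre E) (smooth_section A E) W I t \<phi>"
  by (rule locally_trivial_coframe[OF vector_bundle_locally_trivial[OF assms]])

lemma vector_bundle_finite_dim:
  assumes "vector_bundle A E" shows "finite_dim (fibre E m)"
proof -
  obtain W and I :: "nat set" and t \<phi> where W: "m \<in> W"
    and c: "coframe A (fibre E) (smooth_section A E) W I t \<phi>"
    using vector_bundle_coframe[OF assms] .
  show ?thesis by (rule dual_bases_finite_dim[OF coframeD(3)[OF c W]])
qed

lemma vector_bundle_subspace: "vector_bundle A E \<Longrightarrow> subspace (fibre E m)"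
  by (rule finite_dim_subspace[OF vector_bundle_finite_dim])

lemma smooth_section_sum:
  assumes E: "vector_bundle A E" and W: "open W" and fin: "finite J"
    and f: "\<And>j. j \<in> J \<Longrightarrow> smooth_fun A W (f j)" and \<sigma>: "\<And>j. j \<in> J \<Longrightarrow> smooth_section A E W (\<sigma> j)"
  shows "smooth_section A E W (\<lambda>m. \<Sum>j\<in>J. f j m *\<^sub>R \<sigma> j m)"
proof (rule smooth_section_local[OF E W])
  show mem: "(\<Sum>j\<in>J. f j m *\<^sub>R \<sigma> j m) \<in> fibre E m" if "m \<in> W" for m
    using smooth_section_fibre[OF \<sigma> that] vector_bundle_subspace[OF E]
    by (intro subspace_sum subspace_scale)
  fix m assume m: "m \<in> W"
  obtain V and I :: "nat set" and t \<phi> where V: "m \<in> V"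
    and c: "coframe A (fibre E) (smooth_section A E) V I t \<phi>"
    using vector_bundle_coframe[OF E] .
  define N where "N = V \<inter> W"
  have N: "open N" "N \<subseteq> V" "N \<subseteq> W" "m \<in> N"
    using coframeD(1)[OF c] W V m by (auto simp: N_def)
  have "smooth_fun A N (\<lambda>x. \<phi> i x (\<Sum>j\<in>J. f j x *\<^sub>R \<sigma> j x))" if i: "i \<in> I" for i
  proof (rule smooth_fun_cong[OF N(1)])
    show "smooth_fun A N (\<lambda>x. \<Sum>j\<in>J. f j x * \<phi> i x (\<sigma> j x))"
    proof (rule smooth_fun_sum[OF N(1)], rule smooth_fun_mult[OF N(1)])
      fix j assume j: "j \<in> J"
      show "smooth_fun A N (f j)" by (rule smooth_fun_subset[OF f[OF j] N(3)])
      show "smooth_fun A N (\<lambda>x. \<phi> i x (\<sigma> j x))"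
        by (rule coframe_coord_smooth[OF c N(1,2) smooth_section_subset[OF E W N(1,3) \<sigma>[OF j]] i])
    qed
    fix x assume x: "x \<in> N"
    have "x \<in> V" "x \<in> W" using x N by auto
    note b = coframeD(3)[OF c \<open>x \<in> V\<close>]
    show "(\<Sum>j\<in>J. f j x * \<phi> i x (\<sigma> j x)) = \<phi> i x (\<Sum>j\<in>J. f j x *\<^sub>R \<sigma> j x)"
      using linear_from_to_sum[OF dual_basesD(7)[OF b i] dual_basesD(2)[OF b],
          of J "\<lambda>j. \<sigma> j x" "\<lambda>j. f j x"] smooth_section_fibre[OF \<sigma> \<open>x \<in> W\<close>] by simp
  qed
  then have "smooth_section A E N (\<lambda>x. \<Sum>j\<in>J. f j x *\<^sub>R \<sigma> j x)"
    using coframeD(4)[OF c N(1,2), of "\<lambda>x. \<Sum>j\<in>J. f j x *\<^sub>R \<sigma> j x"] mem N(3) by blast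
  then show "\<exists>W'. open W' \<and> m \<in> W' \<and> W' \<subseteq> W \<and> smooth_section A E W' (\<lambda>x. \<Sum>j\<in>J. f j x *\<^sub>R \<sigma> j x)"
    using N by blast
qed

lemma smooth_section_add:
  assumes "vector_bundle A E" "open W" "smooth_section A E W \<sigma>" "smooth_section A E W \<tau>"
  shows "smooth_section A E W (\<lambda>m. \<sigma> m + \<tau> m)"
  using smooth_section_sum[OF assms(1,2), of "UNIV :: bool set" "\<lambda>_ _. 1" "\<lambda>b. if b then \<sigma> else \<tau>"]
    assms(3,4) by (simp add: UNIV_bool smooth_fun_const add.commute)

lemma smooth_section_scale:
  assumes "vector_bundle A E" "open W" "smooth_section A E W \<sigma>"
  shows "smooth_section A E W (\<lambda>m. c *\<^sub>R \<sigma> m)"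
  using smooth_section_sum[OF assms(1,2), of "{()}" "\<lambda>_ _. c" "\<lambda>_. \<sigma>"]
    assms(3) by (simp add: smooth_fun_const)

lemma smooth_section_diff:
  assumes "vector_bundle A E" "open W" "smooth_section A E W \<sigma>" "smooth_section A E W \<tau>"
  shows "smooth_section A E W (\<lambda>m. \<sigma> m - \<tau> m)"
  using smooth_section_add[OF assms(1-3) smooth_section_scale[OF assms(1,2,4), of "-1"]] by simp

lemma coframe_hom:
  assumes E: "vector_bundle A E" and F: "vector_bundle A F"
    and c: "coframe A (fibre E) (smooth_section A E) W I t \<phi>"
    and d: "coframe A (fibre F) (smooth_section A F) W J u \<psi>"
  shows "coframe A (\<lambda>m. hom_space (fibre E m) (fibre F m))
    (\<lambda>W h. \<forall>W' \<sigma>. open W' \<and> W' \<subseteq> W \<and> smooth_section A E W' \<sigma> \<longrightarrow>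
        smooth_section A F W' (\<lambda>m. h m (\<sigma> m))) W (I \<times> J)
    (\<lambda>p m. case p of (i, j) \<Rightarrow> restrict0 (fibre E m) (\<lambda>x. \<phi> i m x *\<^sub>R u j m))
    (\<lambda>p m. case p of (i, j) \<Rightarrow> restrict0 (hom_space (fibre E m) (fibre F m)) (\<lambda>h. \<psi> j m (h (t i m))))"
  unfolding coframe_def
proof (intro conjI ballI allI impI; (elim conjE)?)
  show "open W" by (rule coframeD(1)[OF c])
  show "finite (I \<times> J)" using coframeD(2)[OF c] coframeD(2)[OF d] by simp
  show "dual_bases (hom_space (fibre E m) (fibre F m)) (I \<times> J)
      (\<lambda>p. case p of (i, j) \<Rightarrow> restrict0 (fibre E m) (\<lambda>x. \<phi> i m x *\<^sub>R u j m))
      (\<lambda>p. case p of (i, j) \<Rightarrow> restrict0 (hom_space (fibre E m) (fibre F m)) (\<lambda>h. \<psi> j m (h (t i m))))"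
    if "m \<in> W" for m
    by (rule dual_bases_hom[OF coframeD(3)[OF c that] coframeD(3)[OF d that]])
next
  fix W' h assume W': "open W'" "W' \<subseteq> W" and h: "\<forall>m\<in>W'. h m \<in> hom_space (fibre E m) (fibre F m)"
  have lin: "linear_from_to (fibre E m) (fibre F m) (h m)" if "m \<in> W'" for m
    using h hom_spaceD that by blast
  have coord: "restrict0 (hom_space (fibre E m) (fibre F m)) (\<lambda>h. \<psi> j m (h (t i m))) (h m) =
      \<psi> j m (h m (t i m))" if "m \<in> W'" for i j m
    using h that by (simp add: restrict0_in)
  have "(\<forall>V \<sigma>. open V \<and> V \<subseteq> W' \<and> smooth_section A E V \<sigma> \<longrightarrow> smooth_section A F V (\<lambda>m. h m (\<sigma> m))) \<longleftrightarrow>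
      (\<forall>i\<in>I. \<forall>j\<in>J. smooth_fun A W' (\<lambda>m. \<psi> j m (h m (t i m))))"
  proof (intro iffI ballI allI impI; (elim conjE)?)
    fix i j assume P: "\<forall>V \<sigma>. open V \<and> V \<subseteq> W' \<and> smooth_section A E V \<sigma> \<longrightarrow>
        smooth_section A F V (\<lambda>m. h m (\<sigma> m))" and ij: "i \<in> I" "j \<in> J"
    have "smooth_section A E W' (t i)"
      by (rule smooth_section_subset[OF E coframeD(1)[OF c] W' coframe_section[OF c ij(1)]])
    then have "smooth_section A F W' (\<lambda>m. h m (t i m))" using P W'(1) by blast
    then show "smooth_fun A W' (\<lambda>m. \<psi> j m (h m (t i m)))"
      by (rule coframe_coord_smooth[OF d W' _ ij(2)])
  next
    fix V \<sigma> assume Q: "\<forall>i\<in>I. \<forall>j\<in>J. smooth_fun A W' (\<lambda>m. \<psi> j m (h m (t i m)))"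
      and V: "open V" "V \<subseteq> W'" and \<sigma>: "smooth_section A E V \<sigma>"
    have VW: "V \<subseteq> W" using V W' by blast
    have "smooth_section A F V (\<lambda>m. \<Sum>i\<in>I. \<phi> i m (\<sigma> m) *\<^sub>R h m (t i m))"
    proof (rule smooth_section_sum[OF F V(1) coframeD(2)[OF c]])
      fix i assume i: "i \<in> I"
      show "smooth_fun A V (\<lambda>m. \<phi> i m (\<sigma> m))"
        by (rule coframe_coord_smooth[OF c V(1) VW \<sigma> i])
      have "h m (t i m) \<in> fibre F m" if "m \<in> V" for m
        using linear_from_toD(1)[OF lin] coframe_frame_section[OF c i] that V(2) VW by blast
      moreover have "smooth_fun A V (\<lambda>m. \<psi> j m (h m (t i m)))" if "j \<in> J" for j
        using Q i that smooth_fun_subset[OF _ V(2)] by blast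
      ultimately show "smooth_section A F V (\<lambda>m. h m (t i m))"
        using coframeD(4)[OF d V(1) VW, of "\<lambda>m. h m (t i m)"] by blast
    qed
    then show "smooth_section A F V (\<lambda>m. h m (\<sigma> m))"
    proof (rule smooth_section_cong)
      fix m assume m: "m \<in> V"
      then have "m \<in> W" "m \<in> W'" using VW V by auto
      show "(\<Sum>i\<in>I. \<phi> i m (\<sigma> m) *\<^sub>R h m (t i m)) = h m (\<sigma> m)"
        using dual_bases_linear_expand[OF coframeD(3)[OF c \<open>m \<in> W\<close>] lin[OF \<open>m \<in> W'\<close>]
          smooth_section_fibre[OF \<sigma> m]] by simp
    qed
  qed
  also have "\<dots> \<longleftrightarrow> (\<forall>p\<in>I \<times> J. smooth_fun A W' (\<lambda>m. (case p of (i, j) \<Rightarrow>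
      restrict0 (hom_space (fibre E m) (fibre F m)) (\<lambda>h. \<psi> j m (h (t i m)))) (h m)))"
  proof -
    have "smooth_fun A W' (\<lambda>m. \<psi> j m (h m (t i m))) \<longleftrightarrow> smooth_fun A W' (\<lambda>m.
      restrict0 (hom_space (fibre E m) (fibre F m)) (\<lambda>h. \<psi> j m (h (t i m))) (h m))" for i j
      by (rule iffI; rule smooth_fun_cong[OF W'(1)]) (auto simp: coord)
    then show ?thesis by simp
  qed
  finally show "(\<forall>V \<sigma>. open V \<and> V \<subseteq> W' \<and> smooth_section A E V \<sigma> \<longrightarrow>
      smooth_section A F V (\<lambda>m. h m (\<sigma> m))) \<longleftrightarrow>
    (\<forall>p\<in>I \<times> J. smooth_fun A W' (\<lambda>m. (case p of (i, j) \<Rightarrow>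
      restrict0 (hom_space (fibre E m) (fibre F m)) (\<lambda>h. \<psi> j m (h (t i m)))) (h m)))" .
qed

lemma locally_trivial_hom:
  assumes E: "vector_bundle A E" and F: "vector_bundle A F"
  shows "locally_trivial A (\<lambda>m. hom_space (fibre E m) (fibre F m))
    (\<lambda>W h. \<forall>W' \<sigma>. open W' \<and> W' \<subseteq> W \<and> smooth_section A E W' \<sigma> \<longrightarrow>
        smooth_section A F W' (\<lambda>m. h m (\<sigma> m)))"
  unfolding locally_trivial_def
proof (intro conjI allI impI; (elim conjE)?)
  fix W V :: "'m set" and h V' \<sigma>
  assume h: "\<forall>W' \<sigma>. open W' \<and> W' \<subseteq> W \<and> smooth_section A E W' \<sigma> \<longrightarrow> smooth_section A F W' (\<lambda>m. h m (\<sigma> m))"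
    and V: "V \<subseteq> W" "open V'" "V' \<subseteq> V" "smooth_section A E V' \<sigma>"
  show "smooth_section A F V' (\<lambda>m. h m (\<sigma> m))"
    by (rule h[THEN spec, THEN spec, THEN mp]) (use V in blast)
next
  fix W h V \<sigma>
  assume h: "\<forall>m\<in>W. h m \<in> hom_space (fibre E m) (fibre F m)"
    and loc: "\<forall>m\<in>W. \<exists>N. open N \<and> m \<in> N \<and> N \<subseteq> W \<and> (\<forall>W' \<sigma>. open W' \<and> W' \<subseteq> N \<and> smooth_section A E W' \<sigma> \<longrightarrow>
        smooth_section A F W' (\<lambda>m. h m (\<sigma> m)))"
    and V: "open V" "V \<subseteq> W" and \<sigma>: "smooth_section A E V \<sigma>"
  show "smooth_section A F V (\<lambda>m. h m (\<sigma> m))"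
  proof (rule smooth_section_local[OF F V(1)])
    fix m assume m: "m \<in> V"
    then have mW: "m \<in> W" using V(2) by blast
    show "h m (\<sigma> m) \<in> fibre F m"
      by (rule linear_from_toD(1)[OF hom_spaceD[OF bspec[OF h mW]] smooth_section_fibre[OF \<sigma> m]])
    from bspec[OF loc mW] obtain N where N: "open N" "m \<in> N"
      and hN: "\<forall>W' \<sigma>. open W' \<and> W' \<subseteq> N \<and> smooth_section A E W' \<sigma> \<longrightarrow>
        smooth_section A F W' (\<lambda>m. h m (\<sigma> m))"
      by (elim exE conjE)
    have "smooth_section A E (N \<inter> V) \<sigma>"
      using N(1) V(1) by (intro smooth_section_subset[OF E V(1) _ _ \<sigma>]) auto
    then have "smooth_section A F (N \<inter> V) (\<lambda>m. h m (\<sigma> m))"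
      using N(1) V(1) by (intro hN[THEN spec, THEN spec, THEN mp]) auto
    then show "\<exists>W'. open W' \<and> m \<in> W' \<and> W' \<subseteq> V \<and> smooth_section A F W' (\<lambda>m. h m (\<sigma> m))"
      using N(1,2) V(1) m by (intro exI[of _ "N \<inter> V"]) auto
  qed
next
  fix m
  obtain W and I :: "nat set" and t \<phi> where W: "m \<in> W"
    and c: "coframe A (fibre E) (smooth_section A E) W I t \<phi>"
    using vector_bundle_coframe[OF E] .
  obtain V and J :: "nat set" and u \<psi> where V: "m \<in> V"
    and d: "coframe A (fibre F) (smooth_section A F) V J u \<psi>"
    using vector_bundle_coframe[OF F] .
  have o: "open (W \<inter> V)" using coframeD(1)[OF c] coframeD(1)[OF d] by blast
  have mWV: "m \<in> W \<inter> V" using W V by simp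
  show "\<exists>W (I::nat set) t \<phi>. m \<in> W \<and> coframe A (\<lambda>m. hom_space (fibre E m) (fibre F m))
    (\<lambda>W h. \<forall>W' \<sigma>. open W' \<and> W' \<subseteq> W \<and> smooth_section A E W' \<sigma> \<longrightarrow>
        smooth_section A F W' (\<lambda>m. h m (\<sigma> m))) W I t \<phi>"
    by (rule coframe_exists_nat[OF coframe_hom[OF E F coframe_subset[OF c o Int_lower1]
          coframe_subset[OF d o Int_lower2]]], intro exI conjI, rule mWV, assumption)
qed

lemma vector_bundle_hom:
  assumes "vector_bundle A E" "vector_bundle A F"
  shows "vector_bundle A (hom_bundle A E F)"
  unfolding hom_bundle_def by (rule vector_bundle_of_sections[OF locally_trivial_hom[OF assms]])

lemma smooth_section_hom:
  assumes "vector_bundle A E" "vector_bundle A F" "open W"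
  shows "smooth_section A (hom_bundle A E F) W h \<longleftrightarrow>
    (\<forall>m\<in>W. h m \<in> hom_space (fibre E m) (fibre F m)) \<and>
    (\<forall>W' \<sigma>. open W' \<and> W' \<subseteq> W \<and> smooth_section A E W' \<sigma> \<longrightarrow> smooth_section A F W' (\<lambda>m. h m (\<sigma> m)))"
  unfolding hom_bundle_def
  by (rule smooth_section_of_sections[OF locally_trivial_hom[OF assms(1,2)] assms(3)])

lemma smooth_section_homI:
  assumes "vector_bundle A E" "vector_bundle A F" "open W"
    and "\<And>m. m \<in> W \<Longrightarrow> h m \<in> hom_space (fibre E m) (fibre F m)"
    and "\<And>W' \<sigma>. open W' \<Longrightarrow> W' \<subseteq> W \<Longrightarrow> smooth_section A E W' \<sigma> \<Longrightarrow>
      smooth_section A F W' (\<lambda>m. h m (\<sigma> m))"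
  shows "smooth_section A (hom_bundle A E F) W h"
  unfolding smooth_section_hom[OF assms(1-3)]
proof (intro conjI allI ballI impI; (elim conjE)?)
  show "h m \<in> hom_space (fibre E m) (fibre F m)" if "m \<in> W" for m by (rule assms(4)[OF that])
  show "smooth_section A F W' (\<lambda>m. h m (\<sigma> m))"
    if "open W'" "W' \<subseteq> W" "smooth_section A E W' \<sigma>" for W' \<sigma>
    by (rule assms(5)[OF that])
qed

lemma smooth_section_apply:
  assumes "vector_bundle A E" "vector_bundle A F" "open W"
    and "smooth_section A (hom_bundle A E F) W h" "smooth_section A E W \<sigma>"
  shows "smooth_section A F W (\<lambda>m. h m (\<sigma> m))"
  using assms smooth_section_hom by blast

lemma smooth_section_line: "open W \<Longrightarrow> smooth_section A line_bundle W f \<longleftrightarrow> smooth_fun A W f"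
  unfolding smooth_section_def line_bundle_def
  by (auto intro: exI[of _ "\<lambda>_. f"] smooth_fun_cong[of W _ f])

lemma vector_bundle_line: "vector_bundle A line_bundle"
proof -
  have "is_frame (\<lambda>_::'m. UNIV :: real set) UNIV 1 (\<lambda>_ _. 1)"
  proof -
    have "span {1::real} = UNIV"
    proof -
      have "x \<in> span {1}" for x :: real
        using span_scale[OF span_base[of 1 "{1::real}"], of x] by simp
      then show ?thesis by blast
    qed
    moreover have "independent {1::real}" by (simp add: dependent_single)
    moreover have "(\<lambda>_::nat. 1::real) ` {..<1} = {1}" by auto
    ultimately show ?thesis by (simp add: is_frame_def inj_on_def)
  qed
  then show ?thesis
    using smooth_section_line[OF open_UNIV, of "\<lambda>_. 1"] smooth_fun_const[of A UNIV 1]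
    by (simp add: vector_bundle_def line_bundle_def)
qed

lemma dual_bundle_hom: "dual_bundle A E = hom_bundle A E line_bundle"
proof -
  have "(\<lambda>W \<alpha>. \<forall>W' \<sigma>. open W' \<and> W' \<subseteq> W \<and> smooth_section A E W' \<sigma> \<longrightarrow> smooth_fun A W' (\<lambda>m. \<alpha> m (\<sigma> m)))
    = (\<lambda>W \<alpha>. \<forall>W' \<sigma>. open W' \<and> W' \<subseteq> W \<and> smooth_section A E W' \<sigma> \<longrightarrow>
        smooth_section A line_bundle W' (\<lambda>m. \<alpha> m (\<sigma> m)))"
    using smooth_section_line by (intro ext) blast
  then show ?thesis
    by (simp add: dual_bundle_def hom_bundle_def dual_space_def line_bundle_def)
qed

lemma vector_bundle_dual: "vector_bundle A E \<Longrightarrow> vector_bundle A (dual_bundle A E)"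
  unfolding dual_bundle_hom by (rule vector_bundle_hom[OF _ vector_bundle_line])

lemma smooth_section_dual:
  assumes "vector_bundle A E" "open W"
  shows "smooth_section A (dual_bundle A E) W \<alpha> \<longleftrightarrow>
    (\<forall>m\<in>W. \<alpha> m \<in> dual_space (fibre E m)) \<and>
    (\<forall>W' \<sigma>. open W' \<and> W' \<subseteq> W \<and> smooth_section A E W' \<sigma> \<longrightarrow> smooth_fun A W' (\<lambda>m. \<alpha> m (\<sigma> m)))"
proof -
  have "fibre line_bundle m = UNIV" for m :: 'm by (simp add: line_bundle_def)
  then show ?thesis
    unfolding dual_bundle_hom smooth_section_hom[OF assms(1) vector_bundle_line assms(2)] dual_space_def
    using smooth_section_line by auto
qed

lemma smooth_fun_eval:
  assumes "vector_bundle A E" "open W" "smooth_section A (dual_bundle A E) W \<alpha>" "smooth_section A E W \<sigma>"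
  shows "smooth_fun A W (\<lambda>m. \<alpha> m (\<sigma> m))"
  using assms smooth_section_dual by blast

lemma bundle_of_sections_cong:
  fixes F :: "'m \<Rightarrow> 'e::real_vector set"
  assumes PQ: "\<And>W s. (\<And>m. m \<in> W \<Longrightarrow> s m \<in> F m) \<Longrightarrow> P W s \<longleftrightarrow> Q W s"
  shows "bundle_of_sections F P = bundle_of_sections F Q"
proof -
  have "(\<forall>i<r. P W (s i)) \<longleftrightarrow> (\<forall>i<r. Q W (s i))" if fr: "is_frame F W r s" for W r s
  proof -
    have "P W (s i) \<longleftrightarrow> Q W (s i)" if "i < r" for i
      using dual_basesD(3)[OF frame_coord[OF fr]] that by (intro PQ) simp
    then show ?thesis by blast
  qed
  then show ?thesis unfolding bundle_of_sections_def by auto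
qed

text \<open>With this and \<open>dual_bundle_hom\<close>, the bundles of duals and of tensors are special cases of the
  bundle of homomorphisms.\<close>

lemma tensor_bundle_hom:
  assumes E: "vector_bundle A E" and F: "vector_bundle A F"
  shows "tensor_bundle A E F = hom_bundle A (dual_bundle A E) (dual_bundle A (dual_bundle A F))"
proof -
  let ?F = "\<lambda>m. hom_space (dual_space (fibre E m)) (dual_space (dual_space (fibre F m)))"
  have eq: "(\<forall>W' \<alpha> \<beta>. open W' \<and> W' \<subseteq> W \<and> smooth_section A (dual_bundle A E) W' \<alpha> \<and>
        smooth_section A (dual_bundle A F) W' \<beta> \<longrightarrow> smooth_fun A W' (\<lambda>m. \<theta> m (\<alpha> m) (\<beta> m))) \<longleftrightarrow>
      (\<forall>W' \<alpha>. open W' \<and> W' \<subseteq> W \<and> smooth_section A (dual_bundle A E) W' \<alpha> \<longrightarrow>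
        smooth_section A (dual_bundle A (dual_bundle A F)) W' (\<lambda>m. \<theta> m (\<alpha> m)))" (is "?L \<longleftrightarrow> ?R")
    if \<theta>: "\<And>m. m \<in> W \<Longrightarrow> \<theta> m \<in> ?F m" for W \<theta>
  proof
    assume L: ?L
    show ?R
    proof (intro allI impI, elim conjE)
      fix W' \<alpha> assume W': "open W'" "W' \<subseteq> W" and \<alpha>: "smooth_section A (dual_bundle A E) W' \<alpha>"
      have "\<theta> m (\<alpha> m) \<in> dual_space (dual_space (fibre F m))" if "m \<in> W'" for m
        using linear_from_toD(1)[OF hom_spaceD[OF \<theta>]] smooth_section_fibre[OF \<alpha> that] that W'(2) by auto
      moreover have "smooth_fun A V (\<lambda>m. \<theta> m (\<alpha> m) (\<beta> m))"
        if V: "open V" "V \<subseteq> W'" and \<beta>: "smooth_section A (dual_bundle A F) V \<beta>" for V \<beta>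
        using L V \<beta> W' smooth_section_subset[OF vector_bundle_dual[OF E] W'(1) V \<alpha>]
        by (meson subset_trans)
      ultimately show "smooth_section A (dual_bundle A (dual_bundle A F)) W' (\<lambda>m. \<theta> m (\<alpha> m))"
        by (subst smooth_section_dual[OF vector_bundle_dual[OF F] W'(1)]) auto
    qed
  next
    assume R: ?R
    show ?L
    proof (intro allI impI, elim conjE)
      fix W' \<alpha> \<beta> assume W': "open W'" "W' \<subseteq> W" and \<alpha>: "smooth_section A (dual_bundle A E) W' \<alpha>"
        and \<beta>: "smooth_section A (dual_bundle A F) W' \<beta>"
      have "smooth_section A (dual_bundle A (dual_bundle A F)) W' (\<lambda>m. \<theta> m (\<alpha> m))"
        using R W' \<alpha> by blast
      from smooth_fun_eval[OF vector_bundle_dual[OF F] W'(1) this \<beta>]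
      show "smooth_fun A W' (\<lambda>m. \<theta> m (\<alpha> m) (\<beta> m))" .
    qed
  qed
  show ?thesis
    unfolding tensor_bundle_def hom_bundle_def[of A "dual_bundle A E"] fibre_bundles tensor_space_hom
    by (rule bundle_of_sections_cong) (rule eq)
qed

lemma vector_bundle_tensor:
  "vector_bundle A E \<Longrightarrow> vector_bundle A F \<Longrightarrow> vector_bundle A (tensor_bundle A E F)"
  by (simp add: tensor_bundle_hom vector_bundle_hom vector_bundle_dual)

lemma smooth_section_tensor:
  assumes "vector_bundle A E" "vector_bundle A F" "open W"
  shows "smooth_section A (tensor_bundle A E F) W \<theta> \<longleftrightarrow>
    (\<forall>m\<in>W. \<theta> m \<in> tensor_space (fibre E m) (fibre F m)) \<and>
    (\<forall>W' \<alpha> \<beta>. open W' \<and> W' \<subseteq> W \<and> smooth_section A (dual_bundle A E) W' \<alpha> \<and>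
        smooth_section A (dual_bundle A F) W' \<beta> \<longrightarrow> smooth_fun A W' (\<lambda>m. \<theta> m (\<alpha> m) (\<beta> m)))"
  (is "?S \<longleftrightarrow> ?M \<and> ?L")
proof
  note E' = vector_bundle_dual[OF assms(1)] and F' = vector_bundle_dual[OF assms(2)]
  note iff = smooth_section_hom[OF E' vector_bundle_dual[OF F'] assms(3), of \<theta>,
      folded tensor_bundle_hom[OF assms(1,2)]]
  {
    assume S: ?S
    have ?L
    proof (intro allI impI, elim conjE)
      fix W' \<alpha> \<beta> assume W': "open W'" "W' \<subseteq> W" and \<alpha>: "smooth_section A (dual_bundle A E) W' \<alpha>"
        and \<beta>: "smooth_section A (dual_bundle A F) W' \<beta>"
      have "smooth_section A (dual_bundle A (dual_bundle A F)) W' (\<lambda>m. \<theta> m (\<alpha> m))"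
        using S iff W' \<alpha> by blast
      from smooth_fun_eval[OF F' W'(1) this \<beta>] show "smooth_fun A W' (\<lambda>m. \<theta> m (\<alpha> m) (\<beta> m))" .
    qed
    moreover have ?M
    proof
      show "\<theta> m \<in> tensor_space (fibre E m) (fibre F m)" if "m \<in> W" for m
        using smooth_section_fibre[OF S that] by simp
    qed
    ultimately show "?M \<and> ?L" by (rule conjI[rotated])
  }
  {
    assume L: "?M \<and> ?L"
    have "smooth_section A (dual_bundle A (dual_bundle A F)) W' (\<lambda>m. \<theta> m (\<alpha> m))"
      if W': "open W'" "W' \<subseteq> W" and \<alpha>: "smooth_section A (dual_bundle A E) W' \<alpha>" for W' \<alpha>
    proof -
      have "\<theta> m (\<alpha> m) \<in> dual_space (dual_space (fibre F m))" if "m \<in> W'" for m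
      proof -
        have "\<theta> m \<in> hom_space (dual_space (fibre E m)) (dual_space (dual_space (fibre F m)))"
          using L that W'(2) unfolding tensor_space_hom by blast
        from linear_from_toD(1)[OF hom_spaceD[OF this], of "\<alpha> m"] show ?thesis
          using smooth_section_fibre[OF \<alpha> that] by simp
      qed
      moreover have "smooth_fun A V (\<lambda>m. \<theta> m (\<alpha> m) (\<beta> m))"
        if V: "open V" "V \<subseteq> W'" and \<beta>: "smooth_section A (dual_bundle A F) V \<beta>" for V \<beta>
        using L V \<beta> W' smooth_section_subset[OF E' W'(1) V \<alpha>] by (meson subset_trans)
      ultimately show "smooth_section A (dual_bundle A (dual_bundle A F)) W' (\<lambda>m. \<theta> m (\<alpha> m))"
        by (subst smooth_section_dual[OF F' W'(1)]) auto
    qed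
    then show ?S using L iff by (simp add: tensor_space_hom)
  }
qed

lemma smooth_fun_tensor:
  assumes E: "vector_bundle A E" "vector_bundle A F" and W: "open W" and W': "open W'" "W' \<subseteq> W"
    and \<theta>: "smooth_section A (tensor_bundle A E F) W \<theta>"
    and \<alpha>: "smooth_section A (dual_bundle A E) W' \<alpha>" and \<beta>: "smooth_section A (dual_bundle A F) W' \<beta>"
  shows "smooth_fun A W' (\<lambda>m. \<theta> m (\<alpha> m) (\<beta> m))"
  by (rule conjunct2[OF iffD1[OF smooth_section_tensor[OF E W] \<theta>], THEN spec, THEN spec, THEN spec, THEN mp])
    (intro conjI W' \<alpha> \<beta>)

lemma smooth_section_tensorI:
  assumes "vector_bundle A E" "vector_bundle A F" "open W"
    and "\<And>m. m \<in> W \<Longrightarrow> \<theta> m \<in> tensor_space (fibre E m) (fibre F m)"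
    and "\<And>W' \<alpha> \<beta>. open W' \<Longrightarrow> W' \<subseteq> W \<Longrightarrow> smooth_section A (dual_bundle A E) W' \<alpha> \<Longrightarrow>
      smooth_section A (dual_bundle A F) W' \<beta> \<Longrightarrow> smooth_fun A W' (\<lambda>m. \<theta> m (\<alpha> m) (\<beta> m))"
  shows "smooth_section A (tensor_bundle A E F) W \<theta>"
  unfolding smooth_section_tensor[OF assms(1-3)]
proof (intro conjI allI ballI impI; (elim conjE)?)
  show "\<theta> m \<in> tensor_space (fibre E m) (fibre F m)" if "m \<in> W" for m by (rule assms(4)[OF that])
  show "smooth_fun A W' (\<lambda>m. \<theta> m (\<alpha> m) (\<beta> m))"
    if "open W'" "W' \<subseteq> W" "smooth_section A (dual_bundle A E) W' \<alpha>" "smooth_section A (dual_bundle A F) W' \<beta>"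
    for W' \<alpha> \<beta>
    by (rule assms(5)[OF that])
qed

lemma coframe_dual_section:
  assumes E: "vector_bundle A E" and c: "coframe A (fibre E) (smooth_section A E) W I t \<phi>" and i: "i \<in> I"
  shows "smooth_section A (dual_bundle A E) W (\<phi> i)"
proof -
  have "smooth_fun A W' (\<lambda>m. \<phi> i m (\<sigma> m))" if "open W'" "W' \<subseteq> W" "smooth_section A E W' \<sigma>" for W' \<sigma>
    by (rule coframe_coord_smooth[OF c that i])
  then show ?thesis
    using dual_basesD(4)[OF coframeD(3)[OF c] i] smooth_section_dual[OF E coframeD(1)[OF c]] by simp
qed

text \<open>Smoothness of a section may be tested by pairing it with smooth sections of the dual.\<close>

lemma smooth_section_dual_test:
  assumes E: "vector_bundle A E" and W: "open W" and \<sigma>: "\<And>m. m \<in> W \<Longrightarrow> \<sigma> m \<in> fibre E m"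
    and test: "\<And>W' \<alpha>. open W' \<Longrightarrow> W' \<subseteq> W \<Longrightarrow> smooth_section A (dual_bundle A E) W' \<alpha> \<Longrightarrow>
      smooth_fun A W' (\<lambda>m. \<alpha> m (\<sigma> m))"
  shows "smooth_section A E W \<sigma>"
proof (rule smooth_section_local[OF E W \<sigma>])
  fix m assume m: "m \<in> W"
  obtain V and I :: "nat set" and t \<phi> where V: "m \<in> V"
    and c: "coframe A (fibre E) (smooth_section A E) V I t \<phi>"
    using vector_bundle_coframe[OF E] .
  have o: "open (V \<inter> W)" using coframeD(1)[OF c] W by blast
  have "smooth_fun A (V \<inter> W) (\<lambda>m. \<phi> i m (\<sigma> m))" if "i \<in> I" for i
    using o coframe_dual_section[OF E coframe_subset[OF c o Int_lower1] that] by (intro test) auto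
  then have "smooth_section A E (V \<inter> W) \<sigma>"
    using coframeD(4)[OF c o Int_lower1, of \<sigma>] \<sigma> by blast
  then show "\<exists>W'. open W' \<and> m \<in> W' \<and> W' \<subseteq> W \<and> smooth_section A E W' \<sigma>"
    using o V m by blast
qed

lemma smooth_section_bidual:
  assumes E: "vector_bundle A E" and W: "open W" and \<sigma>: "smooth_section A E W \<sigma>"
  shows "smooth_section A (dual_bundle A (dual_bundle A E)) W (\<lambda>m. bidual_embed (fibre E m) (\<sigma> m))"
proof -
  have "smooth_fun A W' (\<lambda>m. bidual_embed (fibre E m) (\<sigma> m) (\<alpha> m))"
    if W': "open W'" "W' \<subseteq> W" and \<alpha>: "smooth_section A (dual_bundle A E) W' \<alpha>" for W' \<alpha>
  proof (rule smooth_fun_cong[OF W'(1)])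
    show "smooth_fun A W' (\<lambda>m. \<alpha> m (\<sigma> m))"
      by (rule smooth_fun_eval[OF E W'(1) \<alpha> smooth_section_subset[OF E W W' \<sigma>]])
    show "\<alpha> m (\<sigma> m) = bidual_embed (fibre E m) (\<sigma> m) (\<alpha> m)" if "m \<in> W'" for m
      using bidual_embed_eval[of "\<alpha> m"] smooth_section_fibre[OF \<alpha> that] by simp
  qed
  then show ?thesis
    by (subst smooth_section_dual[OF vector_bundle_dual[OF E] W]) (auto simp: bidual_embed_in)
qed

lemma smooth_section_contract:
  assumes E: "vector_bundle A E" and F: "vector_bundle A F" and W: "open W"
    and \<theta>: "smooth_section A (tensor_bundle A E F) W \<theta>" and \<beta>: "smooth_section A (dual_bundle A F) W \<beta>"
  shows "smooth_section A E W (\<lambda>m. contract (fibre E m) (\<beta> m) (\<theta> m))"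
proof (rule smooth_section_dual_test[OF E W])
  note fin = vector_bundle_finite_dim[OF E]
  have \<theta>m: "\<theta> m \<in> tensor_space (fibre E m) (fibre F m)" and \<beta>m: "\<beta> m \<in> dual_space (fibre F m)"
    if "m \<in> W" for m
    using smooth_section_fibre[OF \<theta> that] smooth_section_fibre[OF \<beta> that] by auto
  show "contract (fibre E m) (\<beta> m) (\<theta> m) \<in> fibre E m" if "m \<in> W" for m
    by (rule contract_in[OF fin \<theta>m[OF that] \<beta>m[OF that]])
  fix W' \<alpha> assume W': "open W'" "W' \<subseteq> W" and \<alpha>: "smooth_section A (dual_bundle A E) W' \<alpha>"
  show "smooth_fun A W' (\<lambda>m. \<alpha> m (contract (fibre E m) (\<beta> m) (\<theta> m)))"
  proof (rule smooth_fun_cong[OF W'(1)])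
    show "smooth_fun A W' (\<lambda>m. \<theta> m (\<alpha> m) (\<beta> m))"
      by (rule smooth_fun_tensor[OF E F W W' \<theta> \<alpha> smooth_section_subset[OF vector_bundle_dual[OF F] W W' \<beta>]])
    fix m assume m: "m \<in> W'"
    then have "m \<in> W" using W' by blast
    show "\<theta> m (\<alpha> m) (\<beta> m) = \<alpha> m (contract (fibre E m) (\<beta> m) (\<theta> m))"
      using contract_eval[OF fin \<theta>m[OF \<open>m \<in> W\<close>] \<beta>m[OF \<open>m \<in> W\<close>]] smooth_section_fibre[OF \<alpha> m] by simp
  qed
qed

section \<open>Injective and surjective bundle maps\<close>

text \<open>The images of a frame of \<open>E\<close> are part of a coframe of \<open>F\<close> near each point, and the
  coordinates of \<open>h(\<sigma>)\<close> with respect to these members are those of \<open>\<sigma>\<close>.\<close>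

lemma injective_bundle_map_reflects_smooth:
  assumes E: "vector_bundle A E" and F: "vector_bundle A F" and h: "bundle_map A E F h"
    and inj: "\<And>m. inj_on (h m) (fibre E m)" and W: "open W"
    and \<sigma>: "\<And>m. m \<in> W \<Longrightarrow> \<sigma> m \<in> fibre E m" and h\<sigma>: "smooth_section A F W (\<lambda>m. h m (\<sigma> m))"
  shows "smooth_section A E W \<sigma>"
proof (rule smooth_section_local[OF E W \<sigma>])
  fix m assume m: "m \<in> W"
  obtain V and I :: "nat set" and t \<phi> where V: "m \<in> V"
    and c: "coframe A (fibre E) (smooth_section A E) V I t \<phi>"
    using vector_bundle_coframe[OF E] .
  obtain V' and J :: "nat set" and u \<psi> where V': "m \<in> V'"
    and d: "coframe A (fibre F) (smooth_section A F) V' J u \<psi>"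
    using vector_bundle_coframe[OF F] .
  define N where "N = V \<inter> V' \<inter> W"
  have N: "open N" "m \<in> N" "N \<subseteq> V" "N \<subseteq> V'" "N \<subseteq> W"
    using coframeD(1)[OF c] coframeD(1)[OF d] V V' W m by (auto simp: N_def)
  note c' = coframe_subset[OF c N(1,3)] and d' = coframe_subset[OF d N(1,4)]
  note b = coframeD(3)[OF c' N(2)]
  have sm: "smooth_section A F N (\<lambda>x. h x (t i x))" if "i \<in> I" for i
    by (rule bundle_mapD(2)[OF h N(1) coframe_section[OF c' that]])
  have indep: "e i = 0" if z: "(\<Sum>i\<in>I. e i *\<^sub>R h m (t i m)) = 0" and i: "i \<in> I" for e i
  proof -
    have "h m (\<Sum>i\<in>I. e i *\<^sub>R t i m) = h m 0"
      using z linear_from_to_sum[OF bundle_mapD(1)[OF h] vector_bundle_subspace[OF E], of I "\<lambda>i. t i m" m e]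
        dual_basesD(3)[OF b] linear_from_to_0[OF bundle_mapD(1)[OF h] vector_bundle_subspace[OF E]] by simp
    moreover have "(\<Sum>i\<in>I. e i *\<^sub>R t i m) \<in> fibre E m"
      using dual_basesD(2,3)[OF b] by (intro subspace_sum subspace_scale)
    moreover have "0 \<in> fibre E m" by (rule subspace_0[OF dual_basesD(2)[OF b]])
    ultimately have "(\<Sum>i\<in>I. e i *\<^sub>R t i m) = 0" using inj_onD[OF inj] by blast
    then show ?thesis
      using dual_bases_coord_sum[OF b i, of e] linear_from_to_0[OF dual_basesD(7)[OF b i] dual_basesD(2)[OF b]]
      by simp
  qed
  have "\<exists>N' J' t' \<phi>'. m \<in> N' \<and> N' \<subseteq> N \<and>
      coframe A (fibre F) (smooth_section A F) N' (Inl ` I \<union> Inr ` J' :: (nat + nat) set) t' \<phi>' \<and>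
      (\<forall>i\<in>I. t' (Inl i) = (\<lambda>x. h x (t i x)))"
  proof (rule coframe_extend[where J = I and \<tau> = "\<lambda>i x. h x (t i x)", OF d' N(2) coframeD(2)[OF c']])
    show "smooth_section A F N (\<lambda>x. h x (t i x))" if "i \<in> I" for i using sm[OF that] .
    show "h x (t i x) \<in> fibre F x" if "i \<in> I" "x \<in> N" for i x
      using smooth_section_fibre[OF sm[OF that(1)] that(2)] .
    show "e i = 0" if "(\<Sum>i\<in>I. e i *\<^sub>R h m (t i m)) = 0" "i \<in> I" for e i
      by (rule indep[OF that])
  qed
  then obtain N' J' t' \<phi>' where N': "m \<in> N'" "N' \<subseteq> N"
    and c'': "coframe A (fibre F) (smooth_section A F) N' (Inl ` I \<union> Inr ` J' :: (nat + nat) set) t' \<phi>'"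
    and t': "\<And>i. i \<in> I \<Longrightarrow> t' (Inl i) = (\<lambda>x. h x (t i x))" by blast
  have o: "open N'" by (rule coframeD(1)[OF c''])
  have N'W: "N' \<subseteq> W" "N' \<subseteq> V" using N' N by auto
  have "smooth_fun A N' (\<lambda>x. \<phi> i x (\<sigma> x))" if i: "i \<in> I" for i
  proof (rule smooth_fun_cong[OF o])
    have "smooth_section A F N' (\<lambda>x. h x (\<sigma> x))"
      by (rule smooth_section_subset[OF F W o N'W(1) h\<sigma>])
    moreover have "h x (\<sigma> x) \<in> fibre F x" if "x \<in> N'" for x
      using smooth_section_fibre[OF h\<sigma>] that N'W(1) by blast
    ultimately show "smooth_fun A N' (\<lambda>x. \<phi>' (Inl i) x (h x (\<sigma> x)))"
      using coframeD(4)[OF c'' o order_refl, of "\<lambda>x. h x (\<sigma> x)"] i by blast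
    fix x assume x: "x \<in> N'"
    then have xV: "x \<in> V" and \<sigma>x: "\<sigma> x \<in> fibre E x" using N'W \<sigma> by auto
    note bx = coframeD(3)[OF c xV] and bx' = coframeD(3)[OF c'' x]
    have fin: "finite (Inl ` I \<union> Inr ` J' :: (nat + nat) set)" by (rule dual_basesD(1)[OF bx'])
    have "h x (\<sigma> x) = (\<Sum>k\<in>I. \<phi> k x (\<sigma> x) *\<^sub>R h x (t k x))"
      by (rule dual_bases_linear_expand[OF bx bundle_mapD(1)[OF h] \<sigma>x])
    also have "\<dots> = (\<Sum>p\<in>Inl ` I \<union> Inr ` J'. (case p of Inl k \<Rightarrow> \<phi> k x (\<sigma> x) | Inr _ \<Rightarrow> 0) *\<^sub>R t' p x)"
      using fin t' by (subst sum.union_disjoint) (auto simp: sum.reindex)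
    finally have e: "h x (\<sigma> x) = (\<Sum>p\<in>Inl ` I \<union> Inr ` J'. (case p of Inl k \<Rightarrow> \<phi> k x (\<sigma> x) | Inr _ \<Rightarrow> 0) *\<^sub>R t' p x)" .
    show "\<phi>' (Inl i) x (h x (\<sigma> x)) = \<phi> i x (\<sigma> x)"
      unfolding e using dual_bases_coord_sum[OF bx', of "Inl i"] i by simp
  qed
  then have "smooth_section A E N' \<sigma>"
    using coframeD(4)[OF c o N'W(2), of \<sigma>] \<sigma> N'W(1) by blast
  then show "\<exists>W'. open W' \<and> m \<in> W' \<and> W' \<subseteq> W \<and> smooth_section A E W' \<sigma>"
    using o N'(1) N'W(1) by blast
qed

text \<open>The splitting sends a basis of \<open>F\<close> near \<open>m\<close> to lifts in \<open>E\<close>.\<close>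

lemma surjective_bundle_map_local_splitting:
  assumes E: "vector_bundle A E" and F: "vector_bundle A F" and h: "bundle_map A E F h"
    and surj: "\<And>m. h m ` fibre E m = fibre F m"
  obtains W s where "open W" "m \<in> W" "\<And>x. x \<in> W \<Longrightarrow> linear_from_to (fibre F x) (fibre E x) (s x)"
    "\<And>x y. x \<in> W \<Longrightarrow> y \<in> fibre F x \<Longrightarrow> h x (s x y) = y"
    "\<And>W' \<sigma>. open W' \<Longrightarrow> W' \<subseteq> W \<Longrightarrow> smooth_section A F W' \<sigma> \<Longrightarrow> smooth_section A E W' (\<lambda>x. s x (\<sigma> x))"
proof -
  obtain V and I :: "nat set" and t \<phi> where V: "m \<in> V"
    and c: "coframe A (fibre E) (smooth_section A E) V I t \<phi>"
    using vector_bundle_coframe[OF E] .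
  obtain V' and J :: "nat set" and u \<psi> where V': "m \<in> V'"
    and d: "coframe A (fibre F) (smooth_section A F) V' J u \<psi>"
    using vector_bundle_coframe[OF F] .
  define N where "N = V \<inter> V'"
  have N: "open N" "m \<in> N" "N \<subseteq> V" "N \<subseteq> V'"
    using coframeD(1)[OF c] coframeD(1)[OF d] V V' by (auto simp: N_def)
  note c' = coframe_subset[OF c N(1,3)] and d' = coframe_subset[OF d N(1,4)]
  have "\<forall>j\<in>J. \<exists>p. p \<in> fibre E m \<and> h m p = u j m"
    using coframe_frame_section[OF d' _ N(2)] surj[of m] by (metis (no_types, lifting) imageE)
  then obtain p where p: "\<And>j. j \<in> J \<Longrightarrow> p j \<in> fibre E m" "\<And>j. j \<in> J \<Longrightarrow> h m (p j) = u j m" by metis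
  \<comment> \<open>The lifts \<open>p j\<close> of a basis of \<open>F\<close> at \<open>m\<close> are extended to sections with constant coordinates.\<close>
  define q where "q = (\<lambda>j x. \<Sum>i\<in>I. \<phi> i m (p j) *\<^sub>R t i x)"
  have q: "smooth_section A E N (q j)" for j
    unfolding q_def
    by (rule smooth_section_sum[OF E N(1) coframeD(2)[OF c'] smooth_fun_const coframe_section[OF c']])
  have qm: "q j m = p j" if "j \<in> J" for j
    unfolding q_def using dual_basesD(6)[OF coframeD(3)[OF c' N(2)] p(1)[OF that]] .
  have hq: "smooth_section A F N (\<lambda>x. h x (q j x))" for j
    by (rule bundle_mapD(2)[OF h N(1) q])
  have "dual_bases (fibre F m) J (\<lambda>j. h m (q j m)) (\<lambda>j. \<psi> j m)"
    using coframeD(3)[OF d' N(2)] p(2) qm unfolding dual_bases_def by simp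
  then obtain W \<rho> where W: "m \<in> W" "W \<subseteq> N"
    and e: "coframe A (fibre F) (smooth_section A F) W J (\<lambda>j x. h x (q j x)) \<rho>"
    using coframe_of_basis[where \<tau> = "\<lambda>j x. h x (q j x)", OF d' N(2) hq smooth_section_fibre[OF hq]]
    by blast
  define s where "s = (\<lambda>x y. \<Sum>j\<in>J. \<rho> j x y *\<^sub>R q j x)"
  have qE: "q j x \<in> fibre E x" if "x \<in> W" for j x
    using smooth_section_fibre[OF q] W(2) that by blast
  show ?thesis
  proof (rule that)
    show "open W" by (rule coframeD(1)[OF e])
    show "m \<in> W" by (rule W(1))
    fix x assume x: "x \<in> W"
    note b = coframeD(3)[OF e x]
    show "linear_from_to (fibre F x) (fibre E x) (s x)"
    proof -
      have "s x y \<in> fibre E x" for y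
        unfolding s_def using qE[OF x] vector_bundle_subspace[OF E]
        by (intro subspace_sum subspace_scale)
      then show ?thesis
        using linear_from_toD(2,3)[OF dual_basesD(7)[OF b]]
        by (auto simp: linear_from_to_def s_def scaleR_left_distrib sum.distrib scaleR_sum_right)
    qed
    show "h x (s x y) = y" if y: "y \<in> fibre F x" for y
      unfolding s_def
      using linear_from_to_sum[OF bundle_mapD(1)[OF h] vector_bundle_subspace[OF E],
          of J "\<lambda>j. q j x" x "\<lambda>j. \<rho> j x y"] qE[OF x] dual_basesD(6)[OF b y] by simp
  next
    fix W' \<sigma> assume W': "open W'" "W' \<subseteq> W" and \<sigma>: "smooth_section A F W' \<sigma>"
    have W'N: "W' \<subseteq> N" using W' W by blast
    show "smooth_section A E W' (\<lambda>x. s x (\<sigma> x))"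
      unfolding s_def
    proof (rule smooth_section_sum[OF E W'(1) coframeD(2)[OF e]])
      show "smooth_fun A W' (\<lambda>x. \<rho> j x (\<sigma> x))" if "j \<in> J" for j
        by (rule coframe_coord_smooth[OF e W' \<sigma> that])
      show "smooth_section A E W' (q j)" for j
        by (rule smooth_section_subset[OF E N(1) W'(1) W'N q])
    qed
  qed
qed

end

section \<open>The dual with respect to a side bundle\<close>

lemma DVB_sequenceD:
  assumes "DVB_sequence A S"
  shows "vector_bundle A (side1 S)" "vector_bundle A (side2 S)" "vector_bundle A (total S)"
    "vector_bundle A (core S)"
    "bundle_map A (tensor_bundle A (side1 S) (side2 S)) (total S) (incl S)"
    "bundle_map A (total S) (core S) (proj S)"
    "inj_on (incl S m) (tensor_space (fibre (side1 S) m) (fibre (side2 S) m))"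
    "incl S m ` tensor_space (fibre (side1 S) m) (fibre (side2 S) m) =
       {\<sigma> \<in> fibre (total S) m. proj S m \<sigma> = 0}"
    "proj S m ` fibre (total S) m = fibre (core S) m"
    "linear_from_to (tensor_space (fibre (side1 S) m) (fibre (side2 S) m)) (fibre (total S) m) (incl S m)"
    "linear_from_to (fibre (total S) m) (fibre (core S) m) (proj S m)"
proof -
  show "vector_bundle A (side1 S)" "vector_bundle A (side2 S)" "vector_bundle A (total S)"
    "vector_bundle A (core S)"
    and i: "bundle_map A (tensor_bundle A (side1 S) (side2 S)) (total S) (incl S)"
    and j: "bundle_map A (total S) (core S) (proj S)"
    and "inj_on (incl S m) (tensor_space (fibre (side1 S) m) (fibre (side2 S) m))"
    "incl S m ` tensor_space (fibre (side1 S) m) (fibre (side2 S) m) =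
       {\<sigma> \<in> fibre (total S) m. proj S m \<sigma> = 0}"
    "proj S m ` fibre (total S) m = fibre (core S) m"
    using assms by (auto simp: DVB_sequence_def)
  show "linear_from_to (fibre (total S) m) (fibre (core S) m) (proj S m)"
    using j by (simp add: bundle_map_def)
  have "linear_from_to (fibre (tensor_bundle A (side1 S) (side2 S)) m) (fibre (total S) m) (incl S m)"
    using i unfolding bundle_map_def by blast
  then show "linear_from_to (tensor_space (fibre (side1 S) m) (fibre (side2 S) m)) (fibre (total S) m) (incl S m)"
    by simp
qed

lemma DVB_sequence_incl:
  assumes "DVB_sequence A S" "\<theta> \<in> tensor_space (fibre (side1 S) m) (fibre (side2 S) m)"
  shows "incl S m \<theta> \<in> fibre (total S) m" "proj S m (incl S m \<theta>) = 0"
proof -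
  have "incl S m \<theta> \<in> {\<sigma> \<in> fibre (total S) m. proj S m \<sigma> = 0}"
    unfolding DVB_sequenceD(8)[OF assms(1), symmetric] using assms(2) by (rule imageI)
  then show "incl S m \<theta> \<in> fibre (total S) m" "proj S m (incl S m \<theta>) = 0" by auto
qed

lemma DVB_sequence_kernel:
  assumes "DVB_sequence A S" "\<sigma> \<in> fibre (total S) m" "proj S m \<sigma> = 0"
  obtains \<theta> where "\<theta> \<in> tensor_space (fibre (side1 S) m) (fibre (side2 S) m)" "incl S m \<theta> = \<sigma>"
proof -
  have "\<sigma> \<in> incl S m ` tensor_space (fibre (side1 S) m) (fibre (side2 S) m)"
    unfolding DVB_sequenceD(8)[OF assms(1)] using assms(2,3) by simp
  then show ?thesis using that by blast
qed

text \<open>Given a linear section \<open>s\<close> of the projection \<open>j\<close> at \<open>m\<close>, the component \<open>\<theta>\<close> in the tensor product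
  of an element \<open>\<sigma> = i(\<theta>) + s(j(\<sigma>))\<close> of the total space.\<close>

definition tensor_part :: "('m, 'u::real_vector, 'v::real_vector, 'p::real_vector, 'k::real_vector) dvb_data
    \<Rightarrow> 'm \<Rightarrow> ('k \<Rightarrow> 'p) \<Rightarrow> 'p \<Rightarrow> ('u, 'v) tensor" where
  "tensor_part S m s \<sigma> = inv_into (tensor_space (fibre (side1 S) m) (fibre (side2 S) m)) (incl S m)
     (\<sigma> - s (proj S m \<sigma>))"

text \<open>The element of the dual with prescribed components \<open>h\<close> on \<open>K\<close> and \<open>\<beta>\<close> in \<open>V\<^sup>*\<close> with respect
  to the decomposition of \<open>\<Pi>\<close> given by the section \<open>s\<close> of \<open>j\<close>.\<close>

definition dual_element :: "('m, 'u::real_vector, 'v::real_vector, 'p::real_vector, 'k::real_vector) dvb_data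
    \<Rightarrow> 'm \<Rightarrow> ('k \<Rightarrow> 'p) \<Rightarrow> ('k \<Rightarrow> 'u) \<times> ('v \<Rightarrow> real) \<Rightarrow> ('p \<Rightarrow> 'u) \<times> ('v \<Rightarrow> real)" where
  "dual_element S m s = (\<lambda>(h, \<beta>). (restrict0 (fibre (total S) m)
     (\<lambda>\<sigma>. h (proj S m \<sigma>) + contract (fibre (side1 S) m) \<beta> (tensor_part S m s \<sigma>)), \<beta>))"

context smooth_base
begin

lemma coframe_prod:
  assumes c: "coframe A F P W I t \<phi>" and d: "coframe A G Q W J u \<psi>"
  shows "coframe A (\<lambda>m. F m \<times> G m) (\<lambda>W s. P W (\<lambda>m. fst (s m)) \<and> Q W (\<lambda>m. snd (s m))) W
    (Inl ` I \<union> Inr ` J)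
    (\<lambda>k m. case_sum (\<lambda>i. (t i m, 0)) (\<lambda>j. (0, u j m)) k)
    (\<lambda>k m. case_sum (\<lambda>i. restrict0 (F m \<times> G m) (\<lambda>(x, y). \<phi> i m x))
      (\<lambda>j. restrict0 (F m \<times> G m) (\<lambda>(x, y). \<psi> j m y)) k)"
  unfolding coframe_def
proof (intro conjI ballI allI impI; (elim conjE)?)
  show "open W" by (rule coframeD(1)[OF c])
  show "finite (Inl ` I \<union> Inr ` J)" using coframeD(2)[OF c] coframeD(2)[OF d] by simp
  show "dual_bases (F m \<times> G m) (Inl ` I \<union> Inr ` J)
    (\<lambda>k. case_sum (\<lambda>i. (t i m, 0)) (\<lambda>j. (0, u j m)) k)
    (\<lambda>k. case_sum (\<lambda>i. restrict0 (F m \<times> G m) (\<lambda>(x, y). \<phi> i m x))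
      (\<lambda>j. restrict0 (F m \<times> G m) (\<lambda>(x, y). \<psi> j m y)) k)" if "m \<in> W" for m
    by (rule dual_bases_prod[OF coframeD(3)[OF c that] coframeD(3)[OF d that]])
  fix W' s assume W': "open W'" "W' \<subseteq> W" and s: "\<forall>m\<in>W'. s m \<in> F m \<times> G m"
  have s1: "fst (s m) \<in> F m" and s2: "snd (s m) \<in> G m" if "m \<in> W'" for m
    using bspec[OF s that] by auto
  have e1: "\<phi> i m (fst (s m)) = restrict0 (F m \<times> G m) (\<lambda>(x, y). \<phi> i m x) (s m)" if "m \<in> W'" for m i
    using bspec[OF s that] by (simp add: restrict0_in case_prod_beta)
  have e2: "\<psi> j m (snd (s m)) = restrict0 (F m \<times> G m) (\<lambda>(x, y). \<psi> j m y) (s m)" if "m \<in> W'" for m j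
    using bspec[OF s that] by (simp add: restrict0_in case_prod_beta)
  have "smooth_fun A W' (\<lambda>m. \<phi> i m (fst (s m))) \<longleftrightarrow>
      smooth_fun A W' (\<lambda>m. restrict0 (F m \<times> G m) (\<lambda>(x, y). \<phi> i m x) (s m))" for i
    by (rule iffI; rule smooth_fun_cong[OF W'(1)]) (auto simp: e1)
  moreover have "smooth_fun A W' (\<lambda>m. \<psi> j m (snd (s m))) \<longleftrightarrow>
      smooth_fun A W' (\<lambda>m. restrict0 (F m \<times> G m) (\<lambda>(x, y). \<psi> j m y) (s m))" for j
    by (rule iffI; rule smooth_fun_cong[OF W'(1)]) (auto simp: e2)
  ultimately show "P W' (\<lambda>m. fst (s m)) \<and> Q W' (\<lambda>m. snd (s m)) \<longleftrightarrow>
      (\<forall>k\<in>Inl ` I \<union> Inr ` J. smooth_fun A W' (\<lambda>m. case_sum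
        (\<lambda>i. restrict0 (F m \<times> G m) (\<lambda>(x, y). \<phi> i m x))
        (\<lambda>j. restrict0 (F m \<times> G m) (\<lambda>(x, y). \<psi> j m y)) k (s m)))"
    using coframeD(4)[OF c W', of "\<lambda>m. fst (s m)"] coframeD(4)[OF d W', of "\<lambda>m. snd (s m)"] s1 s2
    by (simp add: ball_Un)
qed

text \<open>Coframes are transported along a fibrewise isomorphism \<open>f\<close>, with inverse \<open>g\<close>, for which smoothness
  of \<open>\<sigma>\<close> is equivalent to smoothness of \<open>f(\<sigma>)\<close>.\<close>

lemma coframe_transport:
  assumes c: "coframe A G Q W I t \<phi>"
    and F: "\<And>m. m \<in> W \<Longrightarrow> subspace (F m)"
    and f: "\<And>m. m \<in> W \<Longrightarrow> linear_from_to (F m) (G m) (f m)"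
    and g: "\<And>m y. m \<in> W \<Longrightarrow> y \<in> G m \<Longrightarrow> g m y \<in> F m"
    and gf: "\<And>m x. m \<in> W \<Longrightarrow> x \<in> F m \<Longrightarrow> g m (f m x) = x"
    and fg: "\<And>m y. m \<in> W \<Longrightarrow> y \<in> G m \<Longrightarrow> f m (g m y) = y"
    and PQ: "\<And>W' \<sigma>. open W' \<Longrightarrow> W' \<subseteq> W \<Longrightarrow> (\<And>m. m \<in> W' \<Longrightarrow> \<sigma> m \<in> F m) \<Longrightarrow>
      P W' \<sigma> \<longleftrightarrow> Q W' (\<lambda>m. f m (\<sigma> m))"
  shows "coframe A F P W I (\<lambda>i m. g m (t i m)) (\<lambda>i m. restrict0 (F m) (\<lambda>x. \<phi> i m (f m x)))"
  unfolding coframe_def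
proof (intro conjI ballI allI impI; (elim conjE)?)
  show "open W" by (rule coframeD(1)[OF c])
  show "finite I" by (rule coframeD(2)[OF c])
  fix m assume m: "m \<in> W"
  note b = coframeD(3)[OF c m]
  note b' = dual_basesD[OF b]
  have fin: "f m x \<in> G m" if "x \<in> F m" for x by (rule linear_from_toD(1)[OF f[OF m] that])
  have "x = (\<Sum>i\<in>I. restrict0 (F m) (\<lambda>x. \<phi> i m (f m x)) x *\<^sub>R g m (t i m))" if x: "x \<in> F m" for x
  proof -
    let ?y = "\<Sum>i\<in>I. \<phi> i m (f m x) *\<^sub>R g m (t i m)"
    have y: "?y \<in> F m" by (intro subspace_sum subspace_scale F[OF m] g[OF m b'(3)])
    have "f m ?y = (\<Sum>i\<in>I. \<phi> i m (f m x) *\<^sub>R f m (g m (t i m)))"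
      by (rule linear_from_to_sum[OF f[OF m] F[OF m] g[OF m b'(3)]])
    also have "\<dots> = (\<Sum>i\<in>I. \<phi> i m (f m x) *\<^sub>R t i m)"
      using fg[OF m] b'(3) by (intro sum.cong) auto
    also have "\<dots> = f m x" by (rule b'(6)[OF fin[OF x]])
    finally have "?y = x" using gf[OF m y] gf[OF m x] by simp
    then show ?thesis using x by (simp add: restrict0_in)
  qed
  moreover have "restrict0 (F m) (\<lambda>x. \<phi> i m (f m x)) \<in> dual_space (F m)" if "i \<in> I" for i
    by (rule restrict0_dual_space[OF linear_from_to_comp[OF f[OF m] b'(7)[OF that]] F[OF m]])
  moreover have "restrict0 (F m) (\<lambda>x. \<phi> i m (f m x)) (g m (t k m)) = (if i = k then 1 else 0)"
    if "i \<in> I" "k \<in> I" for i k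
    using g[OF m b'(3)[OF that(2)]] fg[OF m b'(3)[OF that(2)]] b'(5)[OF that] by (simp add: restrict0_in)
  moreover have "g m (t i m) \<in> F m" if "i \<in> I" for i by (rule g[OF m b'(3)[OF that]])
  ultimately show "dual_bases (F m) I (\<lambda>i. g m (t i m)) (\<lambda>i. restrict0 (F m) (\<lambda>x. \<phi> i m (f m x)))"
    using b'(1) F[OF m] unfolding dual_bases_def by (intro conjI ballI)
next
  fix W' \<sigma> assume W': "open W'" "W' \<subseteq> W" and \<sigma>: "\<forall>m\<in>W'. \<sigma> m \<in> F m"
  have \<sigma>F: "\<sigma> m \<in> F m" if "m \<in> W'" for m using \<sigma> that by blast
  have f\<sigma>: "f m (\<sigma> m) \<in> G m" if "m \<in> W'" for m
    using linear_from_toD(1)[OF f \<sigma>F[OF that]] that W'(2) by blast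
  have e: "\<phi> i m (f m (\<sigma> m)) = restrict0 (F m) (\<lambda>x. \<phi> i m (f m x)) (\<sigma> m)" if "m \<in> W'" for i m
    by (simp add: restrict0_in \<sigma>F[OF that])
  have "smooth_fun A W' (\<lambda>m. \<phi> i m (f m (\<sigma> m))) \<longleftrightarrow>
      smooth_fun A W' (\<lambda>m. restrict0 (F m) (\<lambda>x. \<phi> i m (f m x)) (\<sigma> m))" for i
    by (rule iffI; rule smooth_fun_cong[OF W'(1)]) (auto simp: e)
  moreover have "P W' \<sigma> \<longleftrightarrow> Q W' (\<lambda>m. f m (\<sigma> m))" by (rule PQ[OF W' \<sigma>F])
  moreover have "Q W' (\<lambda>m. f m (\<sigma> m)) \<longleftrightarrow> (\<forall>i\<in>I. smooth_fun A W' (\<lambda>m. \<phi> i m (f m (\<sigma> m))))"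
    by (rule coframeD(4)[OF c W' f\<sigma>])
  ultimately show "P W' \<sigma> \<longleftrightarrow>
      (\<forall>i\<in>I. smooth_fun A W' (\<lambda>m. restrict0 (F m) (\<lambda>x. \<phi> i m (f m x)) (\<sigma> m)))"
    by simp
qed

lemma smooth_proj_section:
  assumes D: "DVB_sequence A S"
  obtains W s where "open W" "m \<in> W" "\<And>x. x \<in> W \<Longrightarrow> linear_from_to (fibre (core S) x) (fibre (total S) x) (s x)"
    "\<And>x. x \<in> W \<Longrightarrow> \<forall>y\<in>fibre (core S) x. proj S x (s x y) = y"
    "\<And>W' \<sigma>. open W' \<Longrightarrow> W' \<subseteq> W \<Longrightarrow> smooth_section A (core S) W' \<sigma> \<Longrightarrow>
      smooth_section A (total S) W' (\<lambda>x. s x (\<sigma> x))"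
proof (rule surjective_bundle_map_local_splitting[OF DVB_sequenceD(3,4,6,9)[OF D], of m])
  fix W s assume s: "open W" "m \<in> W" "\<And>x. x \<in> W \<Longrightarrow> linear_from_to (fibre (core S) x) (fibre (total S) x) (s x)"
    "\<And>x y. x \<in> W \<Longrightarrow> y \<in> fibre (core S) x \<Longrightarrow> proj S x (s x y) = y"
    "\<And>W' \<sigma>. open W' \<Longrightarrow> W' \<subseteq> W \<Longrightarrow> smooth_section A (core S) W' \<sigma> \<Longrightarrow>
      smooth_section A (total S) W' (\<lambda>x. s x (\<sigma> x))"
  show thesis by (rule that[OF s(1-3) ballI[OF s(4)] s(5)])
qed

lemma proj_section:
  assumes D: "DVB_sequence A S"
  obtains s where "linear_from_to (fibre (core S) m) (fibre (total S) m) s"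
    "\<forall>y\<in>fibre (core S) m. proj S m (s y) = y"
proof (rule smooth_proj_section[OF D, of m])
  fix W s assume "m \<in> W" "\<And>x. x \<in> W \<Longrightarrow> linear_from_to (fibre (core S) x) (fibre (total S) x) (s x)"
    "\<And>x. x \<in> W \<Longrightarrow> \<forall>y\<in>fibre (core S) x. proj S x (s x y) = y"
  then show thesis by (intro that[of "s m"])
qed

lemma tensor_part:
  assumes D: "DVB_sequence A S"
    and s: "linear_from_to (fibre (core S) m) (fibre (total S) m) s"
    and js: "\<forall>y\<in>fibre (core S) m. proj S m (s y) = y"
  shows tensor_part_in: "\<sigma> \<in> fibre (total S) m \<Longrightarrow>
      tensor_part S m s \<sigma> \<in> tensor_space (fibre (side1 S) m) (fibre (side2 S) m)"
    and incl_tensor_part: "\<sigma> \<in> fibre (total S) m \<Longrightarrow> incl S m (tensor_part S m s \<sigma>) = \<sigma> - s (proj S m \<sigma>)"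
    and tensor_part_incl: "\<theta> \<in> tensor_space (fibre (side1 S) m) (fibre (side2 S) m) \<Longrightarrow>
      tensor_part S m s (incl S m \<theta>) = \<theta>"
    and tensor_part_section: "y \<in> fibre (core S) m \<Longrightarrow> tensor_part S m s (s y) = 0"
    and tensor_part_linear: "linear_from_to (fibre (total S) m)
      (tensor_space (fibre (side1 S) m) (fibre (side2 S) m)) (tensor_part S m s)"
proof -
  note d = DVB_sequenceD[OF D]
  let ?T = "tensor_space (fibre (side1 S) m) (fibre (side2 S) m)" and ?P = "fibre (total S) m"
  have subP: "subspace ?P" and subK: "subspace (fibre (core S) m)"
    by (rule vector_bundle_subspace[OF d(3)], rule vector_bundle_subspace[OF d(4)])
  have ker: "\<sigma> - s (proj S m \<sigma>) \<in> incl S m ` ?T" if "\<sigma> \<in> ?P" for \<sigma>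
  proof -
    have j\<sigma>: "proj S m \<sigma> \<in> fibre (core S) m" by (rule linear_from_toD(1)[OF d(11) that])
    have sj: "s (proj S m \<sigma>) \<in> ?P" by (rule linear_from_toD(1)[OF s j\<sigma>])
    have "proj S m (\<sigma> - s (proj S m \<sigma>)) = 0"
      using linear_from_to_diff[OF d(11) subP that sj] bspec[OF js j\<sigma>] by simp
    then show ?thesis unfolding d(8) using subspace_diff[OF subP that sj] by simp
  qed
  show in_T: "tensor_part S m s \<sigma> \<in> ?T" if "\<sigma> \<in> ?P" for \<sigma>
    unfolding tensor_part_def by (rule inv_into_into[OF ker[OF that]])
  show incl_part: "incl S m (tensor_part S m s \<sigma>) = \<sigma> - s (proj S m \<sigma>)" if "\<sigma> \<in> ?P" for \<sigma>
    unfolding tensor_part_def by (rule f_inv_into_f[OF ker[OF that]])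
  have s0: "s 0 = 0" by (rule linear_from_to_0[OF s subK])
  have part: "tensor_part S m s \<sigma> = \<theta>" if "\<sigma> \<in> ?P" "\<theta> \<in> ?T" "incl S m \<theta> = \<sigma> - s (proj S m \<sigma>)" for \<sigma> \<theta>
    using inj_onD[OF d(7) _ in_T[OF that(1)] that(2)] incl_part[OF that(1)] that(3) by simp
  show "tensor_part S m s (incl S m \<theta>) = \<theta>" if "\<theta> \<in> ?T" for \<theta>
    using DVB_sequence_incl[OF D that] s0 that by (intro part) auto
  show "tensor_part S m s (s y) = 0" if "y \<in> fibre (core S) m"
    using linear_from_toD(1)[OF s that] bspec[OF js that] linear_from_to_0[OF d(10) subspace_tensor_space]
    by (intro part) (auto simp: subspace_0[OF subspace_tensor_space])
  show "linear_from_to ?P ?T (tensor_part S m s)"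
    unfolding linear_from_to_def
  proof (intro conjI ballI allI)
    fix \<sigma> assume \<sigma>: "\<sigma> \<in> ?P"
    note j\<sigma> = linear_from_toD(1)[OF d(11) \<sigma>]
    show "tensor_part S m s \<sigma> \<in> ?T" by (rule in_T[OF \<sigma>])
    show "tensor_part S m s (c *\<^sub>R \<sigma>) = c *\<^sub>R tensor_part S m s \<sigma>" for c
    proof (rule part)
      show "c *\<^sub>R \<sigma> \<in> ?P" by (rule subspace_scale[OF subP \<sigma>])
      show "c *\<^sub>R tensor_part S m s \<sigma> \<in> ?T" by (rule subspace_scale[OF subspace_tensor_space in_T[OF \<sigma>]])
      show "incl S m (c *\<^sub>R tensor_part S m s \<sigma>) = c *\<^sub>R \<sigma> - s (proj S m (c *\<^sub>R \<sigma>))"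
        using linear_from_toD(3)[OF d(10) in_T[OF \<sigma>]] incl_part[OF \<sigma>]
          linear_from_toD(3)[OF d(11) \<sigma>] linear_from_toD(3)[OF s j\<sigma>] by (simp add: algebra_simps)
    qed
    fix \<sigma>' assume \<sigma>': "\<sigma>' \<in> ?P"
    note j\<sigma>' = linear_from_toD(1)[OF d(11) \<sigma>']
    show "tensor_part S m s (\<sigma> + \<sigma>') = tensor_part S m s \<sigma> + tensor_part S m s \<sigma>'"
    proof (rule part)
      show "\<sigma> + \<sigma>' \<in> ?P" by (rule subspace_add[OF subP \<sigma> \<sigma>'])
      show "tensor_part S m s \<sigma> + tensor_part S m s \<sigma>' \<in> ?T"
        by (rule subspace_add[OF subspace_tensor_space in_T[OF \<sigma>] in_T[OF \<sigma>']])
      show "incl S m (tensor_part S m s \<sigma> + tensor_part S m s \<sigma>') = \<sigma> + \<sigma>' - s (proj S m (\<sigma> + \<sigma>'))"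
        using linear_from_toD(2)[OF d(10) in_T[OF \<sigma>] in_T[OF \<sigma>']] incl_part[OF \<sigma>] incl_part[OF \<sigma>']
          linear_from_toD(2)[OF d(11) \<sigma> \<sigma>'] linear_from_toD(2)[OF s j\<sigma> j\<sigma>'] by (simp add: algebra_simps)
    qed
  qed
qed

lemma smooth_tensor_part:
  assumes D: "DVB_sequence A S" and W: "open W"
    and s: "\<And>x. x \<in> W \<Longrightarrow> linear_from_to (fibre (core S) x) (fibre (total S) x) (s x)"
    and js: "\<And>x. x \<in> W \<Longrightarrow> \<forall>y\<in>fibre (core S) x. proj S x (s x y) = y"
    and smooth: "\<And>\<sigma>. smooth_section A (core S) W \<sigma> \<Longrightarrow> smooth_section A (total S) W (\<lambda>x. s x (\<sigma> x))"
    and \<sigma>: "smooth_section A (total S) W \<sigma>"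
  shows "smooth_section A (tensor_bundle A (side1 S) (side2 S)) W (\<lambda>x. tensor_part S x (s x) (\<sigma> x))"
proof -
  note d = DVB_sequenceD[OF D]
  note \<sigma>P = smooth_section_fibre[OF \<sigma>]
  have "smooth_section A (total S) W (\<lambda>x. \<sigma> x - s x (proj S x (\<sigma> x)))"
    by (rule smooth_section_diff[OF d(3) W \<sigma> smooth[OF bundle_mapD(2)[OF d(6) W \<sigma>]]])
  then have *: "smooth_section A (total S) W (\<lambda>x. incl S x (tensor_part S x (s x) (\<sigma> x)))"
  proof (rule smooth_section_cong)
    show "\<sigma> x - s x (proj S x (\<sigma> x)) = incl S x (tensor_part S x (s x) (\<sigma> x))" if "x \<in> W" for x
      using incl_tensor_part[OF D s[OF that] js[OF that] \<sigma>P[OF that]] by simp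
  qed
  show ?thesis
  proof (rule injective_bundle_map_reflects_smooth[OF vector_bundle_tensor[OF d(1,2)] d(3) d(5)])
    show "open W" by (rule W)
    show "smooth_section A (total S) W (\<lambda>x. incl S x (tensor_part S x (s x) (\<sigma> x)))" by (rule *)
    show "inj_on (incl S x) (fibre (tensor_bundle A (side1 S) (side2 S)) x)" for x
      using d(7) by simp
    show "tensor_part S x (s x) (\<sigma> x) \<in> fibre (tensor_bundle A (side1 S) (side2 S)) x" if "x \<in> W" for x
      using tensor_part_in[OF D s[OF that] js[OF that] \<sigma>P[OF that]] by simp
  qed
qed

lemma contract_0_left: "finite_dim X \<Longrightarrow> \<theta> \<in> tensor_space X Y \<Longrightarrow> contract X 0 \<theta> = 0"
  by (rule linear_from_to_0[OF contract_linear_left subspace_dual_space])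

lemma contract_0_right:
  assumes "finite_dim X" "\<beta> \<in> dual_space Y"
  shows "contract X \<beta> 0 = 0"
  by (rule linear_from_to_0[OF contract_linear_right[OF assms] subspace_tensor_space])

lemma dual_total_memD:
  assumes "e \<in> fibre (dual_total A S) m"
  shows "fst e \<in> hom_space (fibre (total S) m) (fibre (side1 S) m)"
    "snd e \<in> dual_space (fibre (side2 S) m)"
    "\<theta> \<in> tensor_space (fibre (side1 S) m) (fibre (side2 S) m) \<Longrightarrow>
       fst e (incl S m \<theta>) = contract (fibre (side1 S) m) (snd e) \<theta>"
    "linear_from_to (fibre (total S) m) (fibre (side1 S) m) (fst e)"
  using assms hom_spaceD unfolding fibre_dual_total by auto

lemma subspace_dual_total:
  assumes D: "DVB_sequence A S"
  shows "subspace (fibre (dual_total A S) m)"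
proof -
  note d = DVB_sequenceD[OF D]
  note fin = vector_bundle_finite_dim[OF d(1)]
  have subH: "subspace (hom_space (fibre (total S) m) (fibre (side1 S) m))"
    by (rule subspace_hom_space[OF finite_dim_subspace[OF fin]])
  show ?thesis
    unfolding subspace_def
  proof (intro conjI ballI allI)
    show "0 \<in> fibre (dual_total A S) m"
      using subspace_0[OF subH]
      by (simp add: fibre_dual_total zero_prod_def subspace_0[OF subspace_dual_space] contract_0_left[OF fin])
  next
    fix e e' assume e: "e \<in> fibre (dual_total A S) m" and e': "e' \<in> fibre (dual_total A S) m"
    note l = linear_from_toD(2)[OF contract_linear_left[OF fin] dual_total_memD(2)[OF e] dual_total_memD(2)[OF e']]
    have "fst e + fst e' \<in> hom_space (fibre (total S) m) (fibre (side1 S) m)"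
      by (rule subspace_add[OF subH dual_total_memD(1)[OF e] dual_total_memD(1)[OF e']])
    moreover have "snd e + snd e' \<in> dual_space (fibre (side2 S) m)"
      by (rule subspace_add[OF subspace_dual_space dual_total_memD(2)[OF e] dual_total_memD(2)[OF e']])
    ultimately show "e + e' \<in> fibre (dual_total A S) m"
      using dual_total_memD(3)[OF e] dual_total_memD(3)[OF e'] l by (simp add: fibre_dual_total plus_prod_def)
  next
    fix c e assume e: "e \<in> fibre (dual_total A S) m"
    note l = linear_from_toD(3)[OF contract_linear_left[OF fin] dual_total_memD(2)[OF e]]
    have "c *\<^sub>R fst e \<in> hom_space (fibre (total S) m) (fibre (side1 S) m)"
      by (rule subspace_scale[OF subH dual_total_memD(1)[OF e]])
    moreover have "c *\<^sub>R snd e \<in> dual_space (fibre (side2 S) m)"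
      by (rule subspace_scale[OF subspace_dual_space dual_total_memD(2)[OF e]])
    moreover have "(c *\<^sub>R fst e) x = c *\<^sub>R fst e x" for x by (simp add: scaleR_fun_def)
    ultimately show "c *\<^sub>R e \<in> fibre (dual_total A S) m"
      using dual_total_memD(3)[OF e] l by (simp add: fibre_dual_total scaleR_prod_def)
  qed
qed

lemma dual_element:
  assumes D: "DVB_sequence A S"
    and s: "linear_from_to (fibre (core S) m) (fibre (total S) m) s"
    and js: "\<forall>y\<in>fibre (core S) m. proj S m (s y) = y"
  shows dual_element_in: "h \<in> hom_space (fibre (core S) m) (fibre (side1 S) m) \<Longrightarrow>
      \<beta> \<in> dual_space (fibre (side2 S) m) \<Longrightarrow> dual_element S m s (h, \<beta>) \<in> fibre (dual_total A S) m"
    and dual_element_section: "h \<in> hom_space (fibre (core S) m) (fibre (side1 S) m) \<Longrightarrow>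
      \<beta> \<in> dual_space (fibre (side2 S) m) \<Longrightarrow>
      restrict0 (fibre (core S) m) (\<lambda>y. fst (dual_element S m s (h, \<beta>)) (s y)) = h"
    and dual_total_decomp: "e \<in> fibre (dual_total A S) m \<Longrightarrow> \<sigma> \<in> fibre (total S) m \<Longrightarrow>
      fst e \<sigma> = fst e (s (proj S m \<sigma>)) + contract (fibre (side1 S) m) (snd e) (tensor_part S m s \<sigma>)"
    and dual_element_restrict: "e \<in> fibre (dual_total A S) m \<Longrightarrow>
      dual_element S m s (restrict0 (fibre (core S) m) (\<lambda>y. fst e (s y)), snd e) = e"
proof -
  note d = DVB_sequenceD[OF D]
  note p = tensor_part[OF D s js]
  note fin = vector_bundle_finite_dim[OF d(1)]
  have subP: "subspace (fibre (total S) m)" and subK: "subspace (fibre (core S) m)"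
    and subU: "subspace (fibre (side1 S) m)"
    by (rule vector_bundle_subspace[OF d(3)], rule vector_bundle_subspace[OF d(4)],
        rule vector_bundle_subspace[OF d(1)])
  show "dual_element S m s (h, \<beta>) \<in> fibre (dual_total A S) m"
    if h: "h \<in> hom_space (fibre (core S) m) (fibre (side1 S) m)" and \<beta>: "\<beta> \<in> dual_space (fibre (side2 S) m)"
    for h \<beta>
  proof -
    have l1: "linear_from_to (fibre (total S) m) (fibre (side1 S) m) (\<lambda>\<sigma>. h (proj S m \<sigma>))"
      by (rule linear_from_to_comp[OF d(11) hom_spaceD[OF h]])
    have l2: "linear_from_to (fibre (total S) m) (fibre (side1 S) m)
        (\<lambda>\<sigma>. contract (fibre (side1 S) m) \<beta> (tensor_part S m s \<sigma>))"
      by (rule linear_from_to_comp[OF p(5) contract_linear_right[OF fin \<beta>]])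
    have "linear_from_to (fibre (total S) m) (fibre (side1 S) m)
        (\<lambda>\<sigma>. h (proj S m \<sigma>) + contract (fibre (side1 S) m) \<beta> (tensor_part S m s \<sigma>))"
      using linear_from_toD[OF l1] linear_from_toD[OF l2] subspace_add[OF subU]
      by (auto simp: linear_from_to_def algebra_simps)
    from restrict0_hom_space[OF this subP]
    have "fst (dual_element S m s (h, \<beta>)) \<in> hom_space (fibre (total S) m) (fibre (side1 S) m)"
      by (simp add: dual_element_def)
    moreover have "fst (dual_element S m s (h, \<beta>)) (incl S m \<theta>) = contract (fibre (side1 S) m) \<beta> \<theta>"
      if "\<theta> \<in> tensor_space (fibre (side1 S) m) (fibre (side2 S) m)" for \<theta>
      using DVB_sequence_incl[OF D that] p(3)[OF that] linear_from_to_0[OF hom_spaceD[OF h] subK]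
      by (simp add: dual_element_def restrict0_in)
    moreover have "snd (dual_element S m s (h, \<beta>)) = \<beta>" by (simp add: dual_element_def)
    ultimately show ?thesis using \<beta> by (simp add: fibre_dual_total case_prod_beta)
  qed
  show "restrict0 (fibre (core S) m) (\<lambda>y. fst (dual_element S m s (h, \<beta>)) (s y)) = h"
    if h: "h \<in> hom_space (fibre (core S) m) (fibre (side1 S) m)" and \<beta>: "\<beta> \<in> dual_space (fibre (side2 S) m)"
    for h \<beta>
  proof
    fix y
    show "restrict0 (fibre (core S) m) (\<lambda>y. fst (dual_element S m s (h, \<beta>)) (s y)) y = h y"
    proof (cases "y \<in> fibre (core S) m")
      case True
      then show ?thesis
        using linear_from_toD(1)[OF s True] bspec[OF js True] p(4)[OF True] contract_0_right[OF fin \<beta>]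
        by (simp add: dual_element_def restrict0_in)
    next
      case False
      then show ?thesis using h by (simp add: restrict0_def hom_space_def)
    qed
  qed
  show decomp: "fst e \<sigma> = fst e (s (proj S m \<sigma>)) + contract (fibre (side1 S) m) (snd e) (tensor_part S m s \<sigma>)"
    if e: "e \<in> fibre (dual_total A S) m" and \<sigma>: "\<sigma> \<in> fibre (total S) m" for e \<sigma>
  proof -
    have sj: "s (proj S m \<sigma>) \<in> fibre (total S) m"
      by (rule linear_from_toD(1)[OF s linear_from_toD(1)[OF d(11) \<sigma>]])
    have "contract (fibre (side1 S) m) (snd e) (tensor_part S m s \<sigma>) = fst e (\<sigma> - s (proj S m \<sigma>))"
      using dual_total_memD(3)[OF e p(1)[OF \<sigma>]] p(2)[OF \<sigma>] by simp
    then show ?thesis using linear_from_to_diff[OF dual_total_memD(4)[OF e] subP \<sigma> sj] by simp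
  qed
  show "dual_element S m s (restrict0 (fibre (core S) m) (\<lambda>y. fst e (s y)), snd e) = e"
    if e: "e \<in> fibre (dual_total A S) m" for e
  proof (rule prod_eqI)
    show "fst (dual_element S m s (restrict0 (fibre (core S) m) (\<lambda>y. fst e (s y)), snd e)) = fst e"
    proof
      fix \<sigma>
      show "fst (dual_element S m s (restrict0 (fibre (core S) m) (\<lambda>y. fst e (s y)), snd e)) \<sigma> = fst e \<sigma>"
      proof (cases "\<sigma> \<in> fibre (total S) m")
        case True
        then show ?thesis
          using decomp[OF e True] linear_from_toD(1)[OF d(11) True] by (simp add: dual_element_def restrict0_in)
      next
        case False
        then show ?thesis
          using dual_total_memD(1)[OF e] by (simp add: dual_element_def restrict0_def hom_space_def)
      qed
    qed
  qed (simp add: dual_element_def)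
qed

text \<open>Near every point, a smooth section \<open>s\<close> of \<open>j\<close> makes the total space of the dual isomorphic to
  \<open>Hom(K, U) \<oplus> V\<^sup>*\<close>.\<close>

lemma coframe_dual_total:
  assumes D: "DVB_sequence A S"
  shows "\<exists>W (I::nat set) t \<phi>. m \<in> W \<and> coframe A (fibre (dual_total A S))
    (\<lambda>W s. smooth_section A (hom_bundle A (total S) (side1 S)) W (\<lambda>m. fst (s m)) \<and>
        smooth_section A (dual_bundle A (side2 S)) W (\<lambda>m. snd (s m))) W I t \<phi>"
proof -
  note d = DVB_sequenceD[OF D]
  note fin = vector_bundle_finite_dim[OF d(1)]
  obtain W s where W: "open W" "m \<in> W"
    and s: "\<And>x. x \<in> W \<Longrightarrow> linear_from_to (fibre (core S) x) (fibre (total S) x) (s x)"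
    and js: "\<And>x. x \<in> W \<Longrightarrow> \<forall>y\<in>fibre (core S) x. proj S x (s x y) = y"
    and ss: "\<And>W' \<sigma>. open W' \<Longrightarrow> W' \<subseteq> W \<Longrightarrow> smooth_section A (core S) W' \<sigma> \<Longrightarrow>
      smooth_section A (total S) W' (\<lambda>x. s x (\<sigma> x))"
    using smooth_proj_section[OF D, of m] by blast
  note H = vector_bundle_hom[OF d(4,1)] and V' = vector_bundle_dual[OF d(2)]
  obtain W1 and I :: "nat set" and t \<phi> where W1: "m \<in> W1"
    and c: "coframe A (fibre (hom_bundle A (core S) (side1 S))) (smooth_section A (hom_bundle A (core S) (side1 S))) W1 I t \<phi>"
    using vector_bundle_coframe[OF H] .
  obtain W2 and J :: "nat set" and u \<psi> where W2: "m \<in> W2"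
    and c': "coframe A (fibre (dual_bundle A (side2 S))) (smooth_section A (dual_bundle A (side2 S))) W2 J u \<psi>"
    using vector_bundle_coframe[OF V'] .
  define N where "N = W \<inter> W1 \<inter> W2"
  have N: "open N" "m \<in> N" "N \<subseteq> W" "N \<subseteq> W1" "N \<subseteq> W2"
    using W W1 W2 coframeD(1)[OF c] coframeD(1)[OF c'] by (auto simp: N_def)
  have sN: "linear_from_to (fibre (core S) x) (fibre (total S) x) (s x)"
    and jsN: "\<forall>y\<in>fibre (core S) x. proj S x (s x y) = y" if "x \<in> N" for x
    using s js that N(3) by auto
  define f where "f = (\<lambda>x (e :: ('d \<Rightarrow> 'a) \<times> ('c \<Rightarrow> real)). (restrict0 (fibre (core S) x) (\<lambda>y. fst e (s x y)), snd e))"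
  have cf: "coframe A (fibre (dual_total A S))
    (\<lambda>W s. smooth_section A (hom_bundle A (total S) (side1 S)) W (\<lambda>m. fst (s m)) \<and>
        smooth_section A (dual_bundle A (side2 S)) W (\<lambda>m. snd (s m))) N (Inl ` I \<union> Inr ` J)
    (\<lambda>i x. dual_element S x (s x) (case_sum (\<lambda>i. (t i x, 0)) (\<lambda>j. (0, u j x)) i))
    (\<lambda>i x. restrict0 (fibre (dual_total A S) x) (\<lambda>e. case_sum
      (\<lambda>i. restrict0 (fibre (hom_bundle A (core S) (side1 S)) x \<times> fibre (dual_bundle A (side2 S)) x) (\<lambda>(y, z). \<phi> i x y))
      (\<lambda>j. restrict0 (fibre (hom_bundle A (core S) (side1 S)) x \<times> fibre (dual_bundle A (side2 S)) x) (\<lambda>(y, z). \<psi> j x z)) i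
      (f x e)))"
  proof (rule coframe_transport[OF coframe_prod[OF coframe_subset[OF c N(1,4)] coframe_subset[OF c' N(1,5)]]])
    fix x assume x: "x \<in> N"
    show "subspace (fibre (dual_total A S) x)" by (rule subspace_dual_total[OF D])
    show "linear_from_to (fibre (dual_total A S) x)
        (fibre (hom_bundle A (core S) (side1 S)) x \<times> fibre (dual_bundle A (side2 S)) x) (f x)"
      unfolding linear_from_to_def
    proof (intro conjI ballI allI)
      fix e assume e: "e \<in> fibre (dual_total A S) x"
      have "restrict0 (fibre (core S) x) (\<lambda>y. fst e (s x y)) \<in> hom_space (fibre (core S) x) (fibre (side1 S) x)"
        by (rule restrict0_hom_space[OF linear_from_to_comp[OF sN[OF x] dual_total_memD(4)[OF e]]
              vector_bundle_subspace[OF d(4)]])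
      then show "f x e \<in> fibre (hom_bundle A (core S) (side1 S)) x \<times> fibre (dual_bundle A (side2 S)) x"
        using dual_total_memD(2)[OF e] by (simp add: f_def)
      show "f x (c *\<^sub>R e) = c *\<^sub>R f x e" for c
        by (auto simp: f_def restrict0_def fun_eq_iff scaleR_fun_def)
      show "f x (e + e') = f x e + f x e'" for e'
        by (auto simp: f_def restrict0_def fun_eq_iff)
    qed
    show "dual_element S x (s x) y \<in> fibre (dual_total A S) x"
      if "y \<in> fibre (hom_bundle A (core S) (side1 S)) x \<times> fibre (dual_bundle A (side2 S)) x" for y
      using dual_element_in[OF D sN[OF x] jsN[OF x], of "fst y" "snd y"] that by auto
    show "dual_element S x (s x) (f x e) = e" if "e \<in> fibre (dual_total A S) x" for e
      unfolding f_def by (rule dual_element_restrict[OF D sN[OF x] jsN[OF x] that])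
    show "f x (dual_element S x (s x) y) = y"
      if "y \<in> fibre (hom_bundle A (core S) (side1 S)) x \<times> fibre (dual_bundle A (side2 S)) x" for y
    proof -
      obtain h \<beta> where y: "y = (h, \<beta>)" by (cases y)
      show ?thesis
        using dual_element_section[OF D sN[OF x] jsN[OF x], of h \<beta>] that
        by (simp add: f_def y) (simp add: dual_element_def)
    qed
  next
    fix V e assume V: "open V" "V \<subseteq> N" and e: "\<And>x. x \<in> V \<Longrightarrow> e x \<in> fibre (dual_total A S) x"
    have VW: "V \<subseteq> W" using V(2) N(3) by blast
    have "smooth_section A (hom_bundle A (total S) (side1 S)) V (\<lambda>x. fst (e x)) \<longleftrightarrow>
        smooth_section A (hom_bundle A (core S) (side1 S)) V (\<lambda>x. fst (f x (e x)))"
      if \<beta>: "smooth_section A (dual_bundle A (side2 S)) V (\<lambda>x. snd (e x))"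
    proof
      assume hom: "smooth_section A (hom_bundle A (total S) (side1 S)) V (\<lambda>x. fst (e x))"
      have "smooth_section A (side1 S) V' (\<lambda>x. fst (f x (e x)) (\<sigma> x))"
        if V': "open V'" "V' \<subseteq> V" and \<sigma>: "smooth_section A (core S) V' \<sigma>" for V' \<sigma>
      proof (rule smooth_section_cong)
        show "smooth_section A (side1 S) V' (\<lambda>x. fst (e x) (s x (\<sigma> x)))"
        proof (rule smooth_section_apply[OF d(3,1) V'(1)])
          show "smooth_section A (hom_bundle A (total S) (side1 S)) V' (\<lambda>x. fst (e x))"
            by (rule smooth_section_subset[OF vector_bundle_hom[OF d(3,1)] V(1) V' hom])
          show "smooth_section A (total S) V' (\<lambda>x. s x (\<sigma> x))"
            by (rule ss[OF V'(1) _ \<sigma>]) (use V'(2) VW in blast)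
        qed
        show "fst (e x) (s x (\<sigma> x)) = fst (f x (e x)) (\<sigma> x)" if "x \<in> V'" for x
          using smooth_section_fibre[OF \<sigma> that] by (simp add: f_def restrict0_in)
      qed
      moreover have "fst (f x (e x)) \<in> hom_space (fibre (core S) x) (fibre (side1 S) x)" if "x \<in> V" for x
        using that V(2) unfolding f_def fst_conv
        by (intro restrict0_hom_space[OF linear_from_to_comp[OF sN dual_total_memD(4)[OF e]]
              vector_bundle_subspace[OF d(4)]]) auto
      ultimately show "smooth_section A (hom_bundle A (core S) (side1 S)) V (\<lambda>x. fst (f x (e x)))"
        unfolding smooth_section_hom[OF d(4,1) V(1)] by simp
    next
      assume hom: "smooth_section A (hom_bundle A (core S) (side1 S)) V (\<lambda>x. fst (f x (e x)))"
      have "smooth_section A (side1 S) V' (\<lambda>x. fst (e x) (\<sigma> x))"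
        if V': "open V'" "V' \<subseteq> V" and \<sigma>: "smooth_section A (total S) V' \<sigma>" for V' \<sigma>
      proof (rule smooth_section_cong)
        have xN: "x \<in> N" if "x \<in> V'" for x using that V' V by blast
        have V'W: "V' \<subseteq> W" using V' VW by blast
        have part: "smooth_section A (tensor_bundle A (side1 S) (side2 S)) V' (\<lambda>x. tensor_part S x (s x) (\<sigma> x))"
          by (rule smooth_tensor_part[OF D V'(1) sN[OF xN] jsN[OF xN] ss[OF V'(1) V'W] \<sigma>])
        show "smooth_section A (side1 S) V' (\<lambda>x. fst (f x (e x)) (proj S x (\<sigma> x)) +
            contract (fibre (side1 S) x) (snd (e x)) (tensor_part S x (s x) (\<sigma> x)))"
        proof (rule smooth_section_add[OF d(1) V'(1)])
          show "smooth_section A (side1 S) V' (\<lambda>x. fst (f x (e x)) (proj S x (\<sigma> x)))"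
            by (rule smooth_section_apply[OF d(4,1) V'(1) smooth_section_subset[OF H V(1) V' hom]
                  bundle_mapD(2)[OF d(6) V'(1) \<sigma>]])
          show "smooth_section A (side1 S) V' (\<lambda>x.
              contract (fibre (side1 S) x) (snd (e x)) (tensor_part S x (s x) (\<sigma> x)))"
            by (rule smooth_section_contract[OF d(1,2) V'(1) part smooth_section_subset[OF
                  vector_bundle_dual[OF d(2)] V(1) V' \<beta>]])
        qed
        fix x assume x: "x \<in> V'"
        have ex: "e x \<in> fibre (dual_total A S) x" using e x V'(2) by blast
        show "fst (f x (e x)) (proj S x (\<sigma> x)) +
            contract (fibre (side1 S) x) (snd (e x)) (tensor_part S x (s x) (\<sigma> x)) = fst (e x) (\<sigma> x)"
          using dual_total_decomp[OF D sN[OF xN[OF x]] jsN[OF xN[OF x]] ex smooth_section_fibre[OF \<sigma> x]]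
            linear_from_toD(1)[OF d(11) smooth_section_fibre[OF \<sigma> x]] by (simp add: f_def restrict0_in)
      qed
      then show "smooth_section A (hom_bundle A (total S) (side1 S)) V (\<lambda>x. fst (e x))"
        unfolding smooth_section_hom[OF d(3,1) V(1)] using dual_total_memD(1)[OF e] by simp
    qed
    moreover have "(\<lambda>x. snd (f x (e x))) = (\<lambda>x. snd (e x))" by (simp add: f_def)
    ultimately show "smooth_section A (hom_bundle A (total S) (side1 S)) V (\<lambda>m. fst (e m)) \<and>
        smooth_section A (dual_bundle A (side2 S)) V (\<lambda>m. snd (e m)) \<longleftrightarrow>
      smooth_section A (hom_bundle A (core S) (side1 S)) V (\<lambda>m. fst (f m (e m))) \<and>
        smooth_section A (dual_bundle A (side2 S)) V (\<lambda>m. snd (f m (e m)))"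
      by auto
  qed
  show ?thesis
    by (rule coframe_exists_nat[OF cf], intro exI conjI, rule N(2), assumption)
qed

lemma locally_trivial_dual_total:
  assumes D: "DVB_sequence A S"
  shows "locally_trivial A (fibre (dual_total A S))
    (\<lambda>W s. smooth_section A (hom_bundle A (total S) (side1 S)) W (\<lambda>m. fst (s m)) \<and>
        smooth_section A (dual_bundle A (side2 S)) W (\<lambda>m. snd (s m)))"
  unfolding locally_trivial_def
proof (intro conjI allI impI; (elim conjE)?)
  note d = DVB_sequenceD[OF D]
  note H = vector_bundle_hom[OF d(3,1)] and V' = vector_bundle_dual[OF d(2)]
  {
    fix W W' e assume W: "open W" "open W'" "W' \<subseteq> W"
      and e: "smooth_section A (hom_bundle A (total S) (side1 S)) W (\<lambda>m. fst (e m))"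
        "smooth_section A (dual_bundle A (side2 S)) W (\<lambda>m. snd (e m))"
    show "smooth_section A (hom_bundle A (total S) (side1 S)) W' (\<lambda>m. fst (e m))"
      by (rule smooth_section_subset[OF H W e(1)])
    show "smooth_section A (dual_bundle A (side2 S)) W' (\<lambda>m. snd (e m))"
      by (rule smooth_section_subset[OF V' W e(2)])
  next
    fix W e assume W: "open W" and e: "\<forall>m\<in>W. e m \<in> fibre (dual_total A S) m"
      and loc: "\<forall>m\<in>W. \<exists>W'. open W' \<and> m \<in> W' \<and> W' \<subseteq> W \<and>
        smooth_section A (hom_bundle A (total S) (side1 S)) W' (\<lambda>m. fst (e m)) \<and>
        smooth_section A (dual_bundle A (side2 S)) W' (\<lambda>m. snd (e m))"
    show "smooth_section A (hom_bundle A (total S) (side1 S)) W (\<lambda>m. fst (e m))"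
    proof (rule smooth_section_local[OF H W])
      show "fst (e m) \<in> fibre (hom_bundle A (total S) (side1 S)) m" if "m \<in> W" for m
        using dual_total_memD(1)[OF bspec[OF e that]] by simp
    qed (use loc in blast)
    show "smooth_section A (dual_bundle A (side2 S)) W (\<lambda>m. snd (e m))"
    proof (rule smooth_section_local[OF V' W])
      show "snd (e m) \<in> fibre (dual_bundle A (side2 S)) m" if "m \<in> W" for m
        using dual_total_memD(2)[OF bspec[OF e that]] by simp
    qed (use loc in blast)
  }
  show "\<exists>W (I::nat set) t \<phi>. m \<in> W \<and> coframe A (fibre (dual_total A S))
    (\<lambda>W s. smooth_section A (hom_bundle A (total S) (side1 S)) W (\<lambda>m. fst (s m)) \<and>
        smooth_section A (dual_bundle A (side2 S)) W (\<lambda>m. snd (s m))) W I t \<phi>" for m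
    by (rule coframe_dual_total[OF D])
qed

lemma dual_total_eq:
  "dual_total A S = bundle_of_sections (fibre (dual_total A S))
    (\<lambda>W s. smooth_section A (hom_bundle A (total S) (side1 S)) W (\<lambda>m. fst (s m)) \<and>
        smooth_section A (dual_bundle A (side2 S)) W (\<lambda>m. snd (s m)))"
  by (simp add: dual_total_def bundle_of_sections_def)

lemma vector_bundle_dual_total: "DVB_sequence A S \<Longrightarrow> vector_bundle A (dual_total A S)"
  by (subst dual_total_eq) (rule vector_bundle_of_sections[OF locally_trivial_dual_total])

lemma smooth_section_dual_total:
  assumes "DVB_sequence A S" "open W"
  shows "smooth_section A (dual_total A S) W e \<longleftrightarrow> (\<forall>m\<in>W. e m \<in> fibre (dual_total A S) m) \<and>
    smooth_section A (hom_bundle A (total S) (side1 S)) W (\<lambda>m. fst (e m)) \<and>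
    smooth_section A (dual_bundle A (side2 S)) W (\<lambda>m. snd (e m))"
  by (subst dual_total_eq)
    (rule smooth_section_of_sections[OF locally_trivial_dual_total[OF assms(1)] assms(2)])

end

section \<open>Operations on sequences\<close>

lemma side_dual_sel [simp]:
  "side1 (side_dual A S) = side1 S" "side2 (side_dual A S) = dual_bundle A (core S)"
  "total (side_dual A S) = dual_total A S" "core (side_dual A S) = dual_bundle A (side2 S)"
  "proj (side_dual A S) = (\<lambda>m. snd)"
  by (simp_all add: side_dual_def fun_eq_iff)

lemma incl_side_dual:
  "incl (side_dual A S) = (\<lambda>m \<kappa>. (restrict0 (fibre (total S) m)
        (\<lambda>\<sigma>. contract (fibre (side1 S) m) (bidual_embed (fibre (core S) m) (proj S m \<sigma>)) \<kappa>), 0))"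
  by (simp add: side_dual_def)

lemma flip_sides_sel [simp]:
  "side1 (flip_sides S) = side2 S" "side2 (flip_sides S) = side1 S" "total (flip_sides S) = total S"
  "core (flip_sides S) = core S" "proj (flip_sides S) = proj S"
  "incl (flip_sides S) = (\<lambda>m \<theta>. incl S m (flip \<theta>))"
  by (simp_all add: flip_sides_def)

lemma transposition_sel [simp]:
  "side1 (transposition S) = side2 S" "side2 (transposition S) = side1 S"
  "total (transposition S) = total S" "core (transposition S) = core S"
  "proj (transposition S) = proj S" "incl (transposition S) = (\<lambda>m \<theta>. - incl S m (flip \<theta>))"
  by (simp_all add: transposition_def)

text \<open>The pull-back of a functional on the bidual along the canonical map.\<close>

definition bidual_pullback :: "'a::real_vector set \<Rightarrow> ((('a \<Rightarrow> real) \<Rightarrow> real) \<Rightarrow> real) \<Rightarrow> 'a \<Rightarrow> real" where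
  "bidual_pullback S \<alpha> = restrict0 S (\<lambda>x. \<alpha> (bidual_embed S x))"

text \<open>The tensor product of the canonical map \<open>S \<rightarrow> S\<^sup>*\<^sup>*\<close> with an identity.\<close>

definition tensor_bidual :: "'a::real_vector set \<Rightarrow> ('a, 'c) tensor \<Rightarrow> (('a \<Rightarrow> real) \<Rightarrow> real, 'c) tensor" where
  "tensor_bidual S \<theta> = restrict0 (dual_space (dual_space (dual_space S))) (\<lambda>\<alpha>. \<theta> (bidual_pullback S \<alpha>))"

lemma identify_bidual_sel [simp]:
  "side1 (identify_bidual V S) = V" "side2 (identify_bidual V S) = side2 S"
  "total (identify_bidual V S) = total S" "core (identify_bidual V S) = core S"
  "proj (identify_bidual V S) = proj S"
  "incl (identify_bidual V S) = (\<lambda>m \<theta>. incl S m (tensor_bidual (fibre V m) \<theta>))"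
  by (simp_all add: identify_bidual_def tensor_bidual_def bidual_pullback_def)

lemma bidual_pullback_in:
  assumes "subspace S" "\<alpha> \<in> dual_space (dual_space (dual_space S))"
  shows "bidual_pullback S \<alpha> \<in> dual_space S"
  unfolding bidual_pullback_def
  by (rule restrict0_dual_space[OF linear_from_to_comp[OF bidual_embed_linear dual_spaceD[OF assms(2)]] assms(1)])

lemma bidual_pullback_linear:
  assumes "subspace S"
  shows "linear_from_to (dual_space (dual_space (dual_space S))) (dual_space S) (bidual_pullback S)"
  unfolding linear_from_to_def
  by (intro conjI ballI allI bidual_pullback_in[OF assms])
    (auto simp: bidual_pullback_def restrict0_def fun_eq_iff scaleR_fun_def)

lemma bidual_pullback_embed:
  assumes "\<beta> \<in> dual_space S"
  shows "bidual_pullback S (bidual_embed (dual_space S) \<beta>) = \<beta>"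
proof
  fix x
  show "bidual_pullback S (bidual_embed (dual_space S) \<beta>) x = \<beta> x"
  proof (cases "x \<in> S")
    case True
    then show ?thesis
      by (simp add: bidual_pullback_def restrict0_in bidual_embed_eval[OF bidual_embed_in]
          bidual_embed_eval[OF assms])
  next
    case False
    then show ?thesis using assms by (simp add: bidual_pullback_def restrict0_def dual_space_def hom_space_def)
  qed
qed

lemma bidual_embed_pullback:
  assumes "finite_dim S" "\<alpha> \<in> dual_space (dual_space (dual_space S))"
  shows "bidual_embed (dual_space S) (bidual_pullback S \<alpha>) = \<alpha>"
proof (rule dual_space_eqI[OF bidual_embed_in assms(2)])
  fix \<gamma> assume \<gamma>: "\<gamma> \<in> dual_space (dual_space S)"
  then obtain x where x: "x \<in> S" "\<gamma> = bidual_embed S x" using finite_dim_bidual[OF assms(1)] by blast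
  have "bidual_embed (dual_space S) (bidual_pullback S \<alpha>) \<gamma> = \<gamma> (bidual_pullback S \<alpha>)"
    by (rule bidual_embed_eval[OF \<gamma>])
  also have "\<dots> = bidual_pullback S \<alpha> x"
    unfolding x(2)
    by (rule bidual_embed_eval[OF bidual_pullback_in[OF finite_dim_subspace[OF assms(1)] assms(2)]])
  also have "\<dots> = \<alpha> \<gamma>" by (simp add: bidual_pullback_def restrict0_in x)
  finally show "bidual_embed (dual_space S) (bidual_pullback S \<alpha>) \<gamma> = \<alpha> \<gamma>" .
qed

lemma tensor_bidual_in:
  assumes "subspace S" "\<theta> \<in> tensor_space S T"
  shows "tensor_bidual S \<theta> \<in> tensor_space (dual_space (dual_space S)) T"
  unfolding tensor_space_hom tensor_bidual_def
  by (rule restrict0_hom_space[OF linear_from_to_comp[OF bidual_pullback_linear[OF assms(1)]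
        hom_spaceD[OF assms(2)[unfolded tensor_space_hom]]] subspace_dual_space])

lemma tensor_bidual_embed:
  assumes "\<beta> \<in> dual_space S"
  shows "tensor_bidual S \<theta> (bidual_embed (dual_space S) \<beta>) = \<theta> \<beta>"
  by (simp add: tensor_bidual_def restrict0_in bidual_embed_in bidual_pullback_embed[OF assms])

text \<open>The inverse is the pull-back along \<open>S\<^sup>* \<rightarrow> S\<^sup>*\<^sup>*\<^sup>*\<close>.\<close>

lemma tensor_bidual_bij:
  assumes "finite_dim S"
  shows "bij_betw (tensor_bidual S) (tensor_space S T) (tensor_space (dual_space (dual_space S)) T)"
proof (rule bij_betw_imageI)
  note sub = finite_dim_subspace[OF assms]
  show "inj_on (tensor_bidual S) (tensor_space S T)"
  proof
    fix \<theta> \<theta>' assume \<theta>: "\<theta> \<in> tensor_space S T" "\<theta>' \<in> tensor_space S T"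
      and eq: "tensor_bidual S \<theta> = tensor_bidual S \<theta>'"
    show "\<theta> = \<theta>'"
    proof (rule tensor_space_eqI[OF \<theta>])
      fix \<alpha> \<beta> assume "\<alpha> \<in> dual_space S"
      then show "\<theta> \<alpha> \<beta> = \<theta>' \<alpha> \<beta>" using tensor_bidual_embed[of \<alpha> S \<theta>] tensor_bidual_embed[of \<alpha> S \<theta>'] eq by simp
    qed
  qed
  show "tensor_bidual S ` tensor_space S T = tensor_space (dual_space (dual_space S)) T"
  proof (intro equalityI subsetI)
    show "\<theta>' \<in> tensor_space (dual_space (dual_space S)) T" if "\<theta>' \<in> tensor_bidual S ` tensor_space S T" for \<theta>'
      using that tensor_bidual_in[OF sub] by blast
    fix \<theta>' assume \<theta>': "\<theta>' \<in> tensor_space (dual_space (dual_space S)) T"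
    define \<theta> where "\<theta> = restrict0 (dual_space S) (\<lambda>\<beta>. \<theta>' (bidual_embed (dual_space S) \<beta>))"
    have \<theta>: "\<theta> \<in> tensor_space S T"
      unfolding \<theta>_def tensor_space_hom
      by (rule restrict0_hom_space[OF linear_from_to_comp[OF bidual_embed_linear
              hom_spaceD[OF \<theta>'[unfolded tensor_space_hom]]] subspace_dual_space])
    have "tensor_bidual S \<theta> = \<theta>'"
    proof (rule tensor_space_eqI[OF tensor_bidual_in[OF sub \<theta>] \<theta>'])
      fix \<alpha> \<gamma> assume \<alpha>: "\<alpha> \<in> dual_space (dual_space (dual_space S))"
      show "tensor_bidual S \<theta> \<alpha> \<gamma> = \<theta>' \<alpha> \<gamma>"
        using \<alpha> bidual_pullback_in[OF sub \<alpha>] bidual_embed_pullback[OF assms \<alpha>]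
        by (simp add: tensor_bidual_def \<theta>_def restrict0_in)
    qed
    then show "\<theta>' \<in> tensor_bidual S ` tensor_space S T" using \<theta> by blast
  qed
qed

lemma tensor_bidual_linear:
  assumes "subspace S"
  shows "linear_from_to (tensor_space S T) (tensor_space (dual_space (dual_space S)) T) (tensor_bidual S)"
  unfolding linear_from_to_def
  by (intro conjI ballI allI tensor_bidual_in[OF assms])
    (auto simp: tensor_bidual_def restrict0_def fun_eq_iff scaleR_fun_def)

lemma flip_bij: "bij_betw flip (tensor_space S T) (tensor_space T S)"
proof (rule bij_betw_imageI)
  show "inj_on flip (tensor_space S T)" by (rule inj_on_inverseI[of _ flip]) (rule flip_flip)
  show "flip ` tensor_space S T = tensor_space T S"
  proof (intro equalityI subsetI)
    show "\<theta> \<in> tensor_space T S" if "\<theta> \<in> flip ` tensor_space S T" for \<theta>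
      using that flip_tensor_space by blast
    show "\<theta> \<in> flip ` tensor_space S T" if "\<theta> \<in> tensor_space T S" for \<theta>
      using flip_tensor_space[OF that] flip_flip[of \<theta>] by (metis imageI)
  qed
qed

context smooth_base
begin

lemma bundle_map_comp: "bundle_map A E F f \<Longrightarrow> bundle_map A F G g \<Longrightarrow> bundle_map A E G (\<lambda>m x. g m (f m x))"
  unfolding bundle_map_def by (auto intro: linear_from_to_comp)

lemma bundle_map_cong:
  assumes E: "vector_bundle A E" and h: "bundle_map A E F h"
    and eq: "\<And>m x. x \<in> fibre E m \<Longrightarrow> h m x = h' m x"
  shows "bundle_map A E F h'"
  unfolding bundle_map_def
proof (intro conjI allI impI; (elim conjE)?)
  show "linear_from_to (fibre E m) (fibre F m) (h' m)" for m
    by (rule linear_from_to_cong[OF bundle_mapD(1)[OF h] vector_bundle_subspace[OF E] eq])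
  show "smooth_section A F W (\<lambda>m. h' m (\<sigma> m))" if "open W" "smooth_section A E W \<sigma>" for W \<sigma>
    by (rule smooth_section_cong[OF bundle_mapD(2)[OF h that] eq[OF smooth_section_fibre[OF that(2)]]])
qed

text \<open>The inclusion of a sequence may be composed with an isomorphism from another tensor product.\<close>

lemma DVB_sequence_compose:
  assumes D: "DVB_sequence A S" and E: "vector_bundle A (side1 T)" "vector_bundle A (side2 T)"
    and f: "bundle_map A (tensor_bundle A (side1 T) (side2 T)) (tensor_bundle A (side1 S) (side2 S)) f"
    and bij: "\<And>m. bij_betw (f m) (tensor_space (fibre (side1 T) m) (fibre (side2 T) m))
      (tensor_space (fibre (side1 S) m) (fibre (side2 S) m))"
    and T: "total T = total S" "core T = core S" "proj T = proj S"
    and incl: "\<And>m \<theta>. \<theta> \<in> tensor_space (fibre (side1 T) m) (fibre (side2 T) m) \<Longrightarrow>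
      incl S m (f m \<theta>) = incl T m \<theta>"
  shows "DVB_sequence A T"
proof -
  note d = DVB_sequenceD[OF D]
  have im: "f m ` tensor_space (fibre (side1 T) m) (fibre (side2 T) m) =
      tensor_space (fibre (side1 S) m) (fibre (side2 S) m)"
    and inj: "inj_on (f m) (tensor_space (fibre (side1 T) m) (fibre (side2 T) m))" for m
    using bij[of m] by (auto simp: bij_betw_def)
  have "inj_on (\<lambda>\<theta>. incl S m (f m \<theta>)) (tensor_space (fibre (side1 T) m) (fibre (side2 T) m))" for m
    using comp_inj_on[OF inj[of m], of "incl S m"] d(7)[of m] by (simp add: im comp_def)
  then have "inj_on (incl T m) (tensor_space (fibre (side1 T) m) (fibre (side2 T) m))" for m
    using inj_on_cong[of _ "\<lambda>\<theta>. incl S m (f m \<theta>)" "incl T m", OF incl] by blast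
  moreover have "incl T m ` tensor_space (fibre (side1 T) m) (fibre (side2 T) m) =
      incl S m ` tensor_space (fibre (side1 S) m) (fibre (side2 S) m)" for m
    unfolding im[symmetric] image_image by (rule image_cong[OF refl incl[symmetric]])
  moreover have "bundle_map A (tensor_bundle A (side1 T) (side2 T)) (total S) (incl T)"
    by (rule bundle_map_cong[OF vector_bundle_tensor[OF E] bundle_map_comp[OF f d(5)]])
      (simp add: incl)
  ultimately show ?thesis
    using d E by (simp add: DVB_sequence_def T)
qed

lemma bundle_map_flip:
  assumes E: "vector_bundle A E" and F: "vector_bundle A F"
  shows "bundle_map A (tensor_bundle A E F) (tensor_bundle A F E) (\<lambda>m. flip)"
  unfolding bundle_map_def
proof (intro conjI allI impI; (elim conjE)?)
  show "linear_from_to (fibre (tensor_bundle A E F) m) (fibre (tensor_bundle A F E) m) flip" for m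
    by (auto simp: linear_from_to_def flip_tensor_space) (auto simp: flip_def scaleR_fun_def fun_eq_iff)
  fix W \<theta> assume W: "open W" and \<theta>: "smooth_section A (tensor_bundle A E F) W \<theta>"
  have "smooth_fun A W' (\<lambda>m. \<theta> m (\<alpha> m) (\<beta> m))"
    if "open W'" "W' \<subseteq> W" "smooth_section A (dual_bundle A E) W' \<alpha>" "smooth_section A (dual_bundle A F) W' \<beta>"
    for W' \<alpha> \<beta>
    by (rule smooth_fun_tensor[OF E F W that(1,2) \<theta> that(3,4)])
  moreover have "flip (\<theta> m) \<in> tensor_space (fibre F m) (fibre E m)" if "m \<in> W" for m
    using smooth_section_fibre[OF \<theta> that] by (simp add: flip_tensor_space)
  ultimately show "smooth_section A (tensor_bundle A F E) W (\<lambda>m. flip (\<theta> m))"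
    unfolding smooth_section_tensor[OF F E W] by (simp add: flip_def)
qed

lemma DVB_sequence_flip_sides:
  assumes "DVB_sequence A S" shows "DVB_sequence A (flip_sides S)"
  using DVB_sequenceD[OF assms]
  by (intro DVB_sequence_compose[OF assms, of _ "\<lambda>m. flip"]) (auto simp: bundle_map_flip flip_bij)

lemma DVB_sequence_transposition:
  assumes D: "DVB_sequence A S" shows "DVB_sequence A (transposition S)"
proof -
  note d = DVB_sequenceD[OF D]
  have vb: "vector_bundle A (tensor_bundle A (side2 S) (side1 S))"
    by (rule vector_bundle_tensor[OF d(2,1)])
  have "bundle_map A (tensor_bundle A (side2 S) (side1 S)) (tensor_bundle A (side1 S) (side2 S)) (\<lambda>m \<theta>. - flip \<theta>)"
    unfolding bundle_map_def
  proof (intro conjI allI impI; (elim conjE)?)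
    note fl = bundle_map_flip[OF d(2,1)]
    show "linear_from_to (fibre (tensor_bundle A (side2 S) (side1 S)) m)
        (fibre (tensor_bundle A (side1 S) (side2 S)) m) (\<lambda>\<theta>. - flip \<theta>)" for m
      using bundle_mapD(1)[OF fl, of m]
      by (simp add: linear_from_to_def subspace_neg[OF subspace_tensor_space])
    show "smooth_section A (tensor_bundle A (side1 S) (side2 S)) W (\<lambda>m. - flip (\<theta> m))"
      if "open W" "smooth_section A (tensor_bundle A (side2 S) (side1 S)) W \<theta>" for W \<theta>
      using smooth_section_scale[OF vector_bundle_tensor[OF d(1,2)] that(1) bundle_mapD(2)[OF fl that], of "-1"]
      by simp
  qed
  moreover have "bij_betw (\<lambda>\<theta>. - flip \<theta>) (tensor_space (fibre (side2 S) m) (fibre (side1 S) m))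
      (tensor_space (fibre (side1 S) m) (fibre (side2 S) m))" for m
  proof (rule bij_betw_byWitness[where f' = "\<lambda>\<theta>. flip (- \<theta>)"])
  qed (auto simp: flip_flip intro: flip_tensor_space subspace_neg[OF subspace_tensor_space])
  moreover have "incl S m (- flip \<theta>) = - incl S m (flip \<theta>)"
    if "\<theta> \<in> tensor_space (fibre (side2 S) m) (fibre (side1 S) m)" for m \<theta>
    using linear_from_toD(3)[OF d(10) flip_tensor_space[OF that], of "-1"] by simp
  ultimately show ?thesis
    using d by (intro DVB_sequence_compose[OF D, of _ "\<lambda>m \<theta>. - flip \<theta>"]) auto
qed

lemma DVB_sequence_identify_bidual:
  assumes D: "DVB_sequence A S" and V: "vector_bundle A V"
    and S: "side1 S = dual_bundle A (dual_bundle A V)"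
  shows "DVB_sequence A (identify_bidual V S)"
proof -
  note d = DVB_sequenceD[OF D]
  note V'' = vector_bundle_dual[OF vector_bundle_dual[OF V]]
  have "bundle_map A (tensor_bundle A V (side2 S)) (tensor_bundle A (side1 S) (side2 S))
      (\<lambda>m. tensor_bidual (fibre V m))"
    unfolding bundle_map_def S
  proof (intro conjI allI impI; (elim conjE)?)
    show "linear_from_to (fibre (tensor_bundle A V (side2 S)) m)
        (fibre (tensor_bundle A (dual_bundle A (dual_bundle A V)) (side2 S)) m) (tensor_bidual (fibre V m))" for m
      using tensor_bidual_linear[OF vector_bundle_subspace[OF V]] by simp
    fix W \<theta> assume W: "open W" and \<theta>: "smooth_section A (tensor_bundle A V (side2 S)) W \<theta>"
    have eval: "smooth_fun A W' (\<lambda>m. tensor_bidual (fibre V m) (\<theta> m) (\<alpha> m) (\<beta> m))"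
      if W': "open W'" "W' \<subseteq> W" and \<beta>: "smooth_section A (dual_bundle A (side2 S)) W' \<beta>"
        and \<alpha>: "smooth_section A (dual_bundle A (dual_bundle A (dual_bundle A V))) W' \<alpha>" for W' \<alpha> \<beta>
    proof (rule smooth_fun_cong[OF W'(1)])
      have \<alpha>m: "\<alpha> m \<in> dual_space (dual_space (dual_space (fibre V m)))" if "m \<in> W'" for m
        using smooth_section_fibre[OF \<alpha> that] by simp
      have "smooth_section A (dual_bundle A V) W' (\<lambda>m. bidual_pullback (fibre V m) (\<alpha> m))"
        unfolding smooth_section_dual[OF V W'(1)]
      proof (intro conjI allI impI ballI; (elim conjE)?)
        show "bidual_pullback (fibre V m) (\<alpha> m) \<in> dual_space (fibre V m)" if "m \<in> W'" for m
          by (rule bidual_pullback_in[OF vector_bundle_subspace[OF V] \<alpha>m[OF that]])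
        fix N \<sigma> assume N: "open N" "N \<subseteq> W'" and \<sigma>: "smooth_section A V N \<sigma>"
        show "smooth_fun A N (\<lambda>m. bidual_pullback (fibre V m) (\<alpha> m) (\<sigma> m))"
        proof (rule smooth_fun_cong[OF N(1)])
          show "smooth_fun A N (\<lambda>m. \<alpha> m (bidual_embed (fibre V m) (\<sigma> m)))"
            by (rule smooth_fun_eval[OF V'' N(1) smooth_section_subset[OF vector_bundle_dual[OF V''] W'(1) N \<alpha>]
                  smooth_section_bidual[OF V N(1) \<sigma>]])
          show "\<alpha> m (bidual_embed (fibre V m) (\<sigma> m)) = bidual_pullback (fibre V m) (\<alpha> m) (\<sigma> m)" if "m \<in> N" for m
            using smooth_section_fibre[OF \<sigma> that] by (simp add: bidual_pullback_def restrict0_in)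
        qed
      qed
      then show "smooth_fun A W' (\<lambda>m. \<theta> m (bidual_pullback (fibre V m) (\<alpha> m)) (\<beta> m))"
        by (rule smooth_fun_tensor[OF V d(2) W W' \<theta> _ \<beta>])
      show "\<theta> m (bidual_pullback (fibre V m) (\<alpha> m)) (\<beta> m) = tensor_bidual (fibre V m) (\<theta> m) (\<alpha> m) (\<beta> m)"
        if "m \<in> W'" for m
        by (simp add: tensor_bidual_def restrict0_in \<alpha>m[OF that])
    qed
    have mem: "tensor_bidual (fibre V m) (\<theta> m) \<in>
        tensor_space (fibre (dual_bundle A (dual_bundle A V)) m) (fibre (side2 S) m)" if "m \<in> W" for m
      using tensor_bidual_in[OF vector_bundle_subspace[OF V]] smooth_section_fibre[OF \<theta> that] by simp
    show "smooth_section A (tensor_bundle A (dual_bundle A (dual_bundle A V)) (side2 S)) W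
        (\<lambda>m. tensor_bidual (fibre V m) (\<theta> m))"
      by (rule smooth_section_tensorI[OF V'' d(2) W]; (rule mem | rule eval))
  qed
  moreover have "bij_betw (tensor_bidual (fibre V m)) (tensor_space (fibre V m) (fibre (side2 S) m))
      (tensor_space (fibre (side1 S) m) (fibre (side2 S) m))" for m
    using tensor_bidual_bij[OF vector_bundle_finite_dim[OF V]] by (simp add: S)
  ultimately show ?thesis
    using d V by (intro DVB_sequence_compose[OF D, of _ "\<lambda>m. tensor_bidual (fibre V m)"]) auto
qed

lemma smooth_section_zero: "vector_bundle A E \<Longrightarrow> open W \<Longrightarrow> smooth_section A E W (\<lambda>_. 0)"
  using smooth_section_sum[of E W "{}"] by simp

section \<open>Exactness and pairing of the dual sequence\<close>

lemma side_dual_incl_eval: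
  assumes D: "DVB_sequence A S" and \<kappa>: "\<kappa> \<in> tensor_space (fibre (side1 S) m) (dual_space (fibre (core S) m))"
    and \<sigma>: "\<sigma> \<in> fibre (total S) m" and \<alpha>: "\<alpha> \<in> dual_space (fibre (side1 S) m)"
  shows "\<alpha> (fst (incl (side_dual A S) m \<kappa>) \<sigma>) = \<kappa> \<alpha> (bidual_embed (fibre (core S) m) (proj S m \<sigma>))"
  using contract_eval[OF vector_bundle_finite_dim[OF DVB_sequenceD(1)[OF D]] \<kappa> bidual_embed_in \<alpha>] \<sigma>
  by (simp add: incl_side_dual restrict0_in)

lemma side_dual_incl_in:
  assumes D: "DVB_sequence A S" and \<kappa>: "\<kappa> \<in> tensor_space (fibre (side1 S) m) (dual_space (fibre (core S) m))"
  shows "incl (side_dual A S) m \<kappa> \<in> fibre (dual_total A S) m"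
proof -
  note d = DVB_sequenceD[OF D]
  note fin = vector_bundle_finite_dim[OF d(1)]
  have "linear_from_to (fibre (total S) m) (fibre (side1 S) m)
      (\<lambda>\<sigma>. contract (fibre (side1 S) m) (bidual_embed (fibre (core S) m) (proj S m \<sigma>)) \<kappa>)"
    by (rule linear_from_to_comp[OF linear_from_to_comp[OF d(11) bidual_embed_linear]
          contract_linear_left[OF fin \<kappa>]])
  from restrict0_hom_space[OF this vector_bundle_subspace[OF d(3)]]
  have "fst (incl (side_dual A S) m \<kappa>) \<in> hom_space (fibre (total S) m) (fibre (side1 S) m)"
    by (simp add: incl_side_dual)
  moreover have "bidual_embed (fibre (core S) m) 0 = 0"
    by (rule linear_from_to_0[OF bidual_embed_linear vector_bundle_subspace[OF d(4)]])
  ultimately show ?thesis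
    using DVB_sequence_incl[OF D]
    by (simp add: incl_side_dual fibre_dual_total restrict0_in contract_0_left[OF fin] contract_0_left[OF fin \<kappa>]
        subspace_0[OF subspace_dual_space])
qed

text \<open>Exactness and smoothness of the dual sequence; that the dual has enough smooth frames is
  \<open>vector_bundle_dual_total\<close>.\<close>

lemma DVB_sequence_side_dual:
  assumes D: "DVB_sequence A S" shows "DVB_sequence A (side_dual A S)"
proof -
  note d = DVB_sequenceD[OF D]
  note fin = vector_bundle_finite_dim[OF d(1)]
  note K' = vector_bundle_dual[OF d(4)] and V' = vector_bundle_dual[OF d(2)]
    and DT = vector_bundle_dual_total[OF D]
  let ?T = "side_dual A S"
  have i: "bundle_map A (tensor_bundle A (side1 S) (dual_bundle A (core S))) (dual_total A S) (incl ?T)"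
    unfolding bundle_map_def
  proof (intro conjI allI impI; (elim conjE)?)
    fix m
    show "linear_from_to (fibre (tensor_bundle A (side1 S) (dual_bundle A (core S))) m)
        (fibre (dual_total A S) m) (incl ?T m)"
      unfolding linear_from_to_def
    proof (intro conjI ballI allI)
      fix \<kappa> assume "\<kappa> \<in> fibre (tensor_bundle A (side1 S) (dual_bundle A (core S))) m"
      then have \<kappa>: "\<kappa> \<in> tensor_space (fibre (side1 S) m) (dual_space (fibre (core S) m))" by simp
      show "incl ?T m \<kappa> \<in> fibre (dual_total A S) m" by (rule side_dual_incl_in[OF D \<kappa>])
      show "incl ?T m (c *\<^sub>R \<kappa>) = c *\<^sub>R incl ?T m \<kappa>" for c
        using linear_from_toD(3)[OF contract_linear_right[OF fin bidual_embed_in] \<kappa>]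
        by (auto simp: incl_side_dual restrict0_def fun_eq_iff scaleR_fun_def)
      fix \<kappa>' assume "\<kappa>' \<in> fibre (tensor_bundle A (side1 S) (dual_bundle A (core S))) m"
      then have \<kappa>': "\<kappa>' \<in> tensor_space (fibre (side1 S) m) (dual_space (fibre (core S) m))" by simp
      show "incl ?T m (\<kappa> + \<kappa>') = incl ?T m \<kappa> + incl ?T m \<kappa>'"
        using linear_from_toD(2)[OF contract_linear_right[OF fin bidual_embed_in] \<kappa> \<kappa>']
        by (auto simp: incl_side_dual restrict0_def fun_eq_iff)
    qed
  next
    fix W \<kappa> assume W: "open W" and \<kappa>: "smooth_section A (tensor_bundle A (side1 S) (dual_bundle A (core S))) W \<kappa>"
    have mem: "incl ?T m (\<kappa> m) \<in> fibre (dual_total A S) m" if "m \<in> W" for m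
      by (rule side_dual_incl_in[OF D]) (use smooth_section_fibre[OF \<kappa> that] in simp)
    have "smooth_section A (side1 S) W' (\<lambda>m. fst (incl ?T m (\<kappa> m)) (\<sigma> m))"
      if W': "open W'" "W' \<subseteq> W" and \<sigma>: "smooth_section A (total S) W' \<sigma>" for W' \<sigma>
    proof (rule smooth_section_cong)
      show "smooth_section A (side1 S) W' (\<lambda>m. contract (fibre (side1 S) m)
          (bidual_embed (fibre (core S) m) (proj S m (\<sigma> m))) (\<kappa> m))"
        by (rule smooth_section_contract[OF d(1) K' W'(1) smooth_section_subset[OF
                vector_bundle_tensor[OF d(1) K'] W W' \<kappa>]
              smooth_section_bidual[OF d(4) W'(1) bundle_mapD(2)[OF d(6) W'(1) \<sigma>]]])
      show "contract (fibre (side1 S) m) (bidual_embed (fibre (core S) m) (proj S m (\<sigma> m))) (\<kappa> m) =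
          fst (incl ?T m (\<kappa> m)) (\<sigma> m)" if "m \<in> W'" for m
        using smooth_section_fibre[OF \<sigma> that] by (simp add: incl_side_dual restrict0_in)
    qed
    note smooth_apply = this
    have "smooth_section A (hom_bundle A (total S) (side1 S)) W (\<lambda>m. fst (incl ?T m (\<kappa> m)))"
    proof (rule smooth_section_homI[OF d(3,1) W])
      show "fst (incl ?T m (\<kappa> m)) \<in> hom_space (fibre (total S) m) (fibre (side1 S) m)" if "m \<in> W" for m
        by (rule dual_total_memD(1)[OF mem[OF that]])
    qed (rule smooth_apply)
    moreover have "smooth_section A (dual_bundle A (side2 S)) W (\<lambda>m. snd (incl ?T m (\<kappa> m)))"
      using smooth_section_zero[OF V' W] by (simp add: incl_side_dual)
    ultimately show "smooth_section A (dual_total A S) W (\<lambda>m. incl ?T m (\<kappa> m))"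
      unfolding smooth_section_dual_total[OF D W] using mem by blast
  qed
  have p: "bundle_map A (dual_total A S) (dual_bundle A (side2 S)) (\<lambda>m. snd)"
    unfolding bundle_map_def
  proof (intro conjI allI impI; (elim conjE)?)
    show "linear_from_to (fibre (dual_total A S) m) (fibre (dual_bundle A (side2 S)) m) snd" for m
      using dual_total_memD(2)[of _ S m] by (simp add: linear_from_to_def)
    show "smooth_section A (dual_bundle A (side2 S)) W (\<lambda>m. snd (e m))"
      if "open W" "smooth_section A (dual_total A S) W e" for W e
      using that smooth_section_dual_total[OF D that(1)] by blast
  qed
  have inj: "inj_on (incl ?T m) (tensor_space (fibre (side1 S) m) (dual_space (fibre (core S) m)))" for m
  proof
    fix \<kappa> \<kappa>' assume \<kappa>: "\<kappa> \<in> tensor_space (fibre (side1 S) m) (dual_space (fibre (core S) m))"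
      "\<kappa>' \<in> tensor_space (fibre (side1 S) m) (dual_space (fibre (core S) m))"
      and eq: "incl ?T m \<kappa> = incl ?T m \<kappa>'"
    show "\<kappa> = \<kappa>'"
    proof (rule tensor_space_eqI[OF \<kappa>])
      fix \<alpha> \<gamma> assume \<alpha>: "\<alpha> \<in> dual_space (fibre (side1 S) m)"
        and \<gamma>: "\<gamma> \<in> dual_space (dual_space (fibre (core S) m))"
      obtain k where k: "k \<in> fibre (core S) m" "\<gamma> = bidual_embed (fibre (core S) m) k"
        using finite_dim_bidual[OF vector_bundle_finite_dim[OF d(4)] \<gamma>] .
      obtain \<sigma> where \<sigma>: "\<sigma> \<in> fibre (total S) m" "k = proj S m \<sigma>"
        using k(1) unfolding d(9)[of m, symmetric] by blast
      show "\<kappa> \<alpha> \<gamma> = \<kappa>' \<alpha> \<gamma>"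
        unfolding k(2) \<sigma>(2)
        using side_dual_incl_eval[OF D \<kappa>(1) \<sigma>(1) \<alpha>] side_dual_incl_eval[OF D \<kappa>(2) \<sigma>(1) \<alpha>] eq by metis
    qed
  qed
  have ker: "e \<in> incl ?T m ` tensor_space (fibre (side1 S) m) (dual_space (fibre (core S) m))"
    if e: "e \<in> fibre (dual_total A S) m" and e0: "snd e = 0" for e m
  proof -
    obtain s where sm: "linear_from_to (fibre (core S) m) (fibre (total S) m) s"
      and jsm: "\<forall>y\<in>fibre (core S) m. proj S m (s y) = y"
      using proj_section[OF D, of m] .
    \<comment> \<open>As \<open>e\<close> vanishes on the kernel of \<open>j\<close>, it factors through a map \<open>h\<close> from \<open>K\<close> to \<open>U\<close>.\<close>
    define h where "h = (\<lambda>y. fst e (s y))"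
    have h: "linear_from_to (fibre (core S) m) (fibre (side1 S) m) h"
      unfolding h_def by (rule linear_from_to_comp[OF sm dual_total_memD(4)[OF e]])
    have eh: "fst e \<sigma> = h (proj S m \<sigma>)" if "\<sigma> \<in> fibre (total S) m" for \<sigma>
      using dual_total_decomp[OF D sm jsm e that] e0
        contract_0_left[OF fin tensor_part_in[OF D sm jsm that]] by (simp add: h_def)
    define \<kappa> where "\<kappa> = restrict0 (dual_space (fibre (side1 S) m))
      (\<lambda>\<alpha>. bidual_embed (dual_space (fibre (core S) m)) (restrict0 (fibre (core S) m) (\<lambda>y. \<alpha> (h y))))"
    note subK = vector_bundle_subspace[OF d(4)]
    have "linear_from_to (dual_space (fibre (side1 S) m)) (dual_space (fibre (core S) m))
        (\<lambda>\<alpha>. restrict0 (fibre (core S) m) (\<lambda>y. \<alpha> (h y)))"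
      unfolding linear_from_to_def
    proof (intro conjI ballI allI)
      show "restrict0 (fibre (core S) m) (\<lambda>y. \<alpha> (h y)) \<in> dual_space (fibre (core S) m)"
        if "\<alpha> \<in> dual_space (fibre (side1 S) m)" for \<alpha>
        by (rule restrict0_dual_space[OF linear_from_to_comp[OF h dual_spaceD[OF that]] subK])
    qed (auto simp: restrict0_def fun_eq_iff scaleR_fun_def)
    from restrict0_hom_space[OF linear_from_to_comp[OF this bidual_embed_linear] subspace_dual_space]
    have \<kappa>: "\<kappa> \<in> tensor_space (fibre (side1 S) m) (dual_space (fibre (core S) m))"
      unfolding \<kappa>_def tensor_space_hom .
    have "incl ?T m \<kappa> = e"
    proof (rule prod_eqI)
      show "fst (incl ?T m \<kappa>) = fst e"
      proof (rule hom_space_eqI[OF dual_total_memD(1)[OF side_dual_incl_in[OF D \<kappa>]] dual_total_memD(1)[OF e]])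
        fix \<sigma> assume \<sigma>: "\<sigma> \<in> fibre (total S) m"
        have j\<sigma>: "proj S m \<sigma> \<in> fibre (core S) m" by (rule linear_from_toD(1)[OF d(11) \<sigma>])
        show "fst (incl ?T m \<kappa>) \<sigma> = fst e \<sigma>"
        proof (rule dual_separates[OF finite_dim_subspace[OF fin]])
          show "fst (incl ?T m \<kappa>) \<sigma> \<in> fibre (side1 S) m" "fst e \<sigma> \<in> fibre (side1 S) m"
            by (rule linear_from_toD(1)[OF dual_total_memD(4)[OF side_dual_incl_in[OF D \<kappa>]] \<sigma>],
                rule linear_from_toD(1)[OF dual_total_memD(4)[OF e] \<sigma>])
          fix \<alpha> assume \<alpha>: "\<alpha> \<in> dual_space (fibre (side1 S) m)"
          have r: "restrict0 (fibre (core S) m) (\<lambda>y. \<alpha> (h y)) \<in> dual_space (fibre (core S) m)"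
            by (rule restrict0_dual_space[OF linear_from_to_comp[OF h dual_spaceD[OF \<alpha>]] subK])
          have "\<alpha> (fst (incl ?T m \<kappa>) \<sigma>) = \<kappa> \<alpha> (bidual_embed (fibre (core S) m) (proj S m \<sigma>))"
            by (rule side_dual_incl_eval[OF D \<kappa> \<sigma> \<alpha>])
          also have "\<dots> = restrict0 (fibre (core S) m) (\<lambda>y. \<alpha> (h y)) (proj S m \<sigma>)"
            by (simp add: \<kappa>_def restrict0_in \<alpha> bidual_embed_eval[OF bidual_embed_in] bidual_embed_eval[OF r])
          also have "\<dots> = \<alpha> (fst e \<sigma>)" using eh[OF \<sigma>] j\<sigma> by (simp add: restrict0_in)
          finally show "\<alpha> (fst (incl ?T m \<kappa>) \<sigma>) = \<alpha> (fst e \<sigma>)" .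
        qed
      qed
      show "snd (incl ?T m \<kappa>) = snd e" using e0 by (simp add: incl_side_dual)
    qed
    then show ?thesis using \<kappa> by blast
  qed
  have surj: "\<beta> \<in> snd ` fibre (dual_total A S) m" if \<beta>: "\<beta> \<in> dual_space (fibre (side2 S) m)" for \<beta> m
  proof -
    obtain s where sm: "linear_from_to (fibre (core S) m) (fibre (total S) m) s"
      and jsm: "\<forall>y\<in>fibre (core S) m. proj S m (s y) = y"
      using proj_section[OF D, of m] .
    have "dual_element S m s (0, \<beta>) \<in> fibre (dual_total A S) m"
      by (rule dual_element_in[OF D sm jsm subspace_0[OF subspace_hom_space[OF
              finite_dim_subspace[OF fin]]] \<beta>])
    moreover have "snd (dual_element S m s (0, \<beta>)) = \<beta>" by (simp add: dual_element_def)
    ultimately show ?thesis by (metis imageI)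
  qed
  have "incl ?T m ` tensor_space (fibre (side1 S) m) (dual_space (fibre (core S) m)) =
      {e \<in> fibre (dual_total A S) m. snd e = 0}" for m
  proof (intro equalityI subsetI)
    fix e assume "e \<in> incl ?T m ` tensor_space (fibre (side1 S) m) (dual_space (fibre (core S) m))"
    then obtain \<kappa> where \<kappa>: "\<kappa> \<in> tensor_space (fibre (side1 S) m) (dual_space (fibre (core S) m))"
      "e = incl ?T m \<kappa>" by blast
    show "e \<in> {e \<in> fibre (dual_total A S) m. snd e = 0}"
      using side_dual_incl_in[OF D \<kappa>(1)] unfolding \<kappa>(2) by (simp add: incl_side_dual)
  next
    fix e assume "e \<in> {e \<in> fibre (dual_total A S) m. snd e = 0}"
    then show "e \<in> incl ?T m ` tensor_space (fibre (side1 S) m) (dual_space (fibre (core S) m))"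
      by (intro ker) auto
  qed
  moreover have "snd ` fibre (dual_total A S) m = dual_space (fibre (side2 S) m)" for m
  proof (intro equalityI subsetI)
    show "\<beta> \<in> dual_space (fibre (side2 S) m)" if "\<beta> \<in> snd ` fibre (dual_total A S) m" for \<beta>
      using that dual_total_memD(2) by blast
  qed (rule surj)
  ultimately show ?thesis
    using d(1) K' V' DT i p inj unfolding DVB_sequence_def
    by simp
qed

text \<open>The pairing is evaluation of the component \<open>\<epsilon>\<close>.\<close>

lemma in_duality_side_dual:
  assumes D: "DVB_sequence A S" shows "in_duality A S (side_dual A S)"
proof -
  note d = DVB_sequenceD[OF D]
  have pair: "bilinear_pairing A (dual_total A S) (total S) (side1 S) (\<lambda>m e. fst e)"
    unfolding bilinear_pairing_def
  proof (intro conjI allI impI ballI; (elim conjE)?)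
    show "linear_from_to (fibre (total S) m) (fibre (side1 S) m) (fst e)"
      if "e \<in> fibre (dual_total A S) m" for m e
      by (rule dual_total_memD(4)[OF that])
    show "linear_from_to (fibre (dual_total A S) m) (fibre (side1 S) m) (\<lambda>e. fst e \<sigma>)"
      if \<sigma>: "\<sigma> \<in> fibre (total S) m" for m \<sigma>
      unfolding linear_from_to_def
    proof (intro conjI ballI allI)
      show "fst e \<sigma> \<in> fibre (side1 S) m" if "e \<in> fibre (dual_total A S) m" for e
        by (rule linear_from_toD(1)[OF dual_total_memD(4)[OF that] \<sigma>])
    qed (simp_all add: scaleR_fun_def)
    fix W e \<sigma> assume W: "open W" and e: "smooth_section A (dual_total A S) W e"
      and \<sigma>: "smooth_section A (total S) W \<sigma>"
    have "smooth_section A (hom_bundle A (total S) (side1 S)) W (\<lambda>m. fst (e m))"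
      using e smooth_section_dual_total[OF D W] by blast
    from smooth_section_apply[OF d(3,1) W this \<sigma>]
    show "smooth_section A (side1 S) W (\<lambda>m. fst (e m) (\<sigma> m))" .
  qed
  show ?thesis
    unfolding in_duality_def
  proof (intro conjI exI[of _ "\<lambda>m e. fst e"] allI ballI)
    show "fst e (incl S m \<theta>) = contract (fibre (side1 S) m) (proj (side_dual A S) m e) \<theta>"
      if "e \<in> fibre (total (side_dual A S)) m" "\<theta> \<in> tensor_space (fibre (side1 S) m) (fibre (side2 S) m)" for m e \<theta>
      using dual_total_memD(3)[of e S m \<theta>] that by simp
  qed (use D DVB_sequence_side_dual[OF D] pair in \<open>simp_all add: incl_side_dual restrict0_in\<close>)
qed

end

section \<open>The duality over the second side bundle\<close>

text \<open>The pairing of \<open>x = (\<psi>, \<mu>)\<close> in the \<open>K\<^sup>*\<close>-dual of the \<open>U\<close>-dual of \<open>S\<close> with \<open>\<sigma>\<close> in \<open>\<Pi>\<close>: the element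
  \<open>v\<close> of \<open>V\<close> with \<open>\<beta>(v) = \<psi>(e)(j(\<sigma>)) - \<mu>(\<epsilon>(\<sigma>))\<close> for all \<open>e = (\<epsilon>, \<beta>)\<close> in the \<open>U\<close>-dual.\<close>

definition transposed_pairing ::
    "('m::topological_space, 'b::real_normed_vector) atlas \<Rightarrow>
     ('m, 'u::real_vector, 'v::real_vector, 'p::real_vector, 'k::real_vector) dvb_data \<Rightarrow> 'm \<Rightarrow>
     ((('p \<Rightarrow> 'u) \<times> ('v \<Rightarrow> real)) \<Rightarrow> 'k \<Rightarrow> real) \<times> ('u \<Rightarrow> real) \<Rightarrow> 'p \<Rightarrow> 'v" where
  "transposed_pairing A S m x \<sigma> = (THE v. v \<in> fibre (side2 S) m \<and>
     (\<forall>e\<in>fibre (dual_total A S) m. snd e v = fst x e (proj S m \<sigma>) - snd x (fst e \<sigma>)))"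

context smooth_base
begin

context
  fixes S :: "('m, 'u::real_vector, 'v::real_vector, 'p::real_vector, 'k::real_vector) dvb_data"
  assumes D: "DVB_sequence A S"
begin

abbreviation (input) bidual_total where
  "bidual_total \<equiv> dual_total A (flip_sides (side_dual A S))"

lemma bidual_total_memD:
  assumes x: "x \<in> fibre bidual_total m"
  shows "fst x \<in> hom_space (fibre (dual_total A S) m) (dual_space (fibre (core S) m))"
    "snd x \<in> dual_space (fibre (side1 S) m)"
    "\<theta> \<in> tensor_space (dual_space (fibre (core S) m)) (fibre (side1 S) m) \<Longrightarrow>
       fst x (incl (side_dual A S) m (flip \<theta>)) = contract (dual_space (fibre (core S) m)) (snd x) \<theta>"
    "e \<in> fibre (dual_total A S) m \<Longrightarrow> fst x e \<in> dual_space (fibre (core S) m)"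
  using dual_total_memD[OF x] linear_from_toD(1)
  by simp_all

lemma dual_element_with_component:
  assumes "\<beta> \<in> dual_space (fibre (side2 S) m)"
  obtains e where "e \<in> fibre (dual_total A S) m" "snd e = \<beta>"
proof -
  have "\<beta> \<in> snd ` fibre (dual_total A S) m"
    using DVB_sequenceD(9)[OF DVB_sequence_side_dual[OF D], of m] assms
    by simp
  then show ?thesis using that by (elim imageE) (rule that, simp_all)
qed

lemma transposed_functional_linear:
  assumes x: "x \<in> fibre bidual_total m" and \<sigma>: "\<sigma> \<in> fibre (total S) m"
  shows "linear_from_to (fibre (dual_total A S) m) UNIV (\<lambda>e. fst x e (proj S m \<sigma>) - snd x (fst e \<sigma>))"
proof -
  have f: "fst e \<sigma> \<in> fibre (side1 S) m" if "e \<in> fibre (dual_total A S) m" for e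
    by (rule linear_from_toD(1)[OF dual_total_memD(4)[OF that] \<sigma>])
  note l = linear_from_toD[OF hom_spaceD[OF bidual_total_memD(1)[OF x]]]
    and l' = linear_from_toD[OF dual_spaceD[OF bidual_total_memD(2)[OF x]]]
  show ?thesis
    unfolding linear_from_to_def
    by (auto simp: l l' f scaleR_fun_def algebra_simps)
qed

text \<open>The functional vanishes on the kernel \<open>U \<otimes> K\<^sup>*\<close> of the projection: this is where the compatibility
  of \<open>\<psi>\<close> with \<open>\<mu>\<close> is used, and why the two terms have opposite signs.\<close>

lemma transposed_functional_kernel:
  assumes x: "x \<in> fibre bidual_total m" and \<sigma>: "\<sigma> \<in> fibre (total S) m"
    and e: "e \<in> fibre (dual_total A S) m" "snd e = 0"
  shows "fst x e (proj S m \<sigma>) - snd x (fst e \<sigma>) = 0"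
proof -
  note d = DVB_sequenceD[OF D]
  let ?K = "fibre (core S) m" and ?U = "fibre (side1 S) m"
  have "e \<in> fibre (total (side_dual A S)) m" "proj (side_dual A S) m e = 0"
    using e by simp_all
  then obtain \<kappa> where "\<kappa> \<in> tensor_space (fibre (side1 (side_dual A S)) m) (fibre (side2 (side_dual A S)) m)"
    and \<kappa>2: "incl (side_dual A S) m \<kappa> = e"
    by (rule DVB_sequence_kernel[OF DVB_sequence_side_dual[OF D]])
  then have "\<kappa> \<in> tensor_space ?U (dual_space ?K)" by simp
  note \<kappa> = this \<kappa>2
  have finK: "finite_dim (dual_space ?K)"
    by (rule finite_dim_dual[OF vector_bundle_finite_dim[OF d(4)]])
  have "fst x e = contract (dual_space ?K) (snd x) (flip \<kappa>)"
    using bidual_total_memD(3)[OF x flip_tensor_space[OF \<kappa>(1)]] \<kappa>(2) by (simp only: flip_flip)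
  then have "fst x e (proj S m \<sigma>) = bidual_embed ?K (proj S m \<sigma>) (contract (dual_space ?K) (snd x) (flip \<kappa>))"
    using bidual_embed_eval[OF bidual_total_memD(4)[OF x e(1)], of "proj S m \<sigma>"] by simp
  also have "\<dots> = flip \<kappa> (bidual_embed ?K (proj S m \<sigma>)) (snd x)"
    by (rule contract_eval[OF finK flip_tensor_space[OF \<kappa>(1)] bidual_total_memD(2)[OF x] bidual_embed_in])
  also have "\<dots> = snd x (fst e \<sigma>)"
    using side_dual_incl_eval[OF D \<kappa>(1) \<sigma> bidual_total_memD(2)[OF x]] unfolding \<kappa>(2) by (simp add: flip_def)
  finally show ?thesis by simp
qed

lemma transposed_pairing_unique:
  assumes "v \<in> fibre (side2 S) m" "w \<in> fibre (side2 S) m"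
    and "\<And>e. e \<in> fibre (dual_total A S) m \<Longrightarrow> snd e v = snd e w"
  shows "v = w"
proof (rule dual_separates[OF vector_bundle_subspace[OF DVB_sequenceD(2)[OF D]] assms(1,2)])
  fix \<beta> assume "\<beta> \<in> dual_space (fibre (side2 S) m)"
  then obtain e where "e \<in> fibre (dual_total A S) m" "snd e = \<beta>" by (rule dual_element_with_component)
  then show "\<beta> v = \<beta> w" using assms(3)[of e] by simp
qed

lemma transposed_pairing_eqI:
  assumes "v \<in> fibre (side2 S) m"
    and "\<And>e. e \<in> fibre (dual_total A S) m \<Longrightarrow> snd e v = fst x e (proj S m \<sigma>) - snd x (fst e \<sigma>)"
  shows "transposed_pairing A S m x \<sigma> = v"
  unfolding transposed_pairing_def
proof (rule the_equality)
  fix w assume w: "w \<in> fibre (side2 S) m \<and>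
     (\<forall>e\<in>fibre (dual_total A S) m. snd e w = fst x e (proj S m \<sigma>) - snd x (fst e \<sigma>))"
  show "w = v"
  proof (rule transposed_pairing_unique[OF conjunct1[OF w] assms(1)])
    show "snd e w = snd e v" if "e \<in> fibre (dual_total A S) m" for e
      using bspec[OF conjunct2[OF w] that] assms(2)[OF that] by simp
  qed
qed (use assms in blast)

lemma transposed_pairing:
  assumes x: "x \<in> fibre bidual_total m" and \<sigma>: "\<sigma> \<in> fibre (total S) m"
  shows transposed_pairing_in: "transposed_pairing A S m x \<sigma> \<in> fibre (side2 S) m"
    and transposed_pairing_eval: "e \<in> fibre (dual_total A S) m \<Longrightarrow>
      snd e (transposed_pairing A S m x \<sigma>) = fst x e (proj S m \<sigma>) - snd x (fst e \<sigma>)"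
proof -
  let ?D = "fibre (dual_total A S) m" and ?V = "fibre (side2 S) m"
  define L where "L = (\<lambda>e. fst x e (proj S m \<sigma>) - snd x (fst e \<sigma>))"
  have L: "linear_from_to ?D UNIV L"
    unfolding L_def by (rule transposed_functional_linear[OF x \<sigma>])
  note S2 = DVB_sequence_side_dual[OF D]
  have subD: "subspace ?D" by (rule subspace_dual_total[OF D])
  obtain s where "linear_from_to (fibre (core (side_dual A S)) m) (fibre (total (side_dual A S)) m) s"
    "\<forall>\<beta>\<in>fibre (core (side_dual A S)) m. proj (side_dual A S) m (s \<beta>) = \<beta>"
    using proj_section[OF S2, of m] .
  then have s: "linear_from_to (dual_space ?V) ?D s" and ps: "\<forall>\<beta>\<in>dual_space ?V. snd (s \<beta>) = \<beta>"
    by simp_all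
  have "restrict0 (dual_space ?V) (\<lambda>\<beta>. L (s \<beta>)) \<in> dual_space (dual_space ?V)"
    by (rule restrict0_dual_space[OF linear_from_to_comp[OF s L] subspace_dual_space])
  then obtain v where v: "v \<in> ?V" "restrict0 (dual_space ?V) (\<lambda>\<beta>. L (s \<beta>)) = bidual_embed ?V v"
    by (rule finite_dim_bidual[OF vector_bundle_finite_dim[OF DVB_sequenceD(2)[OF D]]])
  have eval: "snd e v = L e" if e: "e \<in> ?D" for e
  proof -
    have \<beta>: "snd e \<in> dual_space ?V" by (rule dual_total_memD(2)[OF e])
    have se: "s (snd e) \<in> ?D" by (rule linear_from_toD(1)[OF s \<beta>])
    have "L (e - s (snd e)) = 0"
      unfolding L_def
      using transposed_functional_kernel[OF x \<sigma> subspace_diff[OF subD e se]] bspec[OF ps \<beta>] by simp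
    then have "L e = L (s (snd e))" using linear_from_to_diff[OF L subD e se] by simp
    also have "\<dots> = snd e v"
      using fun_cong[OF v(2), of "snd e"] \<beta> by (simp add: restrict0_in bidual_embed_eval)
    finally show ?thesis by simp
  qed
  then have "transposed_pairing A S m x \<sigma> = v"
    unfolding L_def by (rule transposed_pairing_eqI[OF v(1)])
  then show "transposed_pairing A S m x \<sigma> \<in> ?V"
    and "e \<in> ?D \<Longrightarrow> snd e (transposed_pairing A S m x \<sigma>) = fst x e (proj S m \<sigma>) - snd x (fst e \<sigma>)"
    using v(1) eval unfolding L_def by auto
qed

lemma transposed_pairing_linear_right:
  assumes x: "x \<in> fibre bidual_total m"
  shows "linear_from_to (fibre (total S) m) (fibre (side2 S) m) (transposed_pairing A S m x)"
  unfolding linear_from_to_def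
proof (intro conjI ballI allI)
  note d = DVB_sequenceD[OF D]
  have subV: "subspace (fibre (side2 S) m)" and subP: "subspace (fibre (total S) m)"
    by (rule vector_bundle_subspace[OF d(2)], rule vector_bundle_subspace[OF d(3)])
  fix \<sigma> assume \<sigma>: "\<sigma> \<in> fibre (total S) m"
  note p = transposed_pairing[OF x \<sigma>] and j = linear_from_toD[OF d(11)]
  note j\<sigma> = j(1)[OF \<sigma>]
  show "transposed_pairing A S m x \<sigma> \<in> fibre (side2 S) m" by (rule p(1))
  show "transposed_pairing A S m x (c *\<^sub>R \<sigma>) = c *\<^sub>R transposed_pairing A S m x \<sigma>" for c
  proof (rule transposed_pairing_eqI[OF subspace_scale[OF subV p(1)]])
    fix e assume e: "e \<in> fibre (dual_total A S) m"
    note fe = linear_from_toD[OF dual_total_memD(4)[OF e]]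
    show "snd e (c *\<^sub>R transposed_pairing A S m x \<sigma>) = fst x e (proj S m (c *\<^sub>R \<sigma>)) - snd x (fst e (c *\<^sub>R \<sigma>))"
      using linear_from_toD(3)[OF dual_spaceD[OF dual_total_memD(2)[OF e]] p(1)] p(2)[OF e]
        j(3)[OF \<sigma>] fe(3)[OF \<sigma>] linear_from_toD(3)[OF dual_spaceD[OF bidual_total_memD(4)[OF x e]] j\<sigma>]
        linear_from_toD(3)[OF dual_spaceD[OF bidual_total_memD(2)[OF x]] fe(1)[OF \<sigma>]]
      by (simp add: algebra_simps)
  qed
  fix \<sigma>' assume \<sigma>': "\<sigma>' \<in> fibre (total S) m"
  note p' = transposed_pairing[OF x \<sigma>']
  show "transposed_pairing A S m x (\<sigma> + \<sigma>') = transposed_pairing A S m x \<sigma> + transposed_pairing A S m x \<sigma>'"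
  proof (rule transposed_pairing_eqI[OF subspace_add[OF subV p(1) p'(1)]])
    fix e assume e: "e \<in> fibre (dual_total A S) m"
    note fe = linear_from_toD[OF dual_total_memD(4)[OF e]]
    show "snd e (transposed_pairing A S m x \<sigma> + transposed_pairing A S m x \<sigma>') =
        fst x e (proj S m (\<sigma> + \<sigma>')) - snd x (fst e (\<sigma> + \<sigma>'))"
      using linear_from_toD(2)[OF dual_spaceD[OF dual_total_memD(2)[OF e]] p(1) p'(1)] p(2)[OF e] p'(2)[OF e]
        j(2)[OF \<sigma> \<sigma>'] fe(2)[OF \<sigma> \<sigma>']
        linear_from_toD(2)[OF dual_spaceD[OF bidual_total_memD(4)[OF x e]] j\<sigma> j(1)[OF \<sigma>']]
        linear_from_toD(2)[OF dual_spaceD[OF bidual_total_memD(2)[OF x]] fe(1)[OF \<sigma>] fe(1)[OF \<sigma>']]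
      by (simp add: algebra_simps)
  qed
qed

lemma transposed_pairing_linear_left:
  assumes \<sigma>: "\<sigma> \<in> fibre (total S) m"
  shows "linear_from_to (fibre bidual_total m) (fibre (side2 S) m) (\<lambda>x. transposed_pairing A S m x \<sigma>)"
  unfolding linear_from_to_def
proof (intro conjI ballI allI)
  have subV: "subspace (fibre (side2 S) m)"
    by (rule vector_bundle_subspace[OF DVB_sequenceD(2)[OF D]])
  fix x assume x: "x \<in> fibre bidual_total m"
  note p = transposed_pairing[OF x \<sigma>]
  show "transposed_pairing A S m x \<sigma> \<in> fibre (side2 S) m" by (rule p(1))
  show "transposed_pairing A S m (c *\<^sub>R x) \<sigma> = c *\<^sub>R transposed_pairing A S m x \<sigma>" for c
  proof (rule transposed_pairing_eqI[OF subspace_scale[OF subV p(1)]])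
    fix e assume e: "e \<in> fibre (dual_total A S) m"
    show "snd e (c *\<^sub>R transposed_pairing A S m x \<sigma>) =
        fst (c *\<^sub>R x) e (proj S m \<sigma>) - snd (c *\<^sub>R x) (fst e \<sigma>)"
      using linear_from_toD(3)[OF dual_spaceD[OF dual_total_memD(2)[OF e]] p(1)] p(2)[OF e]
      by (simp add: scaleR_fun_def algebra_simps)
  qed
  fix x' assume x': "x' \<in> fibre bidual_total m"
  note p' = transposed_pairing[OF x' \<sigma>]
  show "transposed_pairing A S m (x + x') \<sigma> = transposed_pairing A S m x \<sigma> + transposed_pairing A S m x' \<sigma>"
  proof (rule transposed_pairing_eqI[OF subspace_add[OF subV p(1) p'(1)]])
    fix e assume e: "e \<in> fibre (dual_total A S) m"
    show "snd e (transposed_pairing A S m x \<sigma> + transposed_pairing A S m x' \<sigma>) =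
        fst (x + x') e (proj S m \<sigma>) - snd (x + x') (fst e \<sigma>)"
      using linear_from_toD(2)[OF dual_spaceD[OF dual_total_memD(2)[OF e]] p(1) p'(1)] p(2)[OF e] p'(2)[OF e]
      by simp
  qed
qed

lemma smooth_transposed_pairing:
  assumes W: "open W" and x: "smooth_section A bidual_total W x" and \<sigma>: "smooth_section A (total S) W \<sigma>"
  shows "smooth_section A (side2 S) W (\<lambda>m. transposed_pairing A S m (x m) (\<sigma> m))"
proof (rule smooth_section_dual_test[OF DVB_sequenceD(2)[OF D] W])
  note d = DVB_sequenceD[OF D]
  note S2 = DVB_sequence_side_dual[OF D]
  note DT = vector_bundle_dual_total[OF D] and K' = vector_bundle_dual[OF d(4)]
    and U' = vector_bundle_dual[OF d(1)] and V' = vector_bundle_dual[OF d(2)]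
  note xm = smooth_section_fibre[OF x] and \<sigma>m = smooth_section_fibre[OF \<sigma>]
  have x12: "smooth_section A (hom_bundle A (dual_total A S) (dual_bundle A (core S))) W (\<lambda>m. fst (x m))"
    "smooth_section A (dual_bundle A (side1 S)) W (\<lambda>m. snd (x m))"
    using x smooth_section_dual_total[OF DVB_sequence_flip_sides[OF S2] W, of x] by simp_all
  show "transposed_pairing A S m (x m) (\<sigma> m) \<in> fibre (side2 S) m" if "m \<in> W" for m
    by (rule transposed_pairing_in[OF xm[OF that] \<sigma>m[OF that]])
  fix W' \<beta> assume W': "open W'" "W' \<subseteq> W" and \<beta>: "smooth_section A (dual_bundle A (side2 S)) W' \<beta>"
  show "smooth_fun A W' (\<lambda>m. \<beta> m (transposed_pairing A S m (x m) (\<sigma> m)))"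
  proof (rule smooth_fun_local)
    fix m assume m: "m \<in> W'"
    show "\<exists>N. open N \<and> m \<in> N \<and> smooth_fun A N (\<lambda>m. \<beta> m (transposed_pairing A S m (x m) (\<sigma> m)))"
    proof (rule smooth_proj_section[OF S2, of m])
      fix N s assume N: "open N" "m \<in> N"
        and s: "\<And>y. y \<in> N \<Longrightarrow> linear_from_to (fibre (core (side_dual A S)) y) (fibre (total (side_dual A S)) y) (s y)"
        and ps: "\<And>y. y \<in> N \<Longrightarrow> \<forall>z\<in>fibre (core (side_dual A S)) y. proj (side_dual A S) y (s y z) = z"
        and ss: "\<And>V \<tau>. open V \<Longrightarrow> V \<subseteq> N \<Longrightarrow> smooth_section A (core (side_dual A S)) V \<tau> \<Longrightarrow>
          smooth_section A (total (side_dual A S)) V (\<lambda>y. s y (\<tau> y))"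
      define Q where "Q = N \<inter> W'"
      have Q: "open Q" "Q \<subseteq> N" "Q \<subseteq> W'" "Q \<subseteq> W" "m \<in> Q" using N W' m by (auto simp: Q_def)
      note \<beta>Q = smooth_section_subset[OF V' W'(1) Q(1,3) \<beta>]
      define e where "e = (\<lambda>y. s y (\<beta> y))"
      have e: "smooth_section A (dual_total A S) Q e"
        using ss[OF Q(1,2), of \<beta>] \<beta>Q unfolding e_def by simp
      have pe: "snd (e y) = \<beta> y" if "y \<in> Q" for y
        using bspec[OF ps[of y], of "\<beta> y"] smooth_section_fibre[OF \<beta>Q that] that Q(2) by (auto simp: e_def)
      note \<sigma>Q = smooth_section_subset[OF d(3) W Q(1,4) \<sigma>]
      have "smooth_fun A Q (\<lambda>y. fst (x y) (e y) (proj S y (\<sigma> y)) - snd (x y) (fst (e y) (\<sigma> y)))"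
      proof (rule smooth_fun_diff[OF Q(1)])
        show "smooth_fun A Q (\<lambda>y. fst (x y) (e y) (proj S y (\<sigma> y)))"
          by (rule smooth_fun_eval[OF d(4) Q(1) smooth_section_apply[OF DT K' Q(1)
                  smooth_section_subset[OF vector_bundle_hom[OF DT K'] W Q(1,4) x12(1)] e]
                bundle_mapD(2)[OF d(6) Q(1) \<sigma>Q]])
        have "smooth_section A (hom_bundle A (total S) (side1 S)) Q (\<lambda>y. fst (e y))"
          using e smooth_section_dual_total[OF D Q(1), of e] by blast
        from smooth_fun_eval[OF d(1) Q(1) smooth_section_subset[OF U' W Q(1,4) x12(2)]
            smooth_section_apply[OF d(3,1) Q(1) this \<sigma>Q]]
        show "smooth_fun A Q (\<lambda>y. snd (x y) (fst (e y) (\<sigma> y)))" .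
      qed
      then have "smooth_fun A Q (\<lambda>y. \<beta> y (transposed_pairing A S y (x y) (\<sigma> y)))"
      proof (rule smooth_fun_cong[OF Q(1), rotated])
        fix y assume y: "y \<in> Q"
        then have "y \<in> W" using Q(4) by blast
        show "fst (x y) (e y) (proj S y (\<sigma> y)) - snd (x y) (fst (e y) (\<sigma> y)) =
            \<beta> y (transposed_pairing A S y (x y) (\<sigma> y))"
          using transposed_pairing_eval[OF xm[OF \<open>y \<in> W\<close>] \<sigma>m[OF \<open>y \<in> W\<close>] smooth_section_fibre[OF e y]] pe[OF y]
          by simp
      qed
      then show "\<exists>N. open N \<and> m \<in> N \<and> smooth_fun A N (\<lambda>m. \<beta> m (transposed_pairing A S m (x m) (\<sigma> m)))"
        using Q(1,5) by blast
    qed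
  qed
qed

lemma in_duality_transposition:
  "in_duality A (transposition S)
    (identify_bidual (side2 S) (flip_sides (side_dual A (flip_sides (side_dual A S)))))"
proof -
  note d = DVB_sequenceD[OF D]
  let ?S3' = "side_dual A (flip_sides (side_dual A S))"
  let ?S3 = "identify_bidual (side2 S) (flip_sides ?S3')" and ?S4 = "transposition S"
  note S2' = DVB_sequence_flip_sides[OF DVB_sequence_side_dual[OF D]]
  note S3' = DVB_sequence_side_dual[OF S2']
  have S3: "DVB_sequence A ?S3"
    by (rule DVB_sequence_identify_bidual[OF DVB_sequence_flip_sides[OF S3'] d(2)]) simp
  have pair: "bilinear_pairing A bidual_total (total S) (side2 S) (transposed_pairing A S)"
    unfolding bilinear_pairing_def
  proof (intro conjI allI impI ballI; (elim conjE)?)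
    show "linear_from_to (fibre (total S) m) (fibre (side2 S) m) (transposed_pairing A S m x)"
      if "x \<in> fibre bidual_total m" for m x by (rule transposed_pairing_linear_right[OF that])
    show "linear_from_to (fibre bidual_total m) (fibre (side2 S) m) (\<lambda>x. transposed_pairing A S m x \<sigma>)"
      if "\<sigma> \<in> fibre (total S) m" for m \<sigma> by (rule transposed_pairing_linear_left[OF that])
    show "smooth_section A (side2 S) W (\<lambda>m. transposed_pairing A S m (x m) (\<sigma> m))"
      if "open W" "smooth_section A bidual_total W x" "smooth_section A (total S) W \<sigma>" for W x \<sigma>
      by (rule smooth_transposed_pairing[OF that])
  qed
  have first: "transposed_pairing A S m x (incl ?S4 m \<theta>) = contract (fibre (side2 S) m) (snd x) \<theta>"
    if x: "x \<in> fibre bidual_total m" and \<theta>: "\<theta> \<in> tensor_space (fibre (side2 S) m) (fibre (side1 S) m)" for m x \<theta>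
  proof (rule transposed_pairing_eqI)
    note finV = vector_bundle_finite_dim[OF d(2)] and finU = vector_bundle_finite_dim[OF d(1)]
    note \<mu> = bidual_total_memD(2)[OF x]
    note fl = flip_tensor_space[OF \<theta>]
    note i = DVB_sequence_incl[OF D fl]
    note subP = vector_bundle_subspace[OF d(3)]
    show "contract (fibre (side2 S) m) (snd x) \<theta> \<in> fibre (side2 S) m"
      by (rule contract_in[OF finV \<theta> \<mu>])
    fix e assume e: "e \<in> fibre (dual_total A S) m"
    note \<beta> = dual_total_memD(2)[OF e]
    have "proj S m (incl ?S4 m \<theta>) = 0"
      using linear_from_toD(3)[OF d(11) i(1), of "-1"] i(2) by simp
    then have "fst x e (proj S m (incl ?S4 m \<theta>)) = 0"
      using linear_from_to_0[OF dual_spaceD[OF bidual_total_memD(4)[OF x e]] vector_bundle_subspace[OF d(4)]]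
      by simp
    moreover have "fst e (incl ?S4 m \<theta>) = - contract (fibre (side1 S) m) (snd e) (flip \<theta>)"
      using linear_from_toD(3)[OF dual_total_memD(4)[OF e] i(1), of "-1"] dual_total_memD(3)[OF e fl]
      by simp
    moreover have "snd x (- contract (fibre (side1 S) m) (snd e) (flip \<theta>)) =
        - snd x (contract (fibre (side1 S) m) (snd e) (flip \<theta>))"
      using linear_from_toD(3)[OF dual_spaceD[OF \<mu>] contract_in[OF finU fl \<beta>], of "-1"] by simp
    moreover have "snd x (contract (fibre (side1 S) m) (snd e) (flip \<theta>)) = \<theta> (snd e) (snd x)"
      using contract_eval[OF finU fl \<beta> \<mu>] by (simp add: flip_def)
    moreover have "snd e (contract (fibre (side2 S) m) (snd x) \<theta>) = \<theta> (snd e) (snd x)"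
      by (rule contract_eval[OF finV \<theta> \<mu> \<beta>])
    ultimately show "snd e (contract (fibre (side2 S) m) (snd x) \<theta>) =
        fst x e (proj S m (incl ?S4 m \<theta>)) - snd x (fst e (incl ?S4 m \<theta>))" by simp
  qed
  have second: "transposed_pairing A S m (incl ?S3 m \<kappa>) \<sigma> =
      contract (fibre (side2 S) m) (bidual_embed (fibre (core S) m) (proj S m \<sigma>)) \<kappa>"
    if \<sigma>: "\<sigma> \<in> fibre (total S) m" and \<kappa>: "\<kappa> \<in> tensor_space (fibre (side2 S) m) (dual_space (fibre (core S) m))"
    for m \<sigma> \<kappa>
  proof (rule transposed_pairing_eqI)
    note finV = vector_bundle_finite_dim[OF d(2)] and finK = vector_bundle_finite_dim[OF d(4)]
    let ?V = "fibre (side2 S) m" and ?K = "fibre (core S) m"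
    show "contract ?V (bidual_embed ?K (proj S m \<sigma>)) \<kappa> \<in> ?V"
      by (rule contract_in[OF finV \<kappa> bidual_embed_in])
    fix e assume e: "e \<in> fibre (dual_total A S) m"
    note \<beta> = dual_total_memD(2)[OF e]
    let ?\<kappa> = "flip (tensor_bidual ?V \<kappa>)"
    have k: "?\<kappa> \<in> tensor_space (dual_space ?K) (dual_space (dual_space ?V))"
      by (rule flip_tensor_space[OF tensor_bidual_in[OF finite_dim_subspace[OF finV] \<kappa>]])
    have i: "fst (incl ?S3 m \<kappa>) e = contract (dual_space ?K) (bidual_embed (dual_space ?V) (snd e)) ?\<kappa>"
      "snd (incl ?S3 m \<kappa>) = 0"
      using e by (simp_all add: incl_side_dual restrict0_in)
    have "fst (incl ?S3 m \<kappa>) e (proj S m \<sigma>) =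
        bidual_embed ?K (proj S m \<sigma>) (contract (dual_space ?K) (bidual_embed (dual_space ?V) (snd e)) ?\<kappa>)"
      unfolding i(1)
      using bidual_embed_eval[OF contract_in[OF finite_dim_dual[OF finK] k bidual_embed_in], of "proj S m \<sigma>" "snd e"]
      by simp
    also have "\<dots> = ?\<kappa> (bidual_embed ?K (proj S m \<sigma>)) (bidual_embed (dual_space ?V) (snd e))"
      by (rule contract_eval[OF finite_dim_dual[OF finK] k bidual_embed_in bidual_embed_in])
    also have "\<dots> = \<kappa> (snd e) (bidual_embed ?K (proj S m \<sigma>))"
      using tensor_bidual_embed[OF \<beta>, of \<kappa>] by (simp add: flip_def)
    also have "\<dots> = snd e (contract ?V (bidual_embed ?K (proj S m \<sigma>)) \<kappa>)"
      by (rule contract_eval[OF finV \<kappa> bidual_embed_in \<beta>, symmetric])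
    finally show "snd e (contract ?V (bidual_embed ?K (proj S m \<sigma>)) \<kappa>) =
        fst (incl ?S3 m \<kappa>) e (proj S m \<sigma>) - snd (incl ?S3 m \<kappa>) (fst e \<sigma>)"
      by (simp only: i(2)) simp
  qed
  show ?thesis
    unfolding in_duality_def
  proof (intro conjI exI[of _ "transposed_pairing A S"] allI ballI)
    show "DVB_sequence A ?S4" by (rule DVB_sequence_transposition[OF D])
    show "DVB_sequence A ?S3" by (rule S3)
    show "bilinear_pairing A (total ?S3) (total ?S4) (side1 ?S4) (transposed_pairing A S)"
      using pair by simp
    show "transposed_pairing A S m x (incl ?S4 m \<theta>) = contract (fibre (side1 ?S4) m) (proj ?S3 m x) \<theta>"
      if "x \<in> fibre (total ?S3) m" "\<theta> \<in> tensor_space (fibre (side1 ?S4) m) (fibre (side2 ?S4) m)" for m x \<theta>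
      using first[of x m \<theta>] that by (simp del: transposition_sel(6))
    show "transposed_pairing A S m (incl ?S3 m \<kappa>) \<sigma> =
        contract (fibre (side1 ?S4) m) (bidual_embed (fibre (core ?S4) m) (proj ?S4 m \<sigma>)) \<kappa>"
      if "\<sigma> \<in> fibre (total ?S4) m" "\<kappa> \<in> tensor_space (fibre (side1 ?S4) m) (fibre (side2 ?S3) m)" for m \<sigma> \<kappa>
      using second[of \<sigma> m \<kappa>] that by (simp del: identify_bidual_sel(6))
  qed simp_all
qed

end

end

theorem theorem4p6:
  fixes A :: "('m::{t2_space,second_countable_topology}, 'b::real_normed_vector) atlas"
    and U :: "('m, 'u::real_vector) vbundle" and V :: "('m, 'v::real_vector) vbundle"
    and P :: "('m, 'p::real_vector) vbundle" and K :: "('m, 'k::real_vector) vbundle"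
    and i :: "'m \<Rightarrow> ('u, 'v) tensor \<Rightarrow> 'p" and j :: "'m \<Rightarrow> 'p \<Rightarrow> 'k"
  assumes "smooth_manifold A"
    and S1: "S1 = \<lparr>side1 = U, side2 = V, total = P, core = K, incl = i, proj = j\<rparr>"
    and "DVB_sequence A S1"
    and S2: "S2 = side_dual A S1"
    and S3': "S3' = side_dual A (flip_sides S2)"
    and S3: "S3 = identify_bidual V (flip_sides S3')"
    and S4: "S4 = transposition S1"
  shows "in_duality A S1 S2 \<and> in_duality A (flip_sides S2) S3' \<and> in_duality A S4 S3"
proof (intro conjI)
  interpret smooth_base A by unfold_locales (rule \<open>smooth_manifold A\<close>)
  note D = \<open>DVB_sequence A S1\<close>
  show "in_duality A S1 S2" unfolding S2 by (rule in_duality_side_dual[OF D])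
  show "in_duality A (flip_sides S2) S3'"
    unfolding S3' S2
    by (rule in_duality_side_dual[OF DVB_sequence_flip_sides[OF DVB_sequence_side_dual[OF D]]])
  have "V = side2 S1" by (simp add: S1)
  then show "in_duality A S4 S3"
    unfolding S4 S3 S3' S2 by (simp only: in_duality_transposition[OF D])
qed

end
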